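(* Let $\pi_1:V_1\to X_1$ and $\pi_2:V_2\to X_2$ be finite-dimensional locally trivial diffeological vector pseudo-bundles, let $(\tilde f,f)$ be a gluing of the former to the latter such that $f$ and $\tilde f^*$ are diffeomorphisms (of their domains with their images), and let $g_1,g_2$ be pseudo-metrics on $V_1,V_2$ compatible with this gluing. Then the map $\Phi_{\cup,*}^{C\ell}:C\ell((V_1\cup_{\tilde f}V_2)^*,\tilde g^* )\to C\ell(V_2^*\cup_{\tilde f^*}V_1^*,\widetilde{g^*})$ given by the identity $$\Phi_{\cup,*}^{C\ell}\circ\pi^{T((V_1\cup_{\tilde f}V_2)^* )}=\pi^{T(V_2^*\cup_{\tilde f^*}V_1^* )}\circ\left(\bigoplus_n\Phi_{\cup,*}^{\otimes n}\right)$$ is a well-defined diffeomorphism, where $\pi^{T((V_1\cup_{\tilde f}V_2)^* )}:T((V_1\cup_{\tilde f}V_2)^* )\to C\ell((V_1\cup_{\tilde f}V_2)^*,\tilde g^* )$ and $\pi^{T(V_2^*\cup_{\tilde f^*}V_1^* )}:T(V_2^*\cup_{\tilde f^*}V_1^* )\to C\ell(V_2^*\cup_{\tilde f^*}V_1^*,\widetilde{g^*})$ are the quotient projections.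
   Context: Diffeological spaces, plots, smooth maps, and the subset, quotient, product, disjoint union and functional diffeologies are in the usual sense of Souriau. $E^*$ denotes the space of smooth linear maps $E\to\mathbb R$ on a diffeological vector space $E$, with the functional diffeology. Pseudo-bundles. A diffeological vector pseudo-bundle is a smooth surjective map $\pi:V\to X$ of diffeological spaces with a vector space structure on each fibre such that fibrewise addition $V\times_XV\to V$, scalar multiplication $\mathbb R\times V\to V$ and the zero section are smooth. The dual pseudo-bundle is $V^*=\bigcup_{x}(\pi^{-1}(x))^*$ with projection $\pi^*$; $q:U'\to V^*$ is a plot iff for every plot $p:U\to V$ the map $(u',u)\mapsto q(u')(p(u))$ is smooth on the set where $q(u')$ and $p(u)$ lie over the same point. $V\oplus V'$ is $V\times_XV'$ with the subset diffeology; $V\otimes V'$ is the fibrewise tensor product, with the finest pseudo-bundle diffeology making $V\times_XV'\to V\otimes V'$ smooth. A pseudo-metric on $V$ (finite-dimensional fibres) is a smooth section $g$ of $V^*\otimes V^*$ such that each $g(x)$ is a symmetric positive semi-definite form of rank $\dim((\pi^{-1}(x))^* )$. The dual pseudo-metric $g^*$ on $V^*$ is defined by $g^*(x)(\Psi_g(v),\Psi_g(w))=g(x)(v,w)$, where $\Psi_g(v)=g(\pi(v))(v,\cdot)$ (fibrewise surjective onto $V^*$). Gluing. For $h:Z_1\supseteq Y'\to Z_2$ smooth, $Z_1\cup_hZ_2=(Z_1\sqcup Z_2)/(z\sim h(z))$ with the quotient of the disjoint union diffeology. The natural inclusions of $Z_1\setminus Y'$ and of $Z_2$ have disjoint images covering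 it; they are denoted $i_1^{Z_1},i_2^{Z_2}$ for base spaces and $j_1^{Z_1},j_2^{Z_2}$ for total spaces. A gluing $(\tilde f,f)$ consists of a smooth $f:X_1\supseteq Y\to X_2$ and a smooth fibrewise linear lift $\tilde f:\pi_1^{-1}(Y)\to V_2$; it yields the pseudo-bundle $V_1\cup_{\tilde f}V_2\to X_1\cup_fX_2$. The map $\tilde f^*:(\pi_2^* )^{-1}(f(Y))\to V_1^*$ is $\xi\mapsto\xi\circ\tilde f|_{\pi_1^{-1}(y)}$ for $\xi\in(\pi_2^{-1}(f(y)))^*$; it lifts $f^{-1}$ and gives the gluing $V_2^*\cup_{\tilde f^*}V_1^*\to X_2\cup_{f^{-1}}X_1$. Pseudo-metrics $g_1,g_2$ are compatible with $(\tilde f,f)$ if $g_1(y)(v,w)=g_2(f(y))(\tilde f(v),\tilde f(w))$ for all $y\in Y$, $v,w\in\pi_1^{-1}(y)$. Then $\tilde g$ is the pseudo-metric on $V_1\cup_{\tilde f}V_2$ equal to $g_1$ (via $j_1^{V_1}$) over $i_1^{X_1}(X_1\setminus Y)$ and to $g_2$ (via $j_2^{V_2}$) over $i_2^{X_2}(X_2)$; $\tilde g^*$ is its dual. $\widetilde{g^*}$ is the pseudo-metric on $V_2^*\cup_{\tilde f^*}V_1^*$ equal to $g_2^*$ (via $j_1^{V_2^*}$) over $i_1^{X_2}(X_2\setminus f(Y))$ and to $g_1^*$ (via $j_2^{V_1^*}$) over $i_2^{X_1}(X_1)$. The gluing-dual commutativity diffeomorphism $\Phi_{\cup,*}:(V_1\cup_{\tilde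 f}V_2)^*\to V_2^*\cup_{\tilde f^*}V_1^*$ (which exists under the hypotheses) is $j_2^{V_1^*}\circ(j_1^{V_1})^*$ over $i_1^{X_1}(X_1\setminus Y)$, $j_2^{V_1^*}\circ\tilde f^*\circ(j_2^{V_2})^*$ over $i_2^{X_2}(f(Y))$, and $j_1^{V_2^*}\circ(j_2^{V_2})^*$ over $i_2^{X_2}(X_2\setminus f(Y))$, where $(j_i^{V_i})^*$ is fibrewise pre-composition with $j_i^{V_i}$. Clifford algebras. The dimensions of all fibres are assumed bounded. $T(V)$ is the pseudo-bundle of tensor algebras of the fibres (finite direct sums of tensor powers, up to the maximal fibre dimension, suffice). $C\ell(V,g)=\bigcup_xC\ell(\pi^{-1}(x),g(x))$, where the Clifford algebra is the quotient of the tensor algebra by the relations $v\otimes w+w\otimes v+2g(x)(v,w)=0$, with the quotient diffeology from $T(V)$.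
   Formalization: Plots of the dual pseudo-bundle are additionally required to project under π* to plots of the base; with the evaluation condition alone, zero covectors over arbitrary maps are plots, so π* is not smooth and V* is not a pseudo-bundle. *)

theory Defs
  imports
    "HOL-Analysis.Analysis"
    "HOL-Algebra.QuotRing"
    "HOL-Algebra.Algebraic_Closure_Type"
    "HOL-Library.Poly_Mapping"
begin

section \<open>Smooth maps between open subsets of Euclidean spaces\<close>

text \<open>The space of dimension \<open>n\<close> is the library's \<^const>\<open>Euclidean_space\<close>: functions
  \<open>nat \<Rightarrow> real\<close> that vanish from index \<open>n\<close> on.\<close>

primrec Ck_on :: "nat \<Rightarrow> nat \<Rightarrow> (nat \<Rightarrow> real) set \<Rightarrow> ((nat \<Rightarrow> real) \<Rightarrow> real) \<Rightarrow> bool" where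
  "Ck_on 0 n U f \<longleftrightarrow> continuous_map (subtopology (Euclidean_space n) U) euclideanreal f"
| "Ck_on (Suc k) n U f \<longleftrightarrow>
     (\<forall>i<n. \<exists>f'. (\<forall>x\<in>U. ((\<lambda>t. f (x(i := t))) has_real_derivative f' x) (at (x i))) \<and>
                Ck_on k n U f')"

definition Cinf_on :: "nat \<Rightarrow> (nat \<Rightarrow> real) set \<Rightarrow> ((nat \<Rightarrow> real) \<Rightarrow> real) \<Rightarrow> bool" where
  "Cinf_on n U f \<longleftrightarrow> openin (Euclidean_space n) U \<and> (\<forall>k. Ck_on k n U f)"

definition Cinf_map :: "nat \<Rightarrow> (nat \<Rightarrow> real) set \<Rightarrow> nat \<Rightarrow> ((nat \<Rightarrow> real) \<Rightarrow> nat \<Rightarrow> real) \<Rightarrow> bool" where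
  "Cinf_map n U m h \<longleftrightarrow> openin (Euclidean_space n) U \<and> h ` U \<subseteq> topspace (Euclidean_space m) \<and>
     (\<forall>i<m. Cinf_on n U (\<lambda>x. h x i))"


section \<open>Diffeological spaces\<close>

text \<open>\<open>plots Z n U p\<close> says that \<open>p\<close> is a plot of \<open>Z\<close> with domain the open set \<open>U\<close> of
  \<open>n\<close>-space; the values of \<open>p\<close> outside \<open>U\<close> are irrelevant.\<close>

record 'a dspace =
  points :: "'a set"
  plots :: "nat \<Rightarrow> (nat \<Rightarrow> real) set \<Rightarrow> ((nat \<Rightarrow> real) \<Rightarrow> 'a) \<Rightarrow> bool"

definition locally_on :: "nat \<Rightarrow> (nat \<Rightarrow> real) set \<Rightarrow> ((nat \<Rightarrow> real) set \<Rightarrow> bool) \<Rightarrow> bool" where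
  "locally_on n U P \<longleftrightarrow> (\<forall>u\<in>U. \<exists>W. openin (Euclidean_space n) W \<and> u \<in> W \<and> W \<subseteq> U \<and> P W)"

definition diffeology :: "'a dspace \<Rightarrow> bool" where
  "diffeology Z \<longleftrightarrow>
     (\<forall>n U p. plots Z n U p \<longrightarrow> openin (Euclidean_space n) U \<and> p ` U \<subseteq> points Z) \<and>
     (\<forall>n U p q. plots Z n U p \<and> (\<forall>u\<in>U. p u = q u) \<longrightarrow> plots Z n U q) \<and>
     (\<forall>n U a. openin (Euclidean_space n) U \<and> a \<in> points Z \<longrightarrow> plots Z n U (\<lambda>_. a)) \<and>
     (\<forall>n U p. openin (Euclidean_space n) U \<and> locally_on n U (\<lambda>W. plots Z n W p) \<longrightarrow> plots Z n U p) \<and>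
     (\<forall>n U p m W h. plots Z n U p \<and> Cinf_map m W n h \<and> h ` W \<subseteq> U \<longrightarrow> plots Z m W (p \<circ> h))"

definition dsmooth :: "'a dspace \<Rightarrow> 'b dspace \<Rightarrow> ('a \<Rightarrow> 'b) \<Rightarrow> bool" where
  "dsmooth Z Y f \<longleftrightarrow> f ` points Z \<subseteq> points Y \<and>
     (\<forall>n U p. plots Z n U p \<longrightarrow> plots Y n U (f \<circ> p))"

definition diffeomorphism :: "'a dspace \<Rightarrow> 'b dspace \<Rightarrow> ('a \<Rightarrow> 'b) \<Rightarrow> bool" where
  "diffeomorphism Z Y f \<longleftrightarrow> bij_betw f (points Z) (points Y) \<and> dsmooth Z Y f \<and>
     dsmooth Y Z (inv_into (points Z) f)"

definition euclid_ds :: "nat \<Rightarrow> (nat \<Rightarrow> real) dspace" where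
  "euclid_ds m = \<lparr>points = topspace (Euclidean_space m), plots = (\<lambda>n U h. Cinf_map n U m h)\<rparr>"

definition real_ds :: "real dspace" where
  "real_ds = \<lparr>points = UNIV, plots = Cinf_on\<rparr>"

definition subset_ds :: "'a dspace \<Rightarrow> 'a set \<Rightarrow> 'a dspace" where
  "subset_ds Z A = \<lparr>points = points Z \<inter> A, plots = (\<lambda>n U p. plots Z n U p \<and> p ` U \<subseteq> A)\<rparr>"

definition prod_ds :: "'a dspace \<Rightarrow> 'b dspace \<Rightarrow> ('a \<times> 'b) dspace" where
  "prod_ds Z Y = \<lparr>points = points Z \<times> points Y,
     plots = (\<lambda>n U p. plots Z n U (fst \<circ> p) \<and> plots Y n U (snd \<circ> p))\<rparr>"

definition sum_ds :: "'a dspace \<Rightarrow> 'b dspace \<Rightarrow> ('a + 'b) dspace" where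
  "sum_ds Z Y = \<lparr>points = Inl ` points Z \<union> Inr ` points Y,
     plots = (\<lambda>n U p. openin (Euclidean_space n) U \<and>
       locally_on n U (\<lambda>W. (\<exists>q. plots Z n W q \<and> (\<forall>u\<in>W. p u = Inl (q u))) \<or>
                           (\<exists>q. plots Y n W q \<and> (\<forall>u\<in>W. p u = Inr (q u)))))\<rparr>"

text \<open>Quotient diffeology, the quotient being given by its projection \<open>k\<close>.\<close>

definition quotient_ds :: "'a dspace \<Rightarrow> ('a \<Rightarrow> 'b) \<Rightarrow> 'b dspace" where
  "quotient_ds Z k = \<lparr>points = k ` points Z,
     plots = (\<lambda>n U p. openin (Euclidean_space n) U \<and>
       locally_on n U (\<lambda>W. \<exists>q. plots Z n W q \<and> (\<forall>u\<in>W. p u = k (q u))))\<rparr>"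

definition D_open :: "'a dspace \<Rightarrow> 'a set \<Rightarrow> bool" where
  "D_open Z A \<longleftrightarrow> A \<subseteq> points Z \<and>
     (\<forall>n U p. plots Z n U p \<longrightarrow> openin (Euclidean_space n) {u \<in> U. p u \<in> A})"


section \<open>Real vector spaces with carrier sets\<close>

text \<open>Real vector spaces are modules in the sense of \<^theory>\<open>HOL-Algebra.Module\<close>; their fields
  \<open>mult\<close> and \<open>one\<close> play no role.\<close>

abbreviation real_fld :: "real ring" where
  "real_fld \<equiv> ring_of_type_algebra"

definition real_mod :: "(real, real) module" where
  "real_mod = \<lparr>carrier = UNIV, mult = undefined, one = undefined, zero = 0, add = (+), smult = (*)\<rparr>"

definition lin_map :: "(real, 'a) module \<Rightarrow> (real, 'b) module \<Rightarrow> ('a \<Rightarrow> 'b) \<Rightarrow> bool" where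
  "lin_map M N h \<longleftrightarrow> h \<in> carrier M \<rightarrow> carrier N \<and>
     (\<forall>v\<in>carrier M. \<forall>w\<in>carrier M. h (v \<oplus>\<^bsub>M\<^esub> w) = h v \<oplus>\<^bsub>N\<^esub> h w) \<and>
     (\<forall>c. \<forall>v\<in>carrier M. h (c \<odot>\<^bsub>M\<^esub> v) = c \<odot>\<^bsub>N\<^esub> h v)"

definition vs_basis :: "(real, 'a) module \<Rightarrow> 'a set \<Rightarrow> bool" where
  "vs_basis M B \<longleftrightarrow> finite B \<and> B \<subseteq> carrier M \<and>
     (\<forall>v\<in>carrier M. \<exists>!c. c \<in> extensional B \<and> v = (\<Oplus>\<^bsub>M\<^esub>b\<in>B. c b \<odot>\<^bsub>M\<^esub> b))"

definition vs_dim :: "(real, 'a) module \<Rightarrow> nat \<Rightarrow> bool" where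
  "vs_dim M n \<longleftrightarrow> (\<exists>B. vs_basis M B \<and> card B = n)"


section \<open>Diffeological vector pseudo-bundles\<close>

record ('v, 'x) pbundle =
  tot :: "'v dspace"
  base :: "'x dspace"
  proj :: "'v \<Rightarrow> 'x"
  vadd :: "'v \<Rightarrow> 'v \<Rightarrow> 'v"
  vscale :: "real \<Rightarrow> 'v \<Rightarrow> 'v"
  vzero :: "'x \<Rightarrow> 'v"

definition preim :: "('v, 'x) pbundle \<Rightarrow> 'x set \<Rightarrow> 'v set" where
  "preim V A = {v \<in> points (tot V). proj V v \<in> A}"

definition fibre :: "('v, 'x) pbundle \<Rightarrow> 'x \<Rightarrow> 'v set" where
  "fibre V x = preim V {x}"

definition fibre_mod :: "('v, 'x) pbundle \<Rightarrow> 'x \<Rightarrow> (real, 'v) module" where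
  "fibre_mod V x = \<lparr>carrier = fibre V x, mult = undefined, one = undefined,
     zero = vzero V x, add = vadd V, smult = vscale V\<rparr>"

definition pseudo_bundle :: "('v, 'x) pbundle \<Rightarrow> bool" where
  "pseudo_bundle V \<longleftrightarrow> diffeology (tot V) \<and> diffeology (base V) \<and>
     dsmooth (tot V) (base V) (proj V) \<and> proj V ` points (tot V) = points (base V) \<and>
     (\<forall>x\<in>points (base V). Module.module real_fld (fibre_mod V x)) \<and>
     dsmooth (subset_ds (prod_ds (tot V) (tot V)) {(v, w). proj V v = proj V w}) (tot V)
       (\<lambda>(v, w). vadd V v w) \<and>
     dsmooth (prod_ds real_ds (tot V)) (tot V) (\<lambda>(c, v). vscale V c v) \<and>
     dsmooth (base V) (tot V) (vzero V)"

definition bounded_dim :: "('v, 'x) pbundle \<Rightarrow> bool" where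
  "bounded_dim V \<longleftrightarrow> (\<exists>N. \<forall>x\<in>points (base V). \<exists>n\<le>N. vs_dim (fibre_mod V x) n)"

text \<open>A local trivialization near \<open>x\<close> may be taken to have the fibre over \<open>x\<close> itself as typical
  fibre.\<close>

definition locally_trivial :: "('v, 'x) pbundle \<Rightarrow> bool" where
  "locally_trivial V \<longleftrightarrow> (\<forall>x\<in>points (base V). \<exists>A \<phi>. D_open (base V) A \<and> x \<in> A \<and>
     diffeomorphism (prod_ds (subset_ds (base V) A) (subset_ds (tot V) (fibre V x)))
       (subset_ds (tot V) (preim V A)) \<phi> \<and>
     (\<forall>a\<in>A. lin_map (fibre_mod V x) (fibre_mod V a) (\<lambda>v. \<phi> (a, v))))"


section \<open>The dual pseudo-bundle\<close>

definition dual_space :: "('v, 'x) pbundle \<Rightarrow> 'x \<Rightarrow> ('v \<Rightarrow> real) set" where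
  "dual_space V x = {\<xi> \<in> extensional (fibre V x).
     lin_map (fibre_mod V x) real_mod \<xi> \<and> dsmooth (subset_ds (tot V) (fibre V x)) real_ds \<xi>}"

text \<open>A point of the product of \<open>m\<close>-space with another Euclidean space is given by
  concatenating coordinates.\<close>

definition fst_part :: "nat \<Rightarrow> (nat \<Rightarrow> real) \<Rightarrow> nat \<Rightarrow> real" where
  "fst_part m w = (\<lambda>i. if i < m then w i else 0)"

definition snd_part :: "nat \<Rightarrow> (nat \<Rightarrow> real) \<Rightarrow> nat \<Rightarrow> real" where
  "snd_part m w = (\<lambda>i. w (i + m))"

text \<open>The elements of the dual carry their base point. Plots are required to project to plots
  of the base: the condition on evaluations alone does not make the projection smooth (it says
  nothing about zero covectors), so without this the dual would not be a pseudo-bundle.\<close>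

definition dual :: "('v, 'x) pbundle \<Rightarrow> ('x \<times> ('v \<Rightarrow> real), 'x) pbundle" where
  "dual V = \<lparr>
     tot = \<lparr>points = Sigma (points (base V)) (dual_space V),
       plots = (\<lambda>m U q. q ` U \<subseteq> Sigma (points (base V)) (dual_space V) \<and>
         plots (base V) m U (fst \<circ> q) \<and>
         (\<forall>n U' p. plots (tot V) n U' p \<longrightarrow>
            dsmooth
              (subset_ds (euclid_ds (m + n))
                {w. fst_part m w \<in> U \<and> snd_part m w \<in> U' \<and>
                    fst (q (fst_part m w)) = proj V (p (snd_part m w))})
              real_ds
              (\<lambda>w. snd (q (fst_part m w)) (p (snd_part m w)))))\<rparr>,
     base = base V,
     proj = fst,
     vadd = (\<lambda>(x, \<xi>) (_, \<eta>). (x, \<lambda>v\<in>fibre V x. \<xi> v + \<eta> v)),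
     vscale = (\<lambda>c (x, \<xi>). (x, \<lambda>v\<in>fibre V x. c * \<xi> v)),
     vzero = (\<lambda>x. (x, \<lambda>v\<in>fibre V x. 0))\<rparr>"


section \<open>Tensor algebras and tensor powers\<close>

text \<open>With concatenation as addition on lists, the type \<open>'v list \<Rightarrow>\<^sub>0 real\<close> with its library
  multiplication is the free associative real algebra on \<open>'v\<close>.\<close>

instantiation list :: (type) monoid_add
begin

definition zero_list :: "'a list" where "zero_list = []"

definition plus_list :: "'a list \<Rightarrow> 'a list \<Rightarrow> 'a list" where "plus_list = (@)"

instance
  by standard (simp_all add: zero_list_def plus_list_def)

end

definition free_alg :: "('v, 'x) pbundle \<Rightarrow> 'x \<Rightarrow> ('v list \<Rightarrow>\<^sub>0 real) ring" where
  "free_alg V x =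
     (ring_of_type_algebra :: ('v list \<Rightarrow>\<^sub>0 real) ring)\<lparr>carrier := {p. Poly_Mapping.keys p \<subseteq> lists (fibre V x)}\<rparr>"

text \<open>The linear span of the multilinearity relations, in all tensor degrees at once.\<close>

definition tensor_rels :: "('v, 'x) pbundle \<Rightarrow> 'x \<Rightarrow> ('v list \<Rightarrow>\<^sub>0 real) set" where
  "tensor_rels V x = Modules.module.span (\<lambda>c. Poly_Mapping.map ((*) c))
     ({Poly_Mapping.single (xs @ [vadd V v w] @ ys) 1
         - Poly_Mapping.single (xs @ [v] @ ys) 1 - Poly_Mapping.single (xs @ [w] @ ys) 1 | xs ys v w.
         xs \<in> lists (fibre V x) \<and> ys \<in> lists (fibre V x) \<and> v \<in> fibre V x \<and> w \<in> fibre V x} \<union>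
      {Poly_Mapping.single (xs @ [vscale V c v] @ ys) 1 - Poly_Mapping.single (xs @ [v] @ ys) c | xs ys c v.
         xs \<in> lists (fibre V x) \<and> ys \<in> lists (fibre V x) \<and> v \<in> fibre V x})"

definition tensor_alg :: "('v, 'x) pbundle \<Rightarrow> 'x \<Rightarrow> ('v list \<Rightarrow>\<^sub>0 real) set ring" where
  "tensor_alg V x = free_alg V x Quot tensor_rels V x"

definition tens :: "('v, 'x) pbundle \<Rightarrow> 'x \<Rightarrow> ('v list \<Rightarrow>\<^sub>0 real) \<Rightarrow> ('v list \<Rightarrow>\<^sub>0 real) set" where
  "tens V x p = tensor_rels V x +>\<^bsub>free_alg V x\<^esub> p"

text \<open>The \<open>n\<close>-fold tensor power of a fibre: formal combinations of \<open>n\<close>-tuples modulo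
  multilinearity, as a subspace of the tensor algebra.\<close>

definition tensor_power_space :: "nat \<Rightarrow> ('v, 'x) pbundle \<Rightarrow> 'x \<Rightarrow> ('v list \<Rightarrow>\<^sub>0 real) set set" where
  "tensor_power_space n V x = tens V x ` {p. Poly_Mapping.keys p \<subseteq> {l \<in> lists (fibre V x). length l = n}}"

definition fibre_power :: "nat \<Rightarrow> ('v, 'x) pbundle \<Rightarrow> ('x \<times> 'v list) dspace" where
  "fibre_power n V =
     (let P = (SIGMA x:points (base V). {l \<in> lists (fibre V x). length l = n}) in
      \<lparr>points = P,
       plots = (\<lambda>m U q. q ` U \<subseteq> P \<and> plots (base V) m U (fst \<circ> q) \<and>
         (\<forall>i<n. plots (tot V) m U (\<lambda>u. snd (q u) ! i)))\<rparr>)"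

text \<open>The \<open>n\<close>-fold tensor power with an arbitrary set \<open>D\<close> of plots on its total space. Scalars
  act through multiples of the unit of the tensor algebra.\<close>

definition tensor_power_with ::
    "(nat \<Rightarrow> (nat \<Rightarrow> real) set \<Rightarrow> ((nat \<Rightarrow> real) \<Rightarrow> 'x \<times> ('v list \<Rightarrow>\<^sub>0 real) set) \<Rightarrow> bool)
      \<Rightarrow> nat \<Rightarrow> ('v, 'x) pbundle \<Rightarrow> ('x \<times> ('v list \<Rightarrow>\<^sub>0 real) set, 'x) pbundle" where
  "tensor_power_with D n V = \<lparr>
     tot = \<lparr>points = Sigma (points (base V)) (tensor_power_space n V), plots = D\<rparr>,
     base = base V,
     proj = fst,
     vadd = (\<lambda>(x, s) (_, t). (x, s \<oplus>\<^bsub>tensor_alg V x\<^esub> t)),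
     vscale = (\<lambda>c (x, t). (x, tens V x (Poly_Mapping.single [] c) \<otimes>\<^bsub>tensor_alg V x\<^esub> t)),
     vzero = (\<lambda>x. (x, \<zero>\<^bsub>tensor_alg V x\<^esub>))\<rparr>"

text \<open>The finest pseudo-bundle diffeology making the universal multilinear map smooth, as the
  intersection of all such diffeologies. The case \<open>n = 2\<close> is the tensor product of \<open>V\<close> with
  itself.\<close>

definition tensor_power :: "nat \<Rightarrow> ('v, 'x) pbundle \<Rightarrow> ('x \<times> ('v list \<Rightarrow>\<^sub>0 real) set, 'x) pbundle" where
  "tensor_power n V = tensor_power_with
     (\<lambda>k U q. \<forall>D. pseudo_bundle (tensor_power_with D n V) \<and>
        dsmooth (fibre_power n V) (tot (tensor_power_with D n V))
          (\<lambda>(x, l). (x, tens V x (Poly_Mapping.single l 1)))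
        \<longrightarrow> D k U q) n V"

text \<open>The full tensor algebras with the direct sum diffeology: plots are locally finite sums,
  over a common base plot, of plots of the tensor powers. With bounded fibre dimension, high
  degrees contribute nothing new to the Clifford quotients or their diffeology.\<close>

definition tensor_ds :: "('v, 'x) pbundle \<Rightarrow> ('x \<times> ('v list \<Rightarrow>\<^sub>0 real) set) dspace" where
  "tensor_ds V =
     (let P = (SIGMA x:points (base V). carrier (tensor_alg V x)) in
      \<lparr>points = P,
       plots = (\<lambda>m U q. openin (Euclidean_space m) U \<and> q ` U \<subseteq> P \<and>
         locally_on m U (\<lambda>W. \<exists>N r.
           (\<forall>n\<le>N. plots (tot (tensor_power n V)) m W (r n)) \<and>
           (\<forall>u\<in>W. (\<forall>n\<le>N. fst (r n u) = fst (q u)) \<and>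
              snd (q u) = (\<Oplus>\<^bsub>tensor_alg V (fst (q u))\<^esub>n\<in>{..N}. snd (r n u)))))\<rparr>)"

definition map_words :: "('v \<Rightarrow> 'w) \<Rightarrow> ('v list \<Rightarrow>\<^sub>0 real) \<Rightarrow> ('w list \<Rightarrow>\<^sub>0 real)" where
  "map_words \<Phi> p = (\<Sum>l\<in>Poly_Mapping.keys p. Poly_Mapping.single (map \<Phi> l) (Poly_Mapping.lookup p l))"

text \<open>The direct sum of all tensor powers of a fibrewise linear map \<open>\<Phi>\<close> from \<open>A\<close> to \<open>B\<close>. The
  map of base spaces covered by \<open>\<Phi>\<close> is read off from the zero section, and the image of a
  coset is the common coset of the images of its representatives.\<close>

definition tensor_map ::
    "('v, 'x) pbundle \<Rightarrow> ('w, 'y) pbundle \<Rightarrow> ('v \<Rightarrow> 'w)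
      \<Rightarrow> 'x \<times> ('v list \<Rightarrow>\<^sub>0 real) set \<Rightarrow> 'y \<times> ('w list \<Rightarrow>\<^sub>0 real) set" where
  "tensor_map A B \<Phi> = (\<lambda>(x, t).
     let y = proj B (\<Phi> (vzero A x)) in (y, \<Union>p\<in>t. tens B y (map_words \<Phi> p)))"


section \<open>Pseudo-metrics\<close>

text \<open>The bilinear form given by an element of the tensor square of the dual of a fibre,
  evaluated on a representative that is homogeneous of degree two.\<close>

definition tensor_form ::
    "(('x \<times> ('v \<Rightarrow> real)) list \<Rightarrow>\<^sub>0 real) set \<Rightarrow> 'v \<Rightarrow> 'v \<Rightarrow> real" where
  "tensor_form t v w =
     (let p = (SOME p. p \<in> t \<and> (\<forall>l\<in>Poly_Mapping.keys p. length l = 2))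
      in \<Sum>l\<in>Poly_Mapping.keys p. Poly_Mapping.lookup p l * snd (l ! 0) v * snd (l ! 1) w)"

definition pairing :: "('v, 'x) pbundle \<Rightarrow> ('x \<Rightarrow> 'v \<Rightarrow> 'v \<Rightarrow> real) \<Rightarrow> 'v \<Rightarrow> 'x \<times> ('v \<Rightarrow> real)" where
  "pairing V g v = (proj V v, \<lambda>w\<in>fibre V (proj V v). g (proj V v) v w)"

text \<open>The rank of the form \<open>g x\<close> is the dimension of the image of \<open>v \<mapsto> g x v -\<close>.\<close>

definition form_rank :: "('v, 'x) pbundle \<Rightarrow> ('x \<Rightarrow> 'v \<Rightarrow> 'v \<Rightarrow> real) \<Rightarrow> 'x \<Rightarrow> nat \<Rightarrow> bool" where
  "form_rank V g x n \<longleftrightarrow> vs_dim (fibre_mod (dual V) x\<lparr>carrier := pairing V g ` fibre V x\<rparr>) n"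

text \<open>A pseudo-metric is given by its family of forms \<open>g x\<close>, which has to come from a smooth
  section of the tensor square of the dual.\<close>

definition pseudo_metric :: "('v, 'x) pbundle \<Rightarrow> ('x \<Rightarrow> 'v \<Rightarrow> 'v \<Rightarrow> real) \<Rightarrow> bool" where
  "pseudo_metric V g \<longleftrightarrow>
     (\<exists>s. dsmooth (base V) (tot (tensor_power 2 (dual V))) s \<and>
        (\<forall>x\<in>points (base V). proj (tensor_power 2 (dual V)) (s x) = x \<and>
           (\<forall>v\<in>fibre V x. \<forall>w\<in>fibre V x. g x v w = tensor_form (snd (s x)) v w))) \<and>
     (\<forall>x\<in>points (base V).
        (\<forall>v\<in>fibre V x. \<forall>w\<in>fibre V x. g x v w = g x w v) \<and>
        (\<forall>v\<in>fibre V x. g x v v \<ge> 0) \<and>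
        (\<exists>n. vs_dim (fibre_mod (dual V) x) n \<and> form_rank V g x n))"

text \<open>The dual pseudo-metric, whose value on two covectors is computed from arbitrary preimages
  under \<^const>\<open>pairing\<close>.\<close>

definition dual_metric ::
    "('v, 'x) pbundle \<Rightarrow> ('x \<Rightarrow> 'v \<Rightarrow> 'v \<Rightarrow> real)
      \<Rightarrow> 'x \<Rightarrow> 'x \<times> ('v \<Rightarrow> real) \<Rightarrow> 'x \<times> ('v \<Rightarrow> real) \<Rightarrow> real" where
  "dual_metric V g x \<xi> \<eta> =
     g x (SOME v. v \<in> fibre V x \<and> pairing V g v = \<xi>) (SOME w. w \<in> fibre V x \<and> pairing V g w = \<eta>)"


section \<open>Gluing\<close>

definition glue_rel :: "'a set \<Rightarrow> ('a \<Rightarrow> 'b) \<Rightarrow> (('a + 'b) \<times> ('a + 'b)) set" where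
  "glue_rel Y h = (let R = {(Inl z, Inr (h z)) | z. z \<in> Y} in (R \<union> R\<inverse>)\<^sup>*)"

definition glue_class :: "'a set \<Rightarrow> ('a \<Rightarrow> 'b) \<Rightarrow> 'a + 'b \<Rightarrow> ('a + 'b) set" where
  "glue_class Y h a = glue_rel Y h `` {a}"

definition glue_ds :: "'a dspace \<Rightarrow> 'a set \<Rightarrow> ('a \<Rightarrow> 'b) \<Rightarrow> 'b dspace \<Rightarrow> ('a + 'b) set dspace" where
  "glue_ds Z1 Y h Z2 = quotient_ds (sum_ds Z1 Z2) (glue_class Y h)"

definition inc1 :: "'a set \<Rightarrow> ('a \<Rightarrow> 'b) \<Rightarrow> 'a \<Rightarrow> ('a + 'b) set" where
  "inc1 Y h z = glue_class Y h (Inl z)"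

definition inc2 :: "'a set \<Rightarrow> ('a \<Rightarrow> 'b) \<Rightarrow> 'b \<Rightarrow> ('a + 'b) set" where
  "inc2 Y h z = glue_class Y h (Inr z)"

text \<open>Every point of a glued space is \<^const>\<open>inc1\<close> of a unique point outside \<open>Y\<close> or
  \<^const>\<open>inc2\<close> of a unique point, but not both.\<close>

definition in2 :: "'a set \<Rightarrow> ('a \<Rightarrow> 'b) \<Rightarrow> 'b dspace \<Rightarrow> ('a + 'b) set \<Rightarrow> bool" where
  "in2 Y h Z2 a \<longleftrightarrow> a \<in> inc2 Y h ` points Z2"

definition out1 :: "'a dspace \<Rightarrow> 'a set \<Rightarrow> ('a \<Rightarrow> 'b) \<Rightarrow> ('a + 'b) set \<Rightarrow> 'a" where
  "out1 Z1 Y h = inv_into (points Z1 - Y) (inc1 Y h)"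

definition out2 :: "'a set \<Rightarrow> ('a \<Rightarrow> 'b) \<Rightarrow> 'b dspace \<Rightarrow> ('a + 'b) set \<Rightarrow> 'b" where
  "out2 Y h Z2 = inv_into (points Z2) (inc2 Y h)"

definition gluing ::
    "('v1, 'x1) pbundle \<Rightarrow> 'x1 set \<Rightarrow> ('v1 \<Rightarrow> 'v2) \<Rightarrow> ('x1 \<Rightarrow> 'x2) \<Rightarrow> ('v2, 'x2) pbundle \<Rightarrow> bool" where
  "gluing V1 Y F f V2 \<longleftrightarrow> Y \<subseteq> points (base V1) \<and>
     dsmooth (subset_ds (base V1) Y) (base V2) f \<and>
     dsmooth (subset_ds (tot V1) (preim V1 Y)) (tot V2) F \<and>
     (\<forall>y\<in>Y. lin_map (fibre_mod V1 y) (fibre_mod V2 (f y)) F)"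

definition glue_bundle ::
    "('v1, 'x1) pbundle \<Rightarrow> 'x1 set \<Rightarrow> ('v1 \<Rightarrow> 'v2) \<Rightarrow> ('x1 \<Rightarrow> 'x2) \<Rightarrow> ('v2, 'x2) pbundle
      \<Rightarrow> (('v1 + 'v2) set, ('x1 + 'x2) set) pbundle" where
  "glue_bundle V1 Y F f V2 =
     (let E = preim V1 Y; j1 = inc1 E F; j2 = inc2 E F;
          o1 = out1 (tot V1) E F; o2 = out2 E F (tot V2); is2 = in2 E F (tot V2)
      in \<lparr>
       tot = glue_ds (tot V1) E F (tot V2),
       base = glue_ds (base V1) Y f (base V2),
       proj = (\<lambda>a. if is2 a then inc2 Y f (proj V2 (o2 a)) else inc1 Y f (proj V1 (o1 a))),
       vadd = (\<lambda>a b. if is2 a then j2 (vadd V2 (o2 a) (o2 b)) else j1 (vadd V1 (o1 a) (o1 b))),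
       vscale = (\<lambda>c a. if is2 a then j2 (vscale V2 c (o2 a)) else j1 (vscale V1 c (o1 a))),
       vzero = (\<lambda>P. if in2 Y f (base V2) P then j2 (vzero V2 (out2 Y f (base V2) P))
                    else j1 (vzero V1 (out1 (base V1) Y f P)))\<rparr>)"

definition compatible ::
    "('v1, 'x1) pbundle \<Rightarrow> 'x1 set \<Rightarrow> ('v1 \<Rightarrow> 'v2) \<Rightarrow> ('x1 \<Rightarrow> 'x2)
      \<Rightarrow> ('x1 \<Rightarrow> 'v1 \<Rightarrow> 'v1 \<Rightarrow> real) \<Rightarrow> ('x2 \<Rightarrow> 'v2 \<Rightarrow> 'v2 \<Rightarrow> real) \<Rightarrow> bool" where
  "compatible V1 Y F f g1 g2 \<longleftrightarrow>
     (\<forall>y\<in>Y. \<forall>v\<in>fibre V1 y. \<forall>w\<in>fibre V1 y. g1 y v w = g2 (f y) (F v) (F w))"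

definition glue_metric ::
    "('v1, 'x1) pbundle \<Rightarrow> 'x1 set \<Rightarrow> ('v1 \<Rightarrow> 'v2) \<Rightarrow> ('x1 \<Rightarrow> 'x2) \<Rightarrow> ('v2, 'x2) pbundle
      \<Rightarrow> ('x1 \<Rightarrow> 'v1 \<Rightarrow> 'v1 \<Rightarrow> real) \<Rightarrow> ('x2 \<Rightarrow> 'v2 \<Rightarrow> 'v2 \<Rightarrow> real)
      \<Rightarrow> ('x1 + 'x2) set \<Rightarrow> ('v1 + 'v2) set \<Rightarrow> ('v1 + 'v2) set \<Rightarrow> real" where
  "glue_metric V1 Y F f V2 g1 g2 P a b =
     (let E = preim V1 Y; o1 = out1 (tot V1) E F; o2 = out2 E F (tot V2)
      in if in2 Y f (base V2) P then g2 (out2 Y f (base V2) P) (o2 a) (o2 b)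
         else g1 (out1 (base V1) Y f P) (o1 a) (o1 b))"

text \<open>The fibrewise dual of \<open>F\<close>, defined on the part of the dual of the second pseudo-bundle
  over \<open>f ` Y\<close>, and lifting the inverse of \<open>f\<close>.\<close>

definition dual_lift ::
    "('v1, 'x1) pbundle \<Rightarrow> 'x1 set \<Rightarrow> ('v1 \<Rightarrow> 'v2) \<Rightarrow> ('x1 \<Rightarrow> 'x2)
      \<Rightarrow> 'x2 \<times> ('v2 \<Rightarrow> real) \<Rightarrow> 'x1 \<times> ('v1 \<Rightarrow> real)" where
  "dual_lift V1 Y F f = (\<lambda>(x, \<xi>). let y = inv_into Y f x in (y, \<lambda>v\<in>fibre V1 y. \<xi> (F v)))"

definition glue_dual ::
    "('v1, 'x1) pbundle \<Rightarrow> 'x1 set \<Rightarrow> ('v1 \<Rightarrow> 'v2) \<Rightarrow> ('x1 \<Rightarrow> 'x2) \<Rightarrow> ('v2, 'x2) pbundle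
      \<Rightarrow> ((('x2 \<times> ('v2 \<Rightarrow> real)) + ('x1 \<times> ('v1 \<Rightarrow> real))) set, ('x2 + 'x1) set) pbundle" where
  "glue_dual V1 Y F f V2 =
     glue_bundle (dual V2) (f ` Y) (dual_lift V1 Y F f) (inv_into Y f) (dual V1)"

definition glue_dual_metric ::
    "('v1, 'x1) pbundle \<Rightarrow> 'x1 set \<Rightarrow> ('v1 \<Rightarrow> 'v2) \<Rightarrow> ('x1 \<Rightarrow> 'x2) \<Rightarrow> ('v2, 'x2) pbundle
      \<Rightarrow> ('x1 \<Rightarrow> 'v1 \<Rightarrow> 'v1 \<Rightarrow> real) \<Rightarrow> ('x2 \<Rightarrow> 'v2 \<Rightarrow> 'v2 \<Rightarrow> real)
      \<Rightarrow> ('x2 + 'x1) set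
      \<Rightarrow> (('x2 \<times> ('v2 \<Rightarrow> real)) + ('x1 \<times> ('v1 \<Rightarrow> real))) set
      \<Rightarrow> (('x2 \<times> ('v2 \<Rightarrow> real)) + ('x1 \<times> ('v1 \<Rightarrow> real))) set \<Rightarrow> real" where
  "glue_dual_metric V1 Y F f V2 g1 g2 =
     glue_metric (dual V2) (f ` Y) (dual_lift V1 Y F f) (inv_into Y f) (dual V1)
       (dual_metric V2 g2) (dual_metric V1 g1)"

text \<open>The gluing-dual commutativity map, from the dual of the glued pseudo-bundle to the glued
  duals; \<open>k1\<close> and \<open>k2\<close> are the inclusions of the two duals into the latter.\<close>

definition gluing_dual_comm ::
    "('v1, 'x1) pbundle \<Rightarrow> 'x1 set \<Rightarrow> ('v1 \<Rightarrow> 'v2) \<Rightarrow> ('x1 \<Rightarrow> 'x2) \<Rightarrow> ('v2, 'x2) pbundle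
      \<Rightarrow> ('x1 + 'x2) set \<times> (('v1 + 'v2) set \<Rightarrow> real)
      \<Rightarrow> (('x2 \<times> ('v2 \<Rightarrow> real)) + ('x1 \<times> ('v1 \<Rightarrow> real))) set" where
  "gluing_dual_comm V1 Y F f V2 = (\<lambda>(P, \<xi>).
     let E = preim V1 Y; E' = preim (dual V2) (f ` Y); L = dual_lift V1 Y F f;
         k1 = inc1 E' L; k2 = inc2 E' L
     in if in2 Y f (base V2) P
        then let x = out2 Y f (base V2) P; \<eta> = (x, \<lambda>v\<in>fibre V2 x. \<xi> (inc2 E F v))
             in if x \<in> f ` Y then k2 (L \<eta>) else k1 \<eta>
        else let x = out1 (base V1) Y f P in k2 (x, \<lambda>v\<in>fibre V1 x. \<xi> (inc1 E F v)))"


section \<open>Clifford algebras\<close>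

definition cl_ideal ::
    "('v, 'x) pbundle \<Rightarrow> ('x \<Rightarrow> 'v \<Rightarrow> 'v \<Rightarrow> real) \<Rightarrow> 'x \<Rightarrow> ('v list \<Rightarrow>\<^sub>0 real) set set" where
  "cl_ideal V g x = Idl\<^bsub>tensor_alg V x\<^esub>
     {tens V x (Poly_Mapping.single [v, w] 1 + Poly_Mapping.single [w, v] 1
        + Poly_Mapping.single [] (2 * g x v w)) | v w. v \<in> fibre V x \<and> w \<in> fibre V x}"

definition cl_alg ::
    "('v, 'x) pbundle \<Rightarrow> ('x \<Rightarrow> 'v \<Rightarrow> 'v \<Rightarrow> real) \<Rightarrow> 'x \<Rightarrow> ('v list \<Rightarrow>\<^sub>0 real) set set ring" where
  "cl_alg V g x = tensor_alg V x Quot cl_ideal V g x"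

definition cl_proj ::
    "('v, 'x) pbundle \<Rightarrow> ('x \<Rightarrow> 'v \<Rightarrow> 'v \<Rightarrow> real)
      \<Rightarrow> 'x \<times> ('v list \<Rightarrow>\<^sub>0 real) set \<Rightarrow> 'x \<times> ('v list \<Rightarrow>\<^sub>0 real) set set" where
  "cl_proj V g = (\<lambda>(x, t). (x, cl_ideal V g x +>\<^bsub>tensor_alg V x\<^esub> t))"

definition cl_ds ::
    "('v, 'x) pbundle \<Rightarrow> ('x \<Rightarrow> 'v \<Rightarrow> 'v \<Rightarrow> real) \<Rightarrow> ('x \<times> ('v list \<Rightarrow>\<^sub>0 real) set set) dspace" where
  "cl_ds V g = \<lparr>points = Sigma (points (base V)) (\<lambda>x. carrier (cl_alg V g x)),
     plots = plots (quotient_ds (tensor_ds V) (cl_proj V g))\<rparr>"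

end

theory Submission
  imports Defs "HOL-Library.Function_Algebras"
begin

text \<open>
  The commutativity map is an isomorphism of pseudo-bundles covering the swap
  \<open>X\<^sub>1 \<union>\<^sub>f X\<^sub>2 \<cong> X\<^sub>2 \<union>\<^sub>g X\<^sub>1\<close>, \<open>g = f\<^sup>-\<^sup>1\<close>. Both it and its inverse are smooth because a plot of a glued
  space lifts locally to one of the two pieces. Invertibility over \<open>f(Y)\<close> comes from the
  pseudo-metrics: compatibility forces the dual lift to be fibrewise onto, since every covector of
  \<open>V\<^sub>1\<close> over \<open>Y\<close> is a pairing \<open>g\<^sub>1(v,\<cdot>)\<close> and hence the pullback of \<open>g\<^sub>2(F v,\<cdot>)\<close>. The same observation
  makes the map an isometry, as dual metrics may be computed through arbitrary preimages under
  the pairings.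

  Clifford algebras are functorial for isometric isomorphisms: the diffeology of a tensor power
  is the finest pseudo-bundle diffeology of its kind, so a tensor power of an isomorphism is smooth
  as soon as the competing diffeologies on the target can be pulled back to the source. The
  isomorphism of tensor algebras so obtained matches the Clifford ideals and passes to the
  quotients.
\<close>

section \<open>Calculus on open subsets of Euclidean spaces\<close>

text \<open>\<open>F\<close> is not assumed to be fibrewise invertible; only its dual lift is a
  diffeomorphism, and only onto its image. Over the glued part the dual of the glued bundle consists
  of covectors on \<open>V2\<close>, the glued duals of covectors on \<open>V1\<close>. Inverting
  the commutativity map therefore means moving covectors of \<open>V1\<close> back to
  \<open>V2\<close>, smoothly in families. Smoothness is the hypothesis on the inverse of the dual
  lift; that its domain is everything over \<open>Y\<close> rests on every covector being a pairing.
  The latter is a dimension count: by the rank condition the image of the pairing is a subspace of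
  the dual fibre with the same finite dimension.

  A plot of one piece may enter and leave the glued part, so the pointwise case distinctions in the
  definitions say nothing about smoothness. They are replaced by formulas valid at all points of a
  piece.

  Smoothness is defined by iterated partial derivatives. Sums and products are used for the linear
  structure of dual fibres and compositions for the reparametrization of plots, hence the chain rule
  at the start.\<close>

lemma Cinf_on_openin: "Cinf_on n U f \<Longrightarrow> openin (Euclidean_space n) U"
  by (simp add: Cinf_on_def)

lemma open_subset_Euclidean: "openin (Euclidean_space n) U \<Longrightarrow> x \<in> U \<Longrightarrow> i \<ge> n \<Longrightarrow> x i = 0"
  using openin_subset[of "Euclidean_space n" U] by (auto simp: topspace_Euclidean_space)

lemma topspace_open_subset [simp]:
  "openin (Euclidean_space n) U \<Longrightarrow> topspace (subtopology (Euclidean_space n) U) = U"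
  using openin_subset by fastforce

lemma continuous_map_into_Euclidean:
  "continuous_map T (Euclidean_space n) h \<longleftrightarrow>
     (\<forall>x\<in>topspace T. \<forall>i\<ge>n. h x i = 0) \<and> (\<forall>i. continuous_map T euclideanreal (\<lambda>x. h x i))"
  by (auto simp: Euclidean_space_def continuous_map_in_subtopology continuous_map_componentwise_UNIV)

text \<open>As \<open>i < n\<close>, the line through \<open>x\<close> in direction \<open>i\<close>
  is a continuous curve in n-space, so it stays in an open set for a while.\<close>

lemma eventually_fun_upd_in:
  assumes U: "openin (Euclidean_space n) U" and x: "x \<in> U" and i: "i < n"
  shows "\<forall>\<^sub>F t in nhds (x i). x(i := t) \<in> U"
proof -
  have "continuous_map euclideanreal (Euclidean_space n) (\<lambda>t. x(i := t))"
    using open_subset_Euclidean[OF U x] i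
    by (auto simp: continuous_map_into_Euclidean fun_upd_def intro!: continuous_intros)
  then have "openin euclideanreal {t \<in> topspace euclideanreal. x(i := t) \<in> U}"
    using U by (rule openin_continuous_map_preimage)
  then have "open {t. x(i := t) \<in> U}" by simp
  then show ?thesis using x eventually_nhds[of "\<lambda>t. x(i := t) \<in> U"] by fastforce
qed

text \<open>The derivative at \<open>x i\<close> only sees the points \<open>x(i := t)\<close> with
  \<open>t\<close> near \<open>x i\<close>, and these lie in the open set \<open>U\<close>.\<close>

lemma derivative_local_cong:
  assumes U: "openin (Euclidean_space n) U" and x: "x \<in> U" and i: "i < n"
    and eq: "\<And>y. y \<in> U \<Longrightarrow> f y = g y"
    and d: "((\<lambda>t. f (x(i := t))) has_real_derivative D) (at (x i))"
  shows "((\<lambda>t. g (x(i := t))) has_real_derivative D) (at (x i))"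
proof -
  have "\<forall>\<^sub>F t in nhds (x i). f (x(i := t)) = g (x(i := t))"
    using eventually_fun_upd_in[OF U x i] by eventually_elim (rule eq)
  then show ?thesis
    using d DERIV_cong_ev[of "x i" "x i" "\<lambda>t. f (x(i := t))" "\<lambda>t. g (x(i := t))" D D] by simp
qed

lemma Ck_on_cong:
  assumes U: "openin (Euclidean_space n) U" and eq: "\<And>y. y \<in> U \<Longrightarrow> f y = g y" and f: "Ck_on k n U f"
  shows "Ck_on k n U g"
proof (cases k)
  case 0
  then show ?thesis
    using f eq continuous_map_eq[of "subtopology (Euclidean_space n) U" euclideanreal f g] U by simp
next
  case (Suc k')
  show ?thesis unfolding Suc Ck_on.simps
  proof (intro allI impI)
    fix i assume i: "i < n"
    obtain f' where "\<forall>x\<in>U. ((\<lambda>t. f (x(i := t))) has_real_derivative f' x) (at (x i))" "Ck_on k' n U f'"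
      using f i unfolding Suc Ck_on.simps by blast
    then show "\<exists>f'. (\<forall>x\<in>U. ((\<lambda>t. g (x(i := t))) has_real_derivative f' x) (at (x i))) \<and> Ck_on k' n U f'"
      using derivative_local_cong[OF U _ i, of _ f g] eq by blast
  qed
qed

lemma Cinf_on_cong:
  assumes "\<And>y. y \<in> U \<Longrightarrow> f y = g y" and "Cinf_on n U f"
  shows "Cinf_on n U g"
  using assms Ck_on_cong[of n U f g] by (auto simp: Cinf_on_def)

lemma Cinf_on_continuous: "Cinf_on n U f \<Longrightarrow> continuous_map (subtopology (Euclidean_space n) U) euclideanreal f"
  using Ck_on.simps(1) unfolding Cinf_on_def by blast

text \<open>\<open>Ck_on\<close> provides a separate derivative function for every order.
  Derivatives are unique, so these functions agree on \<open>U\<close>, and any one of them is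
  differentiable to all orders.\<close>

lemma Cinf_on_partial:
  assumes f: "Cinf_on n U f" and i: "i < n"
  obtains f' where "\<And>x. x \<in> U \<Longrightarrow> ((\<lambda>t. f (x(i := t))) has_real_derivative f' x) (at (x i))"
    and "Cinf_on n U f'"
proof -
  note U = Cinf_on_openin[OF f]
  have *: "\<exists>f'. (\<forall>x\<in>U. ((\<lambda>t. f (x(i := t))) has_real_derivative f' x) (at (x i))) \<and> Ck_on k n U f'" for k
    using f i unfolding Cinf_on_def by (metis Ck_on.simps(2))
  obtain f' where f': "\<And>x. x \<in> U \<Longrightarrow> ((\<lambda>t. f (x(i := t))) has_real_derivative f' x) (at (x i))"
    using * by blast
  have "Ck_on k n U f'" for k
  proof -
    obtain f'' where f'': "\<And>x. x \<in> U \<Longrightarrow> ((\<lambda>t. f (x(i := t))) has_real_derivative f'' x) (at (x i))"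
      "Ck_on k n U f''" using * by blast
    have "f'' x = f' x" if "x \<in> U" for x using DERIV_unique f' f'' that by blast
    then show ?thesis using Ck_on_cong[OF U _ f''(2)] by blast
  qed
  then show thesis using that f' U by (auto simp: Cinf_on_def)
qed

text \<open>Coinduction for smoothness: \<open>P\<close> implies continuity and survives partial
  differentiation. The order \<open>k\<close> is dealt with by one induction here; later proofs only
  have to find \<open>P\<close>.\<close>

lemma Cinf_on_coinduct:
  assumes U: "openin (Euclidean_space n) U" and P: "P f"
    and cont: "\<And>f. P f \<Longrightarrow> continuous_map (subtopology (Euclidean_space n) U) euclideanreal f"
    and step: "\<And>f i. P f \<Longrightarrow> i < n \<Longrightarrow>
      \<exists>f'. (\<forall>x\<in>U. ((\<lambda>t. f (x(i := t))) has_real_derivative f' x) (at (x i))) \<and> P f'"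
  shows "Cinf_on n U f"
proof -
  have "P f \<Longrightarrow> Ck_on k n U f" for k f
  proof (induction k arbitrary: f)
    case (Suc k)
    then show ?case using step unfolding Ck_on.simps by metis
  qed (simp add: cont)
  then show ?thesis using U P by (simp add: Cinf_on_def)
qed

lemma Cinf_on_const: "openin (Euclidean_space n) U \<Longrightarrow> Cinf_on n U (\<lambda>_. c)"
  by (rule Cinf_on_coinduct[where P = "\<lambda>f. \<exists>c. f = (\<lambda>_. c)"]) (auto intro!: exI derivative_eq_intros)

lemma Cinf_on_coordinate:
  assumes "openin (Euclidean_space n) U"
  shows "Cinf_on n U (\<lambda>x. x j)"
proof (rule Cinf_on_coinduct[where P = "\<lambda>f. f = (\<lambda>x. x j) \<or> (\<exists>c. f = (\<lambda>_. c))"])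
  fix f :: "(nat \<Rightarrow> real) \<Rightarrow> real" assume f: "f = (\<lambda>x. x j) \<or> (\<exists>c. f = (\<lambda>_. c))"
  have "continuous_map (subtopology (Euclidean_space n) U) euclideanreal (\<lambda>x. x j)"
    unfolding Euclidean_space_def
    by (intro continuous_map_from_subtopology continuous_map_product_projection) simp
  then show "continuous_map (subtopology (Euclidean_space n) U) euclideanreal f"
    using f by auto
  fix i
  have d: "((\<lambda>t. (x(i := t)) j) has_real_derivative (if i = j then 1 else 0)) (at (x i))" for x :: "nat \<Rightarrow> real"
    by (auto intro!: derivative_eq_intros)
  show "\<exists>f'. (\<forall>x\<in>U. ((\<lambda>t. f (x(i := t))) has_real_derivative f' x) (at (x i))) \<and>
    (f' = (\<lambda>x. x j) \<or> (\<exists>c. f' = (\<lambda>_. c)))"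
    using f
  proof
    assume "f = (\<lambda>x. x j)"
    then show ?thesis
      using d by (intro exI[of _ "\<lambda>_. if i = j then 1 else 0"]) blast
  next
    assume "\<exists>c. f = (\<lambda>_. c)"
    then show ?thesis by (intro exI[of _ "\<lambda>_. 0"]) auto
  qed
qed (use assms in auto)

lemma Cinf_map_openin: "Cinf_map n U m h \<Longrightarrow> openin (Euclidean_space n) U"
  by (simp add: Cinf_map_def)

lemma Cinf_map_component:
  assumes "Cinf_map n U m h"
  shows "Cinf_on n U (\<lambda>x. h x i)"
proof (cases "i < m")
  case False
  then have "h x i = 0" if "x \<in> U" for x
    using assms that by (auto simp: Cinf_map_def topspace_Euclidean_space image_subset_iff)
  then show ?thesis
    using Cinf_on_cong[of U "\<lambda>_. 0" "\<lambda>x. h x i" n] Cinf_on_const Cinf_map_openin[OF assms] by simp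
qed (use assms in \<open>simp add: Cinf_map_def\<close>)

lemma Cinf_map_continuous:
  assumes "Cinf_map n U m h"
  shows "continuous_map (subtopology (Euclidean_space n) U) (Euclidean_space m) h"
  using assms Cinf_on_continuous[OF Cinf_map_component[OF assms]]
  by (auto simp: continuous_map_into_Euclidean Cinf_map_def topspace_Euclidean_space image_subset_iff)

lemma openin_Cinf_map_preimage:
  assumes "Cinf_map n U m h" and "openin (Euclidean_space m) W"
  shows "openin (Euclidean_space n) {x \<in> U. h x \<in> W}"
proof -
  note U = Cinf_map_openin[OF assms(1)]
  have "openin (subtopology (Euclidean_space n) U) {x \<in> topspace (subtopology (Euclidean_space n) U). h x \<in> W}"
    by (rule openin_continuous_map_preimage[OF Cinf_map_continuous[OF assms(1)] assms(2)])
  then show ?thesis unfolding topspace_open_subset[OF U] by (rule openin_trans_full[OF _ U])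
qed

lemma Ck_on_subset:
  "W \<subseteq> U \<Longrightarrow> Ck_on k n U f \<Longrightarrow> Ck_on k n W f"
proof (induction k arbitrary: f)
  case 0
  then show ?case by (metis Ck_on.simps(1) continuous_map_from_subtopology_mono)
next
  case (Suc k)
  then show ?case unfolding Ck_on.simps by (meson subsetD)
qed

lemma Cinf_on_subset:
  "Cinf_on n U f \<Longrightarrow> openin (Euclidean_space n) W \<Longrightarrow> W \<subseteq> U \<Longrightarrow> Cinf_on n W f"
  using Ck_on_subset unfolding Cinf_on_def by blast

lemma Cinf_map_subset:
  "Cinf_map n U m h \<Longrightarrow> openin (Euclidean_space n) W \<Longrightarrow> W \<subseteq> U \<Longrightarrow> Cinf_map n W m h"
  using Cinf_on_subset unfolding Cinf_map_def by blast

text \<open>Local smoothness is itself an invariant closed under partial derivatives, so coinduction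
  applies; continuity comes from the pasting lemma.\<close>

lemma Cinf_on_locally:
  assumes U: "openin (Euclidean_space n) U" and loc: "locally_on n U (\<lambda>W. Cinf_on n W f)"
  shows "Cinf_on n U f"
proof (rule Cinf_on_coinduct[where P = "\<lambda>f. locally_on n U (\<lambda>W. Cinf_on n W f)"])
  fix f assume f: "locally_on n U (\<lambda>W. Cinf_on n W f)"
  show "continuous_map (subtopology (Euclidean_space n) U) euclideanreal f"
  proof (rule pasting_lemma[where I = "{W. openin (Euclidean_space n) W \<and> W \<subseteq> U \<and> Cinf_on n W f}"
        and T = "\<lambda>W. W" and f = "\<lambda>_. f"])
    fix W assume "W \<in> {W. openin (Euclidean_space n) W \<and> W \<subseteq> U \<and> Cinf_on n W f}"
    then have W: "openin (Euclidean_space n) W" "W \<subseteq> U" "Cinf_on n W f" by auto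
    show "openin (subtopology (Euclidean_space n) U) W"
      using W(1,2) U by (simp add: openin_open_subtopology)
    show "continuous_map (subtopology (subtopology (Euclidean_space n) U) W) euclideanreal f"
      using Cinf_on_continuous[OF W(3)] W(2) by (simp add: subtopology_subtopology inf.absorb2)
  next
    fix x assume "x \<in> topspace (subtopology (Euclidean_space n) U)"
    then show "\<exists>W. W \<in> {W. openin (Euclidean_space n) W \<and> W \<subseteq> U \<and> Cinf_on n W f} \<and> x \<in> W \<and> f x = f x"
      using f U unfolding locally_on_def by auto
  qed simp
next
  fix f i assume f: "locally_on n U (\<lambda>W. Cinf_on n W f)" and i: "i < n"
  \<comment> \<open>The local derivatives come from unrelated neighbourhoods; \<open>deriv\<close>
    is one function on all of \<open>U\<close> that agrees with each of them.\<close>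
  define f' where "f' x = deriv (\<lambda>t. f (x(i := t))) (x i)" for x
  have *: "\<exists>W. openin (Euclidean_space n) W \<and> x \<in> W \<and> W \<subseteq> U \<and> Cinf_on n W f' \<and>
     (\<forall>x\<in>W. ((\<lambda>t. f (x(i := t))) has_real_derivative f' x) (at (x i)))" if x: "x \<in> U" for x
  proof -
    obtain W where W: "openin (Euclidean_space n) W" "x \<in> W" "W \<subseteq> U" "Cinf_on n W f"
      using f x unfolding locally_on_def by blast
    obtain g where g: "\<And>x. x \<in> W \<Longrightarrow> ((\<lambda>t. f (x(i := t))) has_real_derivative g x) (at (x i))" "Cinf_on n W g"
      using Cinf_on_partial[OF W(4) i] by blast
    have eq: "g y = f' y" if "y \<in> W" for y using DERIV_imp_deriv[OF g(1)[OF that]] by (simp add: f'_def)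
    then have "Cinf_on n W f'" using Cinf_on_cong[OF _ g(2)] by blast
    then show ?thesis using W eq g(1) by metis
  qed
  then show "\<exists>f'. (\<forall>x\<in>U. ((\<lambda>t. f (x(i := t))) has_real_derivative f' x) (at (x i))) \<and>
      locally_on n U (\<lambda>W. Cinf_on n W f')"
    unfolding locally_on_def by meson
qed (use assms in auto)

section \<open>Chain rule; closure of smooth functions under sums, products and composition\<close>

lemma Euclidean_box:
  assumes U: "openin (Euclidean_space n) U" and a: "a \<in> U"
  obtains e where "e > 0" and "\<And>x. (\<And>i. i < n \<Longrightarrow> \<bar>x i - a i\<bar> < e) \<Longrightarrow> (\<And>i. i \<ge> n \<Longrightarrow> x i = 0) \<Longrightarrow> x \<in> U"
proof -
  obtain W where W: "openin (powertop_real UNIV) W" "U = W \<inter> {x. \<forall>i\<ge>n. x i = 0}"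
    using U unfolding Euclidean_space_def openin_subtopology by blast
  obtain V where V: "\<And>i. open (V i)" "\<And>i. a i \<in> V i" "Pi\<^sub>E UNIV V \<subseteq> W"
    using W a unfolding openin_product_topology_alt by (fastforce simp: PiE_iff)
  have "\<forall>i. \<exists>e>0. \<forall>r. \<bar>r - a i\<bar> < e \<longrightarrow> r \<in> V i"
    using V(1,2) unfolding open_real by blast
  then obtain d where d: "\<And>i. d i > 0" "\<And>i r. \<bar>r - a i\<bar> < d i \<Longrightarrow> r \<in> V i" by metis
  \<comment> \<open>A positive radius is required for the first \<open>n\<close> coordinates only,
    the others being zero on n-space; so a finite minimum does it.\<close>
  have "\<exists>e>0. \<forall>i<n. e \<le> d i"
  proof (cases "n = 0")
    case False
    then have ne: "d ` {..<n} \<noteq> {}" by (auto simp: lessThan_empty_iff)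
    have "Min (d ` {..<n}) > 0" using Min_in[OF _ ne] d(1) by auto
    then show ?thesis by (intro exI[of _ "Min (d ` {..<n})"]) auto
  qed (auto intro: exI[of _ 1])
  then obtain e where e: "e > 0" "\<And>i. i < n \<Longrightarrow> e \<le> d i" by blast
  show thesis
  proof (rule that[OF e(1)])
    fix x assume x: "\<And>i. i < n \<Longrightarrow> \<bar>x i - a i\<bar> < e" "\<And>i. i \<ge> n \<Longrightarrow> x i = 0"
    have "x i \<in> V i" for i
    proof (cases "i < n")
      case True
      then show ?thesis using d(2) x(1) e(2) by fastforce
    next
      case False
      then show ?thesis using V(2)[of i] x(2)[of i] open_subset_Euclidean[OF U a, of i] by simp
    qed
    then have "x \<in> W" using V(3) by auto
    then show "x \<in> U" using W(2) x(2) by simp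
  qed
qed

text \<open>The increment of a curve has no fixed sign, so the mean value theorem is brought into a
  form without orientation that includes the degenerate segment.\<close>

lemma MVT_segment:
  fixes \<phi> :: "real \<Rightarrow> real"
  assumes "\<And>s. s \<in> closed_segment a b \<Longrightarrow> (\<phi> has_real_derivative \<phi>' s) (at s)"
  shows "\<exists>s\<in>closed_segment a b. \<phi> b - \<phi> a = (b - a) * \<phi>' s"
proof -
  consider "a < b" | "a = b" | "b < a" by linarith
  then show ?thesis
  proof cases
    case 1
    then show ?thesis
      using MVT2[of a b \<phi> \<phi>'] assms by (auto simp: closed_segment_eq_real_ivl intro!: bexI)
  next
    case 3
    then obtain s where "b < s" "s < a" "\<phi> a - \<phi> b = (a - b) * \<phi>' s"
      using MVT2[of b a \<phi> \<phi>'] assms by (auto simp: closed_segment_eq_real_ivl)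
    then show ?thesis
      using 3 by (intro bexI[of _ s]) (auto simp: closed_segment_eq_real_ivl algebra_simps)
  qed auto
qed

text \<open>Telescoping over the coordinates: each increment is handled by the mean value theorem.\<close>

lemma chain_rule_partial:
  assumes U: "openin (Euclidean_space n) U" and c0: "c t0 \<in> U"
    and c: "\<And>i. i < n \<Longrightarrow> ((\<lambda>t. c t i) has_real_derivative c' i) (at t0)"
    and ctop: "\<forall>\<^sub>F t in nhds t0. c t \<in> U"
    and g: "\<And>i x. i < n \<Longrightarrow> x \<in> U \<Longrightarrow> ((\<lambda>t. g (x(i := t))) has_real_derivative g' i x) (at (x i))"
    and g': "\<And>i. i < n \<Longrightarrow> continuous_map (subtopology (Euclidean_space n) U) euclideanreal (g' i)"
  shows "((\<lambda>t. g (c t)) has_real_derivative (\<Sum>i<n. g' i (c t0) * c' i)) (at t0)"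
proof -
  \<comment> \<open>\<open>z j t\<close> takes its first \<open>j\<close> coordinates from
    \<open>c t\<close> and the others from \<open>c t0\<close>. It runs from \<open>c t0\<close> at
    \<open>j = 0\<close> to \<open>c t\<close> at \<open>j = n\<close>, one coordinate at a
    time.\<close>
  define z where "z j t = (\<lambda>i. if i < j then c t i else c t0 i)" for j t
  have zS: "z (Suc j) t = (z j t)(j := c t j)" "z j t = (z j t)(j := c t0 j)" for j t
    by (auto simp: z_def fun_eq_iff less_Suc_eq)
  have close: "\<forall>\<^sub>F t in nhds t0. \<forall>i<n. \<bar>c t i - c t0 i\<bar> < e" if "e > 0" for e
  proof -
    have "\<forall>\<^sub>F t in nhds t0. \<bar>c t i - c t0 i\<bar> < e" if "i < n" for i
    proof -
      have "isCont (\<lambda>t. c t i) t0" using c[OF that] DERIV_isCont by blast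
      then have "((\<lambda>t. c t i) \<longlongrightarrow> c t0 i) (nhds t0)"
        by (simp add: tendsto_nhds_iff isCont_def)
      then show ?thesis using \<open>e > 0\<close> by (auto simp: tendsto_iff dist_real_def)
    qed
    then have "\<forall>\<^sub>F t in nhds t0. \<forall>i\<in>{..<n}. \<bar>c t i - c t0 i\<bar> < e"
      by (intro eventually_ball_finite) auto
    then show ?thesis by (simp add: Ball_def)
  qed
  have "((\<lambda>t. g (z j t)) has_real_derivative (\<Sum>i<j. g' i (c t0) * c' i)) (at t0)" if "j \<le> n" for j
    using that
  proof (induction j)
    case 0
    then show ?case by (simp add: z_def)
  next
    case (Suc j)
    then have j: "j < n" by simp
    define D where "D t = g (z (Suc j) t) - g (z j t)" for t
    \<comment> \<open>\<open>good t s\<close> makes \<open>s\<close> a mean value point for the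
      change of coordinate \<open>j\<close>, and \<open>G t\<close> is the partial derivative at a
      chosen such point.\<close>
    define good where "good t s \<longleftrightarrow> s \<in> closed_segment (c t0 j) (c t j) \<and>
      D t = (c t j - c t0 j) * g' j ((z j t)(j := s))" for t s
    define G where "G t = g' j ((z j t)(j := SOME s. good t s))" for t
    \<comment> \<open>With arbitrary neighbourhoods \<open>S\<close> this gives the limit of
      \<open>G\<close> at \<open>t0\<close>; the instance \<open>S = UNIV\<close> gives the mean
      value identity near \<open>t0\<close>.\<close>
    have ev: "\<forall>\<^sub>F t in nhds t0. D t = (c t j - c t0 j) * G t \<and> G t \<in> S"
      if S: "open S" "g' j (c t0) \<in> S" for S
    proof -
      define N where "N = {x \<in> U. g' j x \<in> S}"
      have "openin (subtopology (Euclidean_space n) U) {x \<in> topspace (subtopology (Euclidean_space n) U). g' j x \<in> S}"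
        using g'[OF j] S(1) by (intro openin_continuous_map_preimage[where Y = euclideanreal]) auto
      then have N: "openin (Euclidean_space n) N" "c t0 \<in> N"
        using c0 S(2) unfolding topspace_open_subset[OF U] N_def by (auto intro: openin_trans_full[OF _ U])
      obtain e where e: "e > 0"
        "\<And>x. (\<And>i. i < n \<Longrightarrow> \<bar>x i - c t0 i\<bar> < e) \<Longrightarrow> (\<And>i. i \<ge> n \<Longrightarrow> x i = 0) \<Longrightarrow> x \<in> N"
        using Euclidean_box[OF N] by blast
      show ?thesis using close[OF e(1)] ctop
      proof eventually_elim
        case (elim t)
        have in_N: "(z j t)(j := s) \<in> N" if "s \<in> closed_segment (c t0 j) (c t j)" for s
        proof (rule e(2))
          fix i assume i: "i < n"
          have "\<bar>s - c t0 j\<bar> \<le> \<bar>c t j - c t0 j\<bar>"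
            using that by (auto simp: closed_segment_eq_real_ivl split: if_splits)
          then show "\<bar>((z j t)(j := s)) i - c t0 i\<bar> < e"
            using elim i e(1) j by (auto simp: z_def intro: le_less_trans)
        next
          fix i assume "i \<ge> n"
          then show "((z j t)(j := s)) i = 0"
            using j open_subset_Euclidean[OF U elim(2), of i] open_subset_Euclidean[OF U c0, of i]
            by (auto simp: z_def)
        qed
        have "((\<lambda>s. g ((z j t)(j := s))) has_real_derivative g' j ((z j t)(j := s))) (at s)"
          if "s \<in> closed_segment (c t0 j) (c t j)" for s
          using g[OF j, of "(z j t)(j := s)"] in_N[OF that] by (simp add: N_def)
        then obtain s where s: "s \<in> closed_segment (c t0 j) (c t j)"
          "g ((z j t)(j := c t j)) - g ((z j t)(j := c t0 j)) = (c t j - c t0 j) * g' j ((z j t)(j := s))"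
          using MVT_segment[of "c t0 j" "c t j" "\<lambda>s. g ((z j t)(j := s))" "\<lambda>s. g' j ((z j t)(j := s))"]
          by blast
        have "good t s"
          unfolding good_def D_def zS(1) using s arg_cong[OF zS(2), of g j t] by presburger
        then have "\<exists>s. good t s" ..
        then have "good t (SOME s. good t s)" by (rule someI_ex)
        then show ?case using in_N unfolding good_def G_def N_def by blast
      qed
    qed
    have D0: "D t0 = 0" by (simp add: D_def z_def)
    have "(D has_real_derivative g' j (c t0) * c' j) (at t0)"
      unfolding has_field_derivative_iff
    proof (rule Lim_transform_eventually)
      have "(G \<longlongrightarrow> g' j (c t0)) (at t0)"
        unfolding tendsto_def eventually_at_filter by (blast intro: eventually_mono[OF ev])
      moreover have "((\<lambda>t. (c t j - c t0 j) / (t - t0)) \<longlongrightarrow> c' j) (at t0)"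
        using c[OF j] unfolding has_field_derivative_iff .
      ultimately show "((\<lambda>t. G t * ((c t j - c t0 j) / (t - t0))) \<longlongrightarrow> g' j (c t0) * c' j) (at t0)"
        by (rule tendsto_mult)
      show "\<forall>\<^sub>F t in at t0. G t * ((c t j - c t0 j) / (t - t0)) = (D t - D t0) / (t - t0)"
        unfolding eventually_at_filter by (rule eventually_mono[OF ev[of UNIV]]) (simp_all add: D0)
    qed
    from DERIV_add[OF Suc.IH this] j show ?case by (simp add: D_def algebra_simps)
  qed
  from this[of n] have *: "((\<lambda>t. g (z n t)) has_real_derivative (\<Sum>i<n. g' i (c t0) * c' i)) (at t0)" by simp
  have "\<forall>\<^sub>F t in nhds t0. g (z n t) = g (c t)"
    using ctop
  proof eventually_elim
    case (elim t)
    then have "z n t = c t"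
      using open_subset_Euclidean[OF U elim] open_subset_Euclidean[OF U c0]
      by (auto simp: z_def fun_eq_iff)
    then show ?case by simp
  qed
  then show ?thesis
    using * DERIV_cong_ev[of t0 t0 "\<lambda>t. g (z n t)" "\<lambda>t. g (c t)"] by blast
qed

text \<open>Products and compositions are treated together: unlike either class alone, the class of
  functions they generate is visibly closed under partial derivatives.\<close>

inductive Cinf_gen :: "nat \<Rightarrow> (nat \<Rightarrow> real) set \<Rightarrow> ((nat \<Rightarrow> real) \<Rightarrow> real) \<Rightarrow> bool" for m W where
  Cinf_gen_base: "Cinf_on m W f \<Longrightarrow> Cinf_gen m W f"
| Cinf_gen_comp: "Cinf_on n U g \<Longrightarrow> Cinf_map m W n h \<Longrightarrow> h ` W \<subseteq> U \<Longrightarrow> Cinf_gen m W (\<lambda>x. g (h x))"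
| Cinf_gen_add: "Cinf_gen m W f \<Longrightarrow> Cinf_gen m W g \<Longrightarrow> Cinf_gen m W (\<lambda>x. f x + g x)"
| Cinf_gen_mult: "Cinf_gen m W f \<Longrightarrow> Cinf_gen m W g \<Longrightarrow> Cinf_gen m W (\<lambda>x. f x * g x)"

lemma Cinf_gen_sum:
  fixes n :: nat
  assumes W: "openin (Euclidean_space m) W"
  shows "(\<And>j. j < n \<Longrightarrow> Cinf_gen m W (F j)) \<Longrightarrow> Cinf_gen m W (\<lambda>x. \<Sum>j<n. F j x)"
proof (induction n)
  case 0
  then show ?case using Cinf_gen_base[OF Cinf_on_const[OF W]] by simp
next
  case (Suc n)
  then have "Cinf_gen m W (\<lambda>x. (\<Sum>j<n. F j x) + F n x)"
    by (intro Cinf_gen_add) auto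
  then show ?case by simp
qed

lemma Cinf_gen_continuous:
  "Cinf_gen m W f \<Longrightarrow> continuous_map (subtopology (Euclidean_space m) W) euclideanreal f"
proof (induction rule: Cinf_gen.induct)
  case (Cinf_gen_comp n U g h)
  have "continuous_map (subtopology (Euclidean_space m) W) (subtopology (Euclidean_space n) U) h"
    using Cinf_map_continuous[OF Cinf_gen_comp(2)] Cinf_gen_comp(3) Cinf_map_openin[OF Cinf_gen_comp(2)]
    by (auto simp: continuous_map_in_subtopology)
  then show ?case
    using continuous_map_compose[OF _ Cinf_on_continuous[OF Cinf_gen_comp(1)]] by (simp add: o_def)
qed (auto intro: Cinf_on_continuous continuous_map_add continuous_map_real_mult)

lemma Cinf_gen_partial:
  assumes "Cinf_gen m W f" and W: "openin (Euclidean_space m) W" and i: "i < m"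
  shows "\<exists>f'. (\<forall>x\<in>W. ((\<lambda>t. f (x(i := t))) has_real_derivative f' x) (at (x i))) \<and> Cinf_gen m W f'"
  using assms(1)
proof (induction rule: Cinf_gen.induct)
  case (Cinf_gen_base f)
  then show ?case using Cinf_on_partial[OF _ i] Cinf_gen.Cinf_gen_base by metis
next
  case (Cinf_gen_comp n U g h)
  note U = Cinf_on_openin[OF Cinf_gen_comp(1)]
  have "\<forall>j. \<exists>g'. j < n \<longrightarrow> (\<forall>x\<in>U. ((\<lambda>t. g (x(j := t))) has_real_derivative g' x) (at (x j))) \<and> Cinf_on n U g'"
    using Cinf_on_partial[OF Cinf_gen_comp(1)] by metis
  then obtain g' where g': "\<And>j x. j < n \<Longrightarrow> x \<in> U \<Longrightarrow> ((\<lambda>t. g (x(j := t))) has_real_derivative g' j x) (at (x j))"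
    "\<And>j. j < n \<Longrightarrow> Cinf_on n U (g' j)" by metis
  have "\<forall>j. \<exists>h'. j < n \<longrightarrow> (\<forall>x\<in>W. ((\<lambda>t. h (x(i := t)) j) has_real_derivative h' x) (at (x i))) \<and> Cinf_on m W h'"
    using Cinf_on_partial[OF Cinf_map_component[OF Cinf_gen_comp(2)] i] by metis
  then obtain h' where h': "\<And>j x. j < n \<Longrightarrow> x \<in> W \<Longrightarrow> ((\<lambda>t. h (x(i := t)) j) has_real_derivative h' j x) (at (x i))"
    "\<And>j. j < n \<Longrightarrow> Cinf_on m W (h' j)" by metis
  have "((\<lambda>t. g (h (x(i := t)))) has_real_derivative (\<Sum>j<n. g' j (h x) * h' j x)) (at (x i))" if x: "x \<in> W" for x
  proof -
    have "\<forall>\<^sub>F t in nhds (x i). h (x(i := t)) \<in> U"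
      using eventually_fun_upd_in[OF W x i] by eventually_elim (use Cinf_gen_comp(3) in auto)
    moreover have "h x \<in> U" using Cinf_gen_comp(3) x by auto
    ultimately show ?thesis
      using chain_rule_partial[OF U, of "\<lambda>t. h (x(i := t))" "x i" "\<lambda>j. h' j x" g g',
          OF _ h'(1)[OF _ x] _ g'(1) Cinf_on_continuous[OF g'(2)]] by simp
  qed
  moreover have "Cinf_gen m W (\<lambda>x. \<Sum>j<n. g' j (h x) * h' j x)"
    using Cinf_gen.Cinf_gen_comp[OF g'(2) Cinf_gen_comp(2,3)] Cinf_gen.Cinf_gen_base[OF h'(2)]
    by (intro Cinf_gen_sum[OF W] Cinf_gen.Cinf_gen_mult)
  ultimately show ?case by (intro exI conjI ballI)
next
  case (Cinf_gen_add f g)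
  from Cinf_gen_add.IH obtain f' g' where
    "\<forall>x\<in>W. ((\<lambda>t. f (x(i := t))) has_real_derivative f' x) (at (x i))" "Cinf_gen m W f'"
    "\<forall>x\<in>W. ((\<lambda>t. g (x(i := t))) has_real_derivative g' x) (at (x i))" "Cinf_gen m W g'" by (elim exE conjE)
  then show ?case
    by (intro exI[of _ "\<lambda>x. f' x + g' x"] conjI ballI Cinf_gen.Cinf_gen_add DERIV_add) (drule (1) bspec, assumption)+
next
  case (Cinf_gen_mult f g)
  from Cinf_gen_mult.IH obtain f' g' where *:
    "\<forall>x\<in>W. ((\<lambda>t. f (x(i := t))) has_real_derivative f' x) (at (x i))" "Cinf_gen m W f'"
    "\<forall>x\<in>W. ((\<lambda>t. g (x(i := t))) has_real_derivative g' x) (at (x i))" "Cinf_gen m W g'" by (elim exE conjE)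
  have "((\<lambda>t. f (x(i := t)) * g (x(i := t))) has_real_derivative f' x * g x + g' x * f x) (at (x i))"
    if "x \<in> W" for x
    using DERIV_mult[OF bspec[OF *(1) that] bspec[OF *(3) that]] by simp
  moreover have "Cinf_gen m W (\<lambda>x. f' x * g x + g' x * f x)"
    using * Cinf_gen_mult.hyps by (intro Cinf_gen.intros(3,4))
  ultimately show ?case by (intro exI conjI ballI)
qed

lemma Cinf_gen_imp_Cinf_on:
  assumes "Cinf_gen m W f" and "openin (Euclidean_space m) W"
  shows "Cinf_on m W f"
  using assms(2,1)
  by (rule Cinf_on_coinduct[where P = "Cinf_gen m W"])
    (use assms(2) Cinf_gen_continuous Cinf_gen_partial in blast)+

lemma Cinf_on_compose:
  "Cinf_on n U g \<Longrightarrow> Cinf_map m W n h \<Longrightarrow> h ` W \<subseteq> U \<Longrightarrow> Cinf_on m W (\<lambda>x. g (h x))"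
  by (rule Cinf_gen_imp_Cinf_on[OF Cinf_gen_comp Cinf_map_openin])

lemma Cinf_on_add: "Cinf_on m W f \<Longrightarrow> Cinf_on m W g \<Longrightarrow> Cinf_on m W (\<lambda>x. f x + g x)"
  by (rule Cinf_gen_imp_Cinf_on[OF Cinf_gen_add[OF Cinf_gen_base Cinf_gen_base] Cinf_on_openin])

lemma Cinf_on_mult: "Cinf_on m W f \<Longrightarrow> Cinf_on m W g \<Longrightarrow> Cinf_on m W (\<lambda>x. f x * g x)"
  by (rule Cinf_gen_imp_Cinf_on[OF Cinf_gen_mult[OF Cinf_gen_base Cinf_gen_base] Cinf_on_openin])

lemma Cinf_map_compose:
  assumes "Cinf_map n U k g" "Cinf_map m W n h" "h ` W \<subseteq> U"
  shows "Cinf_map m W k (\<lambda>x. g (h x))"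
  using assms Cinf_on_compose[OF Cinf_map_component[OF assms(1)] assms(2,3)]
  unfolding Cinf_map_def by blast

section \<open>Diffeologies\<close>

lemma locally_onI: "openin (Euclidean_space n) U \<Longrightarrow> P U \<Longrightarrow> locally_on n U P"
  by (auto simp: locally_on_def)

lemma locally_onE:
  assumes "locally_on n U P" and "u \<in> U"
  obtains W where "openin (Euclidean_space n) W" "u \<in> W" "W \<subseteq> U" "P W"
  using assms by (auto simp: locally_on_def)

lemma locally_on_mono:
  assumes "locally_on n U P" and "\<And>W. openin (Euclidean_space n) W \<Longrightarrow> W \<subseteq> U \<Longrightarrow> P W \<Longrightarrow> Q W"
  shows "locally_on n U Q"
  using assms unfolding locally_on_def by meson

lemma locally_on_locally:
  assumes "locally_on n U (\<lambda>W. locally_on n W P)"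
  shows "locally_on n U P"
  using assms unfolding locally_on_def by (meson order_trans)

text \<open>Smooth maps are continuous, so preimages of the neighbourhoods for \<open>P\<close> are
  open. This reduces the composition axiom of a locally defined diffeology to a single
  neighbourhood.\<close>

lemma locally_on_pullback:
  assumes P: "locally_on n U P" and h: "Cinf_map m W n h" "h ` W \<subseteq> U"
    and Q: "\<And>U' W'. P U' \<Longrightarrow> openin (Euclidean_space m) W' \<Longrightarrow> W' \<subseteq> W \<Longrightarrow> h ` W' \<subseteq> U' \<Longrightarrow> Q W'"
  shows "locally_on m W Q"
  unfolding locally_on_def
proof
  fix w assume w: "w \<in> W"
  then obtain U' where U': "openin (Euclidean_space n) U'" "h w \<in> U'" "P U'"
    using P h(2) unfolding locally_on_def by blast
  let ?W' = "{x \<in> W. h x \<in> U'}"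
  have "openin (Euclidean_space m) ?W'" using openin_Cinf_map_preimage[OF h(1) U'(1)] .
  moreover from this have "Q ?W'" using Q[OF U'(3)] by blast
  ultimately show "\<exists>W'. openin (Euclidean_space m) W' \<and> w \<in> W' \<and> W' \<subseteq> W \<and> Q W'"
    using w U'(2) by blast
qed

lemma Cinf_map_id: "openin (Euclidean_space n) U \<Longrightarrow> Cinf_map n U n (\<lambda>x. x)"
  using openin_subset by (fastforce simp: Cinf_map_def intro: Cinf_on_coordinate)

context
  fixes Z :: "'a dspace"
  assumes Z: "diffeology Z"
begin

lemmas diffeologyD = Z[unfolded diffeology_def comp_def]

lemma plot_open: "plots Z n U p \<Longrightarrow> openin (Euclidean_space n) U"
  using diffeologyD[THEN conjunct1, rule_format] by simp

lemma plot_points: "plots Z n U p \<Longrightarrow> u \<in> U \<Longrightarrow> p u \<in> points Z"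
  using diffeologyD[THEN conjunct1, rule_format, of n U p] by auto

lemma plot_cong: "plots Z n U p \<Longrightarrow> (\<And>u. u \<in> U \<Longrightarrow> p u = q u) \<Longrightarrow> plots Z n U q"
  by (rule diffeologyD[THEN conjunct2, THEN conjunct1, rule_format, of n U p]) simp

lemma plot_const: "openin (Euclidean_space n) U \<Longrightarrow> a \<in> points Z \<Longrightarrow> plots Z n U (\<lambda>_. a)"
  by (rule diffeologyD[THEN conjunct2, THEN conjunct2, THEN conjunct1, rule_format]) simp

lemma plot_locally: "openin (Euclidean_space n) U \<Longrightarrow> locally_on n U (\<lambda>W. plots Z n W p) \<Longrightarrow> plots Z n U p"
  by (rule diffeologyD[THEN conjunct2, THEN conjunct2, THEN conjunct2, THEN conjunct1, rule_format]) simp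

lemma plot_compose: "plots Z n U p \<Longrightarrow> Cinf_map m W n h \<Longrightarrow> h ` W \<subseteq> U \<Longrightarrow> plots Z m W (\<lambda>x. p (h x))"
  by (rule diffeologyD[THEN conjunct2, THEN conjunct2, THEN conjunct2, THEN conjunct2, rule_format, of n U p]) simp

lemma plot_subset:
  assumes "plots Z n U p" "openin (Euclidean_space n) W" "W \<subseteq> U"
  shows "plots Z n W p"
  using plot_compose[OF assms(1) Cinf_map_id[OF assms(2)]] assms(3) by simp

end

lemma diffeologyI:
  assumes "\<And>n U p. plots Z n U p \<Longrightarrow> openin (Euclidean_space n) U"
    and "\<And>n U p u. plots Z n U p \<Longrightarrow> u \<in> U \<Longrightarrow> p u \<in> points Z"
    and "\<And>n U p q. plots Z n U p \<Longrightarrow> (\<And>u. u \<in> U \<Longrightarrow> p u = q u) \<Longrightarrow> plots Z n U q"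
    and "\<And>n U a. openin (Euclidean_space n) U \<Longrightarrow> a \<in> points Z \<Longrightarrow> plots Z n U (\<lambda>_. a)"
    and "\<And>n U p. openin (Euclidean_space n) U \<Longrightarrow> locally_on n U (\<lambda>W. plots Z n W p) \<Longrightarrow> plots Z n U p"
    and "\<And>n U p m W h. plots Z n U p \<Longrightarrow> Cinf_map m W n h \<Longrightarrow> h ` W \<subseteq> U \<Longrightarrow> plots Z m W (\<lambda>x. p (h x))"
  shows "diffeology Z"
  unfolding diffeology_def comp_def
proof (intro conjI allI impI)
  show "openin (Euclidean_space n) U" "p ` U \<subseteq> points Z" if "plots Z n U p" for n U p
    using assms(1,2)[OF that] by auto
  show "plots Z n U q" if "plots Z n U p \<and> (\<forall>u\<in>U. p u = q u)" for n U p q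
    using that by (auto intro: assms(3)[of n U p])
  show "plots Z n U (\<lambda>_. a)" if "openin (Euclidean_space n) U \<and> a \<in> points Z" for n U a
    using that by (simp add: assms(4))
  show "plots Z n U p" if "openin (Euclidean_space n) U \<and> locally_on n U (\<lambda>W. plots Z n W p)" for n U p
    using that by (simp add: assms(5))
  show "plots Z m W (\<lambda>x. p (h x))" if "plots Z n U p \<and> Cinf_map m W n h \<and> h ` W \<subseteq> U" for n U p m W h
    using that assms(6)[of n U p m W h] by simp
qed

lemma diffeology_sum:
  assumes Z1: "diffeology Z1" and Z2: "diffeology Z2"
  shows "diffeology (sum_ds Z1 Z2)"
proof -
  let ?P = "\<lambda>n p W. (\<exists>q. plots Z1 n W q \<and> (\<forall>u\<in>W. p u = Inl (q u))) \<or>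
                           (\<exists>q. plots Z2 n W q \<and> (\<forall>u\<in>W. p u = Inr (q u)))"
  have plots_eq: "plots (sum_ds Z1 Z2) n U p \<longleftrightarrow> openin (Euclidean_space n) U \<and> locally_on n U (?P n p)" for n U p
    by (simp add: sum_ds_def)
  show ?thesis
  proof (rule diffeologyI, unfold plots_eq)
    fix n U p u assume *: "openin (Euclidean_space n) U \<and> locally_on n U (?P n p)" and u: "u \<in> U"
    then obtain W where "u \<in> W" "?P n p W" by (blast elim: locally_onE)
    then show "p u \<in> points (sum_ds Z1 Z2)"
      using plot_points[OF Z1] plot_points[OF Z2] by (fastforce simp: sum_ds_def)
  next
    fix n U p q assume *: "openin (Euclidean_space n) U \<and> locally_on n U (?P n p)"
      and eq: "\<And>u. u \<in> U \<Longrightarrow> p u = q u"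
    have "locally_on n U (?P n q)"
    proof (rule locally_on_mono[OF conjunct2[OF *]])
      fix W assume "W \<subseteq> U" and P: "?P n p W"
      then have "\<And>u. u \<in> W \<Longrightarrow> q u = p u" using eq by auto
      with P show "?P n q W" by (simp cong: ball_cong)
    qed
    then show "openin (Euclidean_space n) U \<and> locally_on n U (?P n q)" using * by simp
  next
    fix n U a assume U: "openin (Euclidean_space n) U" and "a \<in> points (sum_ds Z1 Z2)"
    then consider b where "b \<in> points Z1" "a = Inl b" | b where "b \<in> points Z2" "a = Inr b"
      by (auto simp: sum_ds_def)
    then have "?P n (\<lambda>_. a) U"
      using plot_const[OF Z1 U] plot_const[OF Z2 U] by cases blast+
    then show "openin (Euclidean_space n) U \<and> locally_on n U (?P n (\<lambda>_. a))"
      using U by (auto intro: locally_onI)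
  next
    fix n U p assume U: "openin (Euclidean_space n) U"
      and loc: "locally_on n U (\<lambda>W. openin (Euclidean_space n) W \<and> locally_on n W (?P n p))"
    show "openin (Euclidean_space n) U \<and> locally_on n U (?P n p)"
      by (intro conjI U locally_on_locally[OF locally_on_mono[OF loc]]) (rule conjunct2)
  next
    fix n U p m W h assume *: "openin (Euclidean_space n) U \<and> locally_on n U (?P n p)"
      and h: "Cinf_map m W n h" "h ` W \<subseteq> U"
    have "locally_on m W (?P m (\<lambda>x. p (h x)))"
    proof (rule locally_on_pullback[OF conjunct2[OF *] h])
      fix U' W' assume P: "?P n p U'" and W': "openin (Euclidean_space m) W'" "W' \<subseteq> W" "h ` W' \<subseteq> U'"
      note h' = Cinf_map_subset[OF h(1) W'(1,2)]
      from P show "?P m (\<lambda>x. p (h x)) W'"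
      proof (elim disjE exE conjE)
        fix q assume "plots Z1 n U' q" "\<forall>u\<in>U'. p u = Inl (q u)"
        then show ?thesis
          using plot_compose[OF Z1 _ h' W'(3), of q] W'(3) by (intro disjI1 exI[of _ "\<lambda>x. q (h x)"]) auto
      next
        fix q assume "plots Z2 n U' q" "\<forall>u\<in>U'. p u = Inr (q u)"
        then show ?thesis
          using plot_compose[OF Z2 _ h' W'(3), of q] W'(3) by (intro disjI2 exI[of _ "\<lambda>x. q (h x)"]) auto
      qed
    qed
    then show "openin (Euclidean_space m) W \<and> locally_on m W (?P m (\<lambda>x. p (h x)))"
      using Cinf_map_openin[OF h(1)] by simp
  qed auto
qed

lemma diffeology_quotient:
  assumes Z: "diffeology Z"
  shows "diffeology (quotient_ds Z k)"
proof -
  let ?P = "\<lambda>n p W. \<exists>q. plots Z n W q \<and> (\<forall>u\<in>W. p u = k (q u))"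
  have plots_eq: "plots (quotient_ds Z k) n U p \<longleftrightarrow> openin (Euclidean_space n) U \<and> locally_on n U (?P n p)" for n U p
    by (simp add: quotient_ds_def)
  show ?thesis
  proof (rule diffeologyI, unfold plots_eq)
    fix n U p u assume *: "openin (Euclidean_space n) U \<and> locally_on n U (?P n p)" and u: "u \<in> U"
    then obtain W where "u \<in> W" "?P n p W" by (blast elim: locally_onE)
    then show "p u \<in> points (quotient_ds Z k)"
      using plot_points[OF Z] by (fastforce simp: quotient_ds_def)
  next
    fix n U p q assume *: "openin (Euclidean_space n) U \<and> locally_on n U (?P n p)"
      and eq: "\<And>u. u \<in> U \<Longrightarrow> p u = q u"
    have "locally_on n U (?P n q)"
    proof (rule locally_on_mono[OF conjunct2[OF *]])
      fix W assume "W \<subseteq> U" and P: "?P n p W"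
      then have "\<And>u. u \<in> W \<Longrightarrow> q u = p u" using eq by auto
      with P show "?P n q W" by (simp cong: ball_cong)
    qed
    then show "openin (Euclidean_space n) U \<and> locally_on n U (?P n q)" using * by simp
  next
    fix n U a assume "openin (Euclidean_space n) U" "a \<in> points (quotient_ds Z k)"
    then show "openin (Euclidean_space n) U \<and> locally_on n U (?P n (\<lambda>_. a))"
      using plot_const[OF Z] by (auto simp: quotient_ds_def intro!: locally_onI)
  next
    fix n U p assume U: "openin (Euclidean_space n) U"
      and loc: "locally_on n U (\<lambda>W. openin (Euclidean_space n) W \<and> locally_on n W (?P n p))"
    show "openin (Euclidean_space n) U \<and> locally_on n U (?P n p)"
      by (intro conjI U locally_on_locally[OF locally_on_mono[OF loc]]) (rule conjunct2)
  next
    fix n U p m W h assume *: "openin (Euclidean_space n) U \<and> locally_on n U (?P n p)"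
      and h: "Cinf_map m W n h" "h ` W \<subseteq> U"
    have "locally_on m W (?P m (\<lambda>x. p (h x)))"
    proof (rule locally_on_pullback[OF conjunct2[OF *] h])
      fix U' W' assume P: "?P n p U'" and W': "openin (Euclidean_space m) W'" "W' \<subseteq> W" "h ` W' \<subseteq> U'"
      note h' = Cinf_map_subset[OF h(1) W'(1,2)]
      from P show "?P m (\<lambda>x. p (h x)) W'"
      proof (elim exE conjE)
        fix q assume "plots Z n U' q" "\<forall>u\<in>U'. p u = k (q u)"
        then show ?thesis
          using plot_compose[OF Z _ h' W'(3), of q] W'(3) by (intro exI[of _ "\<lambda>x. q (h x)"]) auto
      qed
    qed
    then show "openin (Euclidean_space m) W \<and> locally_on m W (?P m (\<lambda>x. p (h x)))"
      using Cinf_map_openin[OF h(1)] by simp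
  qed auto
qed

lemma diffeology_glue: "diffeology Z1 \<Longrightarrow> diffeology Z2 \<Longrightarrow> diffeology (glue_ds Z1 Y h Z2)"
  unfolding glue_ds_def by (intro diffeology_quotient diffeology_sum)

lemma dsmooth_points: "dsmooth Z Z' f \<Longrightarrow> z \<in> points Z \<Longrightarrow> f z \<in> points Z'"
  by (auto simp: dsmooth_def)

lemma dsmooth_plot: "dsmooth Z Z' f \<Longrightarrow> plots Z n U p \<Longrightarrow> plots Z' n U (\<lambda>u. f (p u))"
  by (auto simp: dsmooth_def comp_def)


section \<open>Glued spaces\<close>

text \<open>Normal form modulo gluing: glued points of the first piece are moved to the second. It
  turns questions about the equivalence closure into equations.\<close>

definition glue_norm :: "'a set \<Rightarrow> ('a \<Rightarrow> 'b) \<Rightarrow> 'a + 'b \<Rightarrow> 'a + 'b" where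
  "glue_norm Y h a = (case a of Inl z \<Rightarrow> if z \<in> Y then Inr (h z) else Inl z | Inr w \<Rightarrow> Inr w)"

lemma glue_norm_simps [simp]:
  "glue_norm Y h (Inl z) = (if z \<in> Y then Inr (h z) else Inl z)"
  "glue_norm Y h (Inr w) = Inr w"
  by (simp_all add: glue_norm_def)

text \<open>Every point is linked to its normal form by at most one generating step, and generating
  steps do not change normal forms.\<close>

lemma glue_rel_iff:
  fixes h :: "'a \<Rightarrow> 'b"
  shows "(a, b) \<in> glue_rel Y h \<longleftrightarrow> glue_norm Y h a = glue_norm Y h b"
proof -
  define R :: "(('a + 'b) \<times> ('a + 'b)) set" where "R = {(Inl z, Inr (h z)) | z. z \<in> Y}"
  have rel: "glue_rel Y h = (R \<union> R\<inverse>)\<^sup>*" by (simp add: glue_rel_def R_def Let_def)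
  have norm: "(a, glue_norm Y h a) \<in> (R \<union> R\<inverse>)\<^sup>*" for a
    by (cases a) (auto simp: R_def)
  have sym: "(a, b) \<in> (R \<union> R\<inverse>)\<^sup>* \<Longrightarrow> (b, a) \<in> (R \<union> R\<inverse>)\<^sup>*" for a b
    by (metis Un_commute converse_Un converse_converse rtrancl_converseI)
  have "glue_norm Y h a = glue_norm Y h b" if "(a, b) \<in> (R \<union> R\<inverse>)\<^sup>*"
    using that by induction (auto simp: R_def)
  then show ?thesis unfolding rel using norm sym rtrancl_trans by metis
qed

lemma glue_class_eq_iff: "glue_class Y h a = glue_class Y h b \<longleftrightarrow> glue_norm Y h a = glue_norm Y h b"
  by (auto simp: glue_class_def glue_rel_iff set_eq_iff)

lemma inc1_glued: "z \<in> Y \<Longrightarrow> inc1 Y h z = inc2 Y h (h z)"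
  by (simp add: inc1_def inc2_def glue_class_eq_iff)

lemma inc2_eq_iff [simp]: "inc2 Y h w = inc2 Y h w' \<longleftrightarrow> w = w'"
  by (simp add: inc2_def glue_class_eq_iff)

lemma inc1_eq_inc2_iff: "inc1 Y h z = inc2 Y h w \<longleftrightarrow> z \<in> Y \<and> h z = w"
  by (auto simp: inc1_def inc2_def glue_class_eq_iff)

lemma inc1_eq_iff:
  "inc1 Y h z = inc1 Y h z' \<longleftrightarrow> (if z \<in> Y \<and> z' \<in> Y then h z = h z' else z = z')"
  by (auto simp: inc1_def glue_class_eq_iff)

lemma inc1_inject: "inj_on h Y \<Longrightarrow> inc1 Y h z = inc1 Y h z' \<longleftrightarrow> z = z'"
  by (auto simp: inc1_eq_iff inj_on_eq_iff)

lemma in2_inc2 [simp]: "w \<in> points Z2 \<Longrightarrow> in2 Y h Z2 (inc2 Y h w)"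
  by (simp add: in2_def)

lemma in2_inc1 [simp]: "z \<notin> Y \<Longrightarrow> \<not> in2 Y h Z2 (inc1 Y h z)"
  by (auto simp: in2_def inc1_eq_inc2_iff)

lemma out2_inc2 [simp]: "w \<in> points Z2 \<Longrightarrow> out2 Y h Z2 (inc2 Y h w) = w"
  unfolding out2_def by (rule inv_into_f_f) (auto simp: inj_on_def)

lemma out1_inc1 [simp]: "z \<in> points Z1 \<Longrightarrow> z \<notin> Y \<Longrightarrow> out1 Z1 Y h (inc1 Y h z) = z"
  unfolding out1_def by (rule inv_into_f_f) (auto simp: inj_on_def inc1_eq_iff)

lemma points_glue: "points (glue_ds Z1 Y h Z2) = inc1 Y h ` points Z1 \<union> inc2 Y h ` points Z2"
  by (auto simp: glue_ds_def quotient_ds_def sum_ds_def inc1_def inc2_def)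

lemma glue_cases:
  assumes "a \<in> points (glue_ds Z1 Y h Z2)" and "h ` (Y \<inter> points Z1) \<subseteq> points Z2"
  obtains z where "z \<in> points Z1" "z \<notin> Y" "a = inc1 Y h z"
  | w where "w \<in> points Z2" "a = inc2 Y h w"
proof -
  from assms(1) consider z where "z \<in> points Z1" "a = inc1 Y h z" | w where "w \<in> points Z2" "a = inc2 Y h w"
    unfolding points_glue by blast
  then show thesis
  proof cases
    case (1 z)
    show thesis
    proof (cases "z \<in> Y")
      case True
      then have "h z \<in> points Z2" using 1(1) assms(2) by blast
      then show thesis using that(2)[of "h z"] 1(2) inc1_glued[OF True, of h] by simp
    qed (use that(1) 1 in blast)
  qed (use that(2) in blast)
qed

lemma inc1_points: "z \<in> points Z1 \<Longrightarrow> inc1 Y h z \<in> points (glue_ds Z1 Y h Z2)"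
  and inc2_points: "w \<in> points Z2 \<Longrightarrow> inc2 Y h w \<in> points (glue_ds Z1 Y h Z2)"
  by (auto simp: points_glue)

definition glue_lift where
  "glue_lift Z1 Y h Z2 n p W \<longleftrightarrow>
     (\<exists>q. plots Z1 n W q \<and> (\<forall>u\<in>W. p u = inc1 Y h (q u))) \<or>
     (\<exists>q. plots Z2 n W q \<and> (\<forall>u\<in>W. p u = inc2 Y h (q u)))"

text \<open>Two layers of locality, one from the quotient and one from the disjoint union, merge
  into one: near each parameter a plot comes from a plot of a single piece.\<close>

lemma glue_plots_iff:
  assumes Z1: "diffeology Z1" and Z2: "diffeology Z2"
  shows "plots (glue_ds Z1 Y h Z2) n U p \<longleftrightarrow>
    openin (Euclidean_space n) U \<and> locally_on n U (glue_lift Z1 Y h Z2 n p)" (is "?L \<longleftrightarrow> ?R")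
proof
  assume ?L
  then have U: "openin (Euclidean_space n) U"
    and loc: "locally_on n U (\<lambda>W. \<exists>q. plots (sum_ds Z1 Z2) n W q \<and> (\<forall>u\<in>W. p u = glue_class Y h (q u)))"
    by (auto simp: glue_ds_def quotient_ds_def)
  have "locally_on n U (\<lambda>W. locally_on n W (glue_lift Z1 Y h Z2 n p))"
    using loc
  proof (rule locally_on_mono)
    fix W assume "\<exists>q. plots (sum_ds Z1 Z2) n W q \<and> (\<forall>u\<in>W. p u = glue_class Y h (q u))"
    then obtain q where q: "plots (sum_ds Z1 Z2) n W q" "\<forall>u\<in>W. p u = glue_class Y h (q u)" by blast
    have "locally_on n W (\<lambda>W. (\<exists>q'. plots Z1 n W q' \<and> (\<forall>u\<in>W. q u = Inl (q' u))) \<or>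
                           (\<exists>q'. plots Z2 n W q' \<and> (\<forall>u\<in>W. q u = Inr (q' u))))"
      using q(1) by (simp add: sum_ds_def)
    then show "locally_on n W (glue_lift Z1 Y h Z2 n p)"
    proof (rule locally_on_mono)
      fix W' assume "W' \<subseteq> W" and "(\<exists>q'. plots Z1 n W' q' \<and> (\<forall>u\<in>W'. q u = Inl (q' u))) \<or>
                           (\<exists>q'. plots Z2 n W' q' \<and> (\<forall>u\<in>W'. q u = Inr (q' u)))"
      then show "glue_lift Z1 Y h Z2 n p W'"
        using q(2) unfolding glue_lift_def inc1_def inc2_def by (metis subsetD)
    qed
  qed
  then show ?R using U locally_on_locally by blast
next
  assume R: ?R
  have "locally_on n U (\<lambda>W. \<exists>q. plots (sum_ds Z1 Z2) n W q \<and> (\<forall>u\<in>W. p u = glue_class Y h (q u)))"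
    using conjunct2[OF R]
  proof (rule locally_on_mono)
    fix W assume W: "openin (Euclidean_space n) W" and "glue_lift Z1 Y h Z2 n p W"
    then consider q where "plots Z1 n W q" "\<forall>u\<in>W. p u = inc1 Y h (q u)"
      | q where "plots Z2 n W q" "\<forall>u\<in>W. p u = inc2 Y h (q u)"
      unfolding glue_lift_def by blast
    then show "\<exists>q. plots (sum_ds Z1 Z2) n W q \<and> (\<forall>u\<in>W. p u = glue_class Y h (q u))"
    proof cases
      case 1
      then show ?thesis using W
        by (intro exI[of _ "\<lambda>u. Inl (q u)"]) (auto simp: sum_ds_def inc1_def intro!: locally_onI)
    next
      case 2
      then show ?thesis using W
        by (intro exI[of _ "\<lambda>u. Inr (q u)"]) (auto simp: sum_ds_def inc2_def intro!: locally_onI)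
    qed
  qed
  then show ?L using R by (auto simp: glue_ds_def quotient_ds_def)
qed

lemma inc1_plot:
  assumes "diffeology Z1" "diffeology Z2" "plots Z1 n U q"
  shows "plots (glue_ds Z1 Y h Z2) n U (\<lambda>u. inc1 Y h (q u))"
  using assms plot_open[OF assms(1,3)] unfolding glue_plots_iff[OF assms(1,2)]
  by (auto simp: glue_lift_def intro!: locally_onI)

lemma inc2_plot:
  assumes "diffeology Z1" "diffeology Z2" "plots Z2 n U q"
  shows "plots (glue_ds Z1 Y h Z2) n U (\<lambda>u. inc2 Y h (q u))"
  using assms plot_open[OF assms(2,3)] unfolding glue_plots_iff[OF assms(1,2)]
  by (auto simp: glue_lift_def intro!: locally_onI)

lemma dsmooth_from_glue:
  assumes Z: "diffeology Z1" "diffeology Z2" "diffeology Z"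
    and 1: "\<And>n U q. plots Z1 n U q \<Longrightarrow> plots Z n U (\<lambda>u. f (inc1 Y h (q u)))"
    and 2: "\<And>n U q. plots Z2 n U q \<Longrightarrow> plots Z n U (\<lambda>u. f (inc2 Y h (q u)))"
  shows "dsmooth (glue_ds Z1 Y h Z2) Z f"
proof -
  have plot: "plots Z n U (\<lambda>u. f (p u))" if "plots (glue_ds Z1 Y h Z2) n U p" for n U p
  proof (rule plot_locally[OF Z(3)])
    show "openin (Euclidean_space n) U" using that glue_plots_iff[OF Z(1,2)] by blast
    have "locally_on n U (glue_lift Z1 Y h Z2 n p)" using that glue_plots_iff[OF Z(1,2)] by blast
    then show "locally_on n U (\<lambda>W. plots Z n W (\<lambda>u. f (p u)))"
    proof (rule locally_on_mono)
      fix W assume "glue_lift Z1 Y h Z2 n p W"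
      then consider q where "plots Z1 n W q" "\<forall>u\<in>W. p u = inc1 Y h (q u)"
        | q where "plots Z2 n W q" "\<forall>u\<in>W. p u = inc2 Y h (q u)"
        unfolding glue_lift_def by blast
      then show "plots Z n W (\<lambda>u. f (p u))"
      proof cases
        case (1 q)
        then show ?thesis by (intro plot_cong[OF Z(3) assms(4)[OF 1(1)]]) simp
      next
        case (2 q)
        then show ?thesis by (intro plot_cong[OF Z(3) assms(5)[OF 2(1)]]) simp
      qed
    qed
  qed
  \<comment> \<open>A point is the value of a constant plot on 0-dimensional space, so the result on
    plots yields the one on points.\<close>
  have "f a \<in> points Z" if a: "a \<in> points (glue_ds Z1 Y h Z2)" for a
  proof -
    have "plots (glue_ds Z1 Y h Z2) 0 (topspace (Euclidean_space 0)) (\<lambda>_. a)"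
      using plot_const[OF diffeology_glue[OF Z(1,2)] openin_topspace a] .
    from plot_points[OF Z(3) plot[OF this], of "\<lambda>_. 0"] show ?thesis
      by (simp add: topspace_Euclidean_space)
  qed
  then show ?thesis using plot by (auto simp: dsmooth_def comp_def)
qed

section \<open>Free and tensor algebras of a fibre\<close>

lemma poly_mapping_sum_singles: "p = (\<Sum>l\<in>Poly_Mapping.keys p. Poly_Mapping.single l (Poly_Mapping.lookup p l))"
proof (rule poly_mapping_eqI)
  fix k
  have "(\<Sum>l\<in>Poly_Mapping.keys p. Poly_Mapping.lookup (Poly_Mapping.single l (Poly_Mapping.lookup p l)) k)
    = (\<Sum>l\<in>Poly_Mapping.keys p. if l = k then Poly_Mapping.lookup p k else 0)"
    by (intro sum.cong) (auto simp: lookup_single)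
  also have "\<dots> = Poly_Mapping.lookup p k" by (simp add: in_keys_iff)
  finally show "Poly_Mapping.lookup p k =
      Poly_Mapping.lookup (\<Sum>l\<in>Poly_Mapping.keys p. Poly_Mapping.single l (Poly_Mapping.lookup p l)) k"
    by (simp add: lookup_sum)
qed

text \<open>The words \<open>l\<close> in the step are keys of \<open>q\<close> itself, which keeps
  facts about the letters of \<open>q\<close> available during the induction.\<close>

lemma poly_mapping_singles_induct [case_names zero add]:
  fixes q :: "'a \<Rightarrow>\<^sub>0 'b :: comm_monoid_add"
  assumes "P 0" and "\<And>l c p. l \<in> Poly_Mapping.keys q \<Longrightarrow> P p \<Longrightarrow> P (Poly_Mapping.single l c + p)"
  shows "P q"
proof -
  have "P (\<Sum>l\<in>S. Poly_Mapping.single l (Poly_Mapping.lookup q l))" if "S \<subseteq> Poly_Mapping.keys q" for S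
  proof -
    have "finite S" using that finite_subset finite_keys by blast
    then show ?thesis using that by induction (auto intro: assms)
  qed
  from this[OF subset_refl] show ?thesis using poly_mapping_sum_singles[of q] by simp
qed

text \<open>A common finite index set makes the sums for \<open>p\<close>, \<open>q\<close> and
  \<open>p + q\<close> comparable even when coefficients cancel.\<close>

lemma map_words_superset:
  assumes "finite S" "Poly_Mapping.keys p \<subseteq> S"
  shows "map_words \<Phi> p = (\<Sum>l\<in>S. Poly_Mapping.single (map \<Phi> l) (Poly_Mapping.lookup p l))"
  unfolding map_words_def using assms by (intro sum.mono_neutral_left) (auto simp: in_keys_iff)

lemma map_words_zero [simp]: "map_words \<Phi> 0 = 0"
  by (simp add: map_words_def)

lemma map_words_single [simp]: "map_words \<Phi> (Poly_Mapping.single l c) = Poly_Mapping.single (map \<Phi> l) c"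
  by (subst map_words_superset[of "{l}"]) auto

lemma map_words_add: "map_words \<Phi> (p + q) = map_words \<Phi> p + map_words \<Phi> q"
proof -
  let ?S = "Poly_Mapping.keys p \<union> Poly_Mapping.keys q"
  show ?thesis
    by (simp add: map_words_superset[of ?S] Poly_Mapping.keys_add lookup_add single_add sum.distrib)
qed

lemma map_words_minus: "map_words \<Phi> (- p) = - map_words \<Phi> p"
  using map_words_add[of \<Phi> p "- p"] by (simp add: eq_neg_iff_add_eq_0 add.commute)

lemma map_words_diff: "map_words \<Phi> (p - q) = map_words \<Phi> p - map_words \<Phi> q"
  using map_words_add[of \<Phi> p "- q"] by (simp add: map_words_minus)

lemma map_words_mult: "map_words \<Phi> (p * q) = map_words \<Phi> p * map_words \<Phi> q"
proof -
  have 1: "map_words \<Phi> (Poly_Mapping.single a c * q) = Poly_Mapping.single (map \<Phi> a) c * map_words \<Phi> q" for a c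
  proof (induction q rule: poly_mapping_singles_induct)
    case (add l d p)
    then show ?case
      by (simp add: distrib_left map_words_add mult_single plus_list_def)
  qed simp
  show ?thesis
    by (induction p rule: poly_mapping_singles_induct) (simp_all add: 1 distrib_right map_words_add)
qed

lemma map_words_comp:
  assumes "\<And>l. l \<in> Poly_Mapping.keys p \<Longrightarrow> map \<Psi> (map \<Phi> l) = l"
  shows "map_words \<Psi> (map_words \<Phi> p) = p"
proof (induction p rule: poly_mapping_singles_induct)
  case (add l c q)
  then show ?case using assms[of l] by (simp add: map_words_add del: map_map)
qed simp

lemma keys_map_words: "Poly_Mapping.keys (map_words \<Phi> p) \<subseteq> map \<Phi> ` Poly_Mapping.keys p"
  unfolding map_words_def using Poly_Mapping.keys_sum
  by (rule order_trans) (auto split: if_splits)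

abbreviation pm_scale :: "real \<Rightarrow> ('a list \<Rightarrow>\<^sub>0 real) \<Rightarrow> ('a list \<Rightarrow>\<^sub>0 real)" where
  "pm_scale c \<equiv> Poly_Mapping.map ((*) c)"

text \<open>The empty word is the unit for concatenation, so scalars act through multiples of one;
  compatibility of algebra maps with scaling then follows from multiplicativity.\<close>

lemma pm_scale_eq: "pm_scale c p = Poly_Mapping.single [] c * p"
  using mult_map_scale_conv_mult[of c p] by (simp add: zero_list_def)

lemma pm_scale_mult_right: "p * pm_scale c q = pm_scale c (p * q)"
proof -
  have "p * Poly_Mapping.single [] c = Poly_Mapping.single [] c * p"
    by (induction p rule: poly_mapping_singles_induct)
      (simp_all add: distrib_left distrib_right mult_single plus_list_def mult.commute)
  then show ?thesis by (simp add: pm_scale_eq mult.assoc[symmetric])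
qed

interpretation pm: Modules.module pm_scale
proof
  have 1: "Poly_Mapping.single [] (1::real) = (1 :: 'a list \<Rightarrow>\<^sub>0 real)"
    by (metis single_one zero_list_def)
  show "pm_scale 1 p = p" for p :: "'a list \<Rightarrow>\<^sub>0 real" by (simp add: pm_scale_eq 1)
qed (simp_all add: pm_scale_eq distrib_left distrib_right single_add mult.assoc[symmetric] mult_single plus_list_def)

lemma map_words_scale: "map_words \<Phi> (pm_scale c p) = pm_scale c (map_words \<Phi> p)"
  by (simp add: pm_scale_eq map_words_mult)

text \<open>These closure properties keep the multilinearity relations inside
  \<open>words V x\<close>, which makes them an ideal of the free algebra and the tensor algebra a
  ring. They pass to dual and glued bundles.\<close>

definition fibre_closed :: "('v, 'x) pbundle \<Rightarrow> 'x \<Rightarrow> bool" where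
  "fibre_closed V x \<longleftrightarrow> vzero V x \<in> fibre V x \<and>
     (\<forall>v\<in>fibre V x. \<forall>w\<in>fibre V x. vadd V v w \<in> fibre V x) \<and>
     (\<forall>c. \<forall>v\<in>fibre V x. vscale V c v \<in> fibre V x)"

definition words :: "('v, 'x) pbundle \<Rightarrow> 'x \<Rightarrow> ('v list \<Rightarrow>\<^sub>0 real) set" where
  "words V x = {p. Poly_Mapping.keys p \<subseteq> lists (fibre V x)}"

lemma free_alg_simps [simp]:
  "carrier (free_alg V x) = words V x" "p \<otimes>\<^bsub>free_alg V x\<^esub> q = p * q" "p \<oplus>\<^bsub>free_alg V x\<^esub> q = p + q"
  "\<one>\<^bsub>free_alg V x\<^esub> = 1" "\<zero>\<^bsub>free_alg V x\<^esub> = 0"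
  by (simp_all add: free_alg_def ring_of_type_algebra_def words_def)

lemma words_single: "l \<in> lists (fibre V x) \<Longrightarrow> Poly_Mapping.single l c \<in> words V x"
  by (auto simp: words_def split: if_splits)

lemma words_zero: "0 \<in> words V x"
  by (simp add: words_def)

lemma words_one: "1 \<in> words V x"
  using words_single[of "[]" V x 1] by (metis lists.Nil single_one zero_list_def)

lemma words_add: "p \<in> words V x \<Longrightarrow> q \<in> words V x \<Longrightarrow> p + q \<in> words V x"
  unfolding words_def using Poly_Mapping.keys_add[of p q] by blast

lemma words_minus: "p \<in> words V x \<Longrightarrow> - p \<in> words V x"
  by (simp add: words_def in_keys_iff subset_iff)

lemma words_diff: "p \<in> words V x \<Longrightarrow> q \<in> words V x \<Longrightarrow> p - q \<in> words V x"
  using words_add[of p V x "- q"] words_minus[of q V x] by simp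

lemma words_mult: "p \<in> words V x \<Longrightarrow> q \<in> words V x \<Longrightarrow> p * q \<in> words V x"
  unfolding words_def using Poly_Mapping.keys_mult[of p q] by (fastforce simp: plus_list_def)

lemma words_subspace: "pm.subspace (words V x)"
  by (rule pm.subspaceI) (auto simp: pm_scale_eq intro!: words_zero words_add words_mult words_single)

lemma ring_ring_of_type_algebra: "ring (ring_of_type_algebra :: 'a :: ring_1 ring)"
proof -
  have "\<exists>y. x + y = 0" "\<exists>y. y + x = 0" for x :: 'a
    using add.right_inverse add.left_inverse by blast+
  then show ?thesis
    unfolding ring_of_type_algebra_def by unfold_locales (auto simp: algebra_simps Units_def)
qed

lemma ring_free_alg: "ring (free_alg V x)"
proof -
  let ?R = "ring_of_type_algebra :: ('a list \<Rightarrow>\<^sub>0 real) ring"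
  interpret R: ring ?R by (rule ring_ring_of_type_algebra)
  have R: "p \<otimes>\<^bsub>?R\<^esub> q = p * q" "p \<oplus>\<^bsub>?R\<^esub> q = p + q" "\<one>\<^bsub>?R\<^esub> = 1" "\<zero>\<^bsub>?R\<^esub> = 0" "carrier ?R = UNIV" for p q
    by (simp_all add: ring_of_type_algebra_def)
  have neg: "\<ominus>\<^bsub>?R\<^esub> p = - p" for p by (rule R.minus_equality) (simp_all add: R)
  have "subring (words V x) ?R"
    by (rule R.subringI) (simp_all add: R neg words_one words_minus words_mult words_add)
  from R.subring_is_ring[OF this] show ?thesis by (simp add: free_alg_def words_def)
qed

section \<open>The ideal of multilinearity relations and the tensor algebra as a quotient
  ring\<close>

definition tensor_gens :: "('v, 'x) pbundle \<Rightarrow> 'x \<Rightarrow> ('v list \<Rightarrow>\<^sub>0 real) set" where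
  "tensor_gens V x =
     {Poly_Mapping.single (xs @ [vadd V v w] @ ys) 1
         - Poly_Mapping.single (xs @ [v] @ ys) 1 - Poly_Mapping.single (xs @ [w] @ ys) 1 | xs ys v w.
         xs \<in> lists (fibre V x) \<and> ys \<in> lists (fibre V x) \<and> v \<in> fibre V x \<and> w \<in> fibre V x} \<union>
      {Poly_Mapping.single (xs @ [vscale V c v] @ ys) 1 - Poly_Mapping.single (xs @ [v] @ ys) c | xs ys c v.
         xs \<in> lists (fibre V x) \<and> ys \<in> lists (fibre V x) \<and> v \<in> fibre V x}"

lemma tensor_rels_span: "tensor_rels V x = pm.span (tensor_gens V x)"
  by (simp add: tensor_rels_def tensor_gens_def)

lemma tensor_gens_cases:
  assumes "r \<in> tensor_gens V x"
  obtains (add) xs ys v w where "xs \<in> lists (fibre V x)" "ys \<in> lists (fibre V x)" "v \<in> fibre V x" "w \<in> fibre V x"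
    "r = Poly_Mapping.single (xs @ [vadd V v w] @ ys) 1
         - Poly_Mapping.single (xs @ [v] @ ys) 1 - Poly_Mapping.single (xs @ [w] @ ys) 1"
  | (scale) xs ys c v where "xs \<in> lists (fibre V x)" "ys \<in> lists (fibre V x)" "v \<in> fibre V x"
    "r = Poly_Mapping.single (xs @ [vscale V c v] @ ys) 1 - Poly_Mapping.single (xs @ [v] @ ys) c"
  using assms unfolding tensor_gens_def by blast

lemma tensor_gens_add:
  assumes "xs \<in> lists (fibre V x)" "ys \<in> lists (fibre V x)" "v \<in> fibre V x" "w \<in> fibre V x"
  shows "Poly_Mapping.single (xs @ [vadd V v w] @ ys) 1
         - Poly_Mapping.single (xs @ [v] @ ys) 1 - Poly_Mapping.single (xs @ [w] @ ys) 1 \<in> tensor_gens V x"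
  using assms unfolding tensor_gens_def by blast

lemma tensor_gens_scale:
  assumes "xs \<in> lists (fibre V x)" "ys \<in> lists (fibre V x)" "v \<in> fibre V x"
  shows "Poly_Mapping.single (xs @ [vscale V c v] @ ys) 1 - Poly_Mapping.single (xs @ [v] @ ys) c \<in> tensor_gens V x"
  using assms unfolding tensor_gens_def by blast

lemma tensor_gens_mult:
  assumes r: "r \<in> tensor_gens V x" and l: "l \<in> lists (fibre V x)"
  shows "Poly_Mapping.single l 1 * r \<in> tensor_gens V x" "r * Poly_Mapping.single l 1 \<in> tensor_gens V x"
proof -
  show "Poly_Mapping.single l 1 * r \<in> tensor_gens V x"
    using r
  proof (cases rule: tensor_gens_cases)
    case (add xs ys v w)
    then show ?thesis using tensor_gens_add[of "l @ xs" V x ys v w] l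
      by (simp add: right_diff_distrib mult_single plus_list_def)
  next
    case (scale xs ys c v)
    then show ?thesis using tensor_gens_scale[of "l @ xs" V x ys v c] l
      by (simp add: right_diff_distrib mult_single plus_list_def)
  qed
  show "r * Poly_Mapping.single l 1 \<in> tensor_gens V x"
    using r
  proof (cases rule: tensor_gens_cases)
    case (add xs ys v w)
    then show ?thesis using tensor_gens_add[of xs V x "ys @ l" v w] l
      by (simp add: left_diff_distrib mult_single plus_list_def)
  next
    case (scale xs ys c v)
    then show ?thesis using tensor_gens_scale[of xs V x "ys @ l" v c] l
      by (simp add: left_diff_distrib mult_single plus_list_def)
  qed
qed

text \<open>Multiplying a generating relation by a word lengthens its context \<open>xs\<close> or
  \<open>ys\<close> and gives another generating relation. The rest is linearity, first in
  \<open>r\<close>, then in \<open>p\<close>.\<close>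

lemma tensor_rels_mult:
  assumes r: "r \<in> tensor_rels V x" and p: "p \<in> words V x"
  shows "p * r \<in> tensor_rels V x" "r * p \<in> tensor_rels V x"
proof -
  have single: "Poly_Mapping.single l 1 * r \<in> tensor_rels V x \<and> r * Poly_Mapping.single l 1 \<in> tensor_rels V x"
    if l: "l \<in> lists (fibre V x)" for l
    using r unfolding tensor_rels_span
  proof (induction rule: pm.span_induct_alt)
    case (step c g q)
    have "pm_scale c g * Poly_Mapping.single l 1 = pm_scale c (g * Poly_Mapping.single l 1)"
      by (simp add: pm_scale_eq mult.assoc)
    then show ?case
      using tensor_gens_mult[OF step(1) l] step(2)
      by (simp add: distrib_left distrib_right pm_scale_mult_right pm.span_add pm.span_scale pm.span_base)
  qed (simp add: pm.span_zero)
  have s: "Poly_Mapping.single l c = pm_scale c (Poly_Mapping.single l 1)" for l :: "'a list" and c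
    by (simp add: pm_scale_eq mult_single plus_list_def)
  have "p * r \<in> tensor_rels V x \<and> r * p \<in> tensor_rels V x"
  proof (induction p rule: poly_mapping_singles_induct)
    case zero
    then show ?case by (simp add: tensor_rels_span pm.span_zero)
  next
    case (add l c q)
    have l: "l \<in> lists (fibre V x)" using p add(1) by (auto simp: words_def)
    have "Poly_Mapping.single l c * r = pm_scale c (Poly_Mapping.single l 1 * r)"
      by (simp add: pm_scale_eq mult_single plus_list_def mult.assoc[symmetric])
    moreover have "r * Poly_Mapping.single l c = pm_scale c (r * Poly_Mapping.single l 1)"
      by (simp only: pm_scale_mult_right[symmetric] s[symmetric])
    ultimately
    show ?case using add(2) single[OF l]
      by (simp add: distrib_left distrib_right tensor_rels_span pm.span_add pm.span_scale)
  qed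
  then show "p * r \<in> tensor_rels V x" "r * p \<in> tensor_rels V x" by auto
qed

lemma tensor_gens_words: "fibre_closed V x \<Longrightarrow> tensor_gens V x \<subseteq> words V x"
  by (auto simp: fibre_closed_def elim!: tensor_gens_cases intro!: words_diff words_single)

lemma tensor_rels_words: "fibre_closed V x \<Longrightarrow> tensor_rels V x \<subseteq> words V x"
  unfolding tensor_rels_span by (intro pm.span_minimal tensor_gens_words words_subspace)

lemma tensor_rels_ideal:
  assumes "fibre_closed V x"
  shows "ideal (tensor_rels V x) (free_alg V x)"
proof -
  interpret R: ring "free_alg V x" by (rule ring_free_alg)
  note sub = tensor_rels_words[OF assms]
  have neg: "\<ominus>\<^bsub>free_alg V x\<^esub> p = - p" if "p \<in> words V x" for p
    using that words_minus[OF that] by (intro R.minus_equality) simp_all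
  show ?thesis
  proof (rule idealI)
    show "subgroup (tensor_rels V x) (add_monoid (free_alg V x))"
    proof (rule R.add.subgroupI)
      show "tensor_rels V x \<noteq> {}" using pm.span_zero unfolding tensor_rels_span by blast
      fix a b assume a: "a \<in> tensor_rels V x" and b: "b \<in> tensor_rels V x"
      show "\<ominus>\<^bsub>free_alg V x\<^esub> a \<in> tensor_rels V x"
        using a sub neg[of a] pm.span_neg[of a "tensor_gens V x"] by (auto simp: tensor_rels_span)
      show "a \<oplus>\<^bsub>free_alg V x\<^esub> b \<in> tensor_rels V x"
        using a b by (simp add: tensor_rels_span pm.span_add)
    qed (use sub in simp)
  qed (simp_all add: ring_free_alg tensor_rels_mult)
qed

lemma ring_tensor_alg: "fibre_closed V x \<Longrightarrow> ring (tensor_alg V x)"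
  unfolding tensor_alg_def by (intro ideal.quotient_is_ring tensor_rels_ideal)

lemma tens_eq: "tens V x p = {r + p | r. r \<in> tensor_rels V x}"
  by (auto simp: tens_def a_r_coset_def')

lemma carrier_tensor_alg: "carrier (tensor_alg V x) = tens V x ` words V x"
  by (auto simp: tensor_alg_def FactRing_def A_RCOSETS_def' tens_def)

lemma tens_closed: "p \<in> words V x \<Longrightarrow> tens V x p \<in> carrier (tensor_alg V x)"
  by (simp add: carrier_tensor_alg)

context
  fixes V :: "('v, 'x) pbundle" and x :: 'x
  assumes V: "fibre_closed V x"
begin

lemma tens_hom: "tens V x \<in> ring_hom (free_alg V x) (tensor_alg V x)"
  using ideal.rcos_ring_hom[OF tensor_rels_ideal[OF V]] by (simp add: tens_def[abs_def] tensor_alg_def)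

lemma tens_mult: "p \<in> words V x \<Longrightarrow> q \<in> words V x \<Longrightarrow> tens V x p \<otimes>\<^bsub>tensor_alg V x\<^esub> tens V x q = tens V x (p * q)"
  using ring_hom_mult[OF tens_hom, of p q] by simp

lemma tens_add: "p \<in> words V x \<Longrightarrow> q \<in> words V x \<Longrightarrow> tens V x p \<oplus>\<^bsub>tensor_alg V x\<^esub> tens V x q = tens V x (p + q)"
  using ring_hom_add[OF tens_hom, of p q] by simp

lemma tens_one: "\<one>\<^bsub>tensor_alg V x\<^esub> = tens V x 1"
  using ring_hom_one[OF tens_hom] by simp

lemma tens_zero: "\<zero>\<^bsub>tensor_alg V x\<^esub> = tens V x 0"
  using ring_hom_zero[OF tens_hom ring_free_alg ring_tensor_alg[OF V]] by simp

lemma tens_scale: "p \<in> words V x \<Longrightarrow>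
    tens V x (Poly_Mapping.single [] c) \<otimes>\<^bsub>tensor_alg V x\<^esub> tens V x p = tens V x (pm_scale c p)"
  by (simp add: tens_mult words_single pm_scale_eq)

end

section \<open>Tensor powers as homogeneous parts of the tensor algebra\<close>

definition homogeneous :: "nat \<Rightarrow> ('v, 'x) pbundle \<Rightarrow> 'x \<Rightarrow> ('v list \<Rightarrow>\<^sub>0 real) set" where
  "homogeneous n V x = {p. Poly_Mapping.keys p \<subseteq> {l \<in> lists (fibre V x). length l = n}}"

lemma homogeneous_words: "p \<in> homogeneous n V x \<Longrightarrow> p \<in> words V x"
  by (auto simp: homogeneous_def words_def)

lemma homogeneous_zero: "0 \<in> homogeneous n V x"
  by (simp add: homogeneous_def)

lemma homogeneous_add: "p \<in> homogeneous n V x \<Longrightarrow> q \<in> homogeneous n V x \<Longrightarrow> p + q \<in> homogeneous n V x"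
  unfolding homogeneous_def using Poly_Mapping.keys_add[of p q] by blast

lemma homogeneous_scale: "p \<in> homogeneous n V x \<Longrightarrow> pm_scale c p \<in> homogeneous n V x"
proof -
  have "Poly_Mapping.keys (pm_scale c p) \<subseteq> Poly_Mapping.keys p"
    unfolding pm_scale_eq using Poly_Mapping.keys_mult[of "Poly_Mapping.single [] c" p]
    by (auto simp: plus_list_def split: if_splits)
  then show "p \<in> homogeneous n V x \<Longrightarrow> ?thesis" by (auto simp: homogeneous_def)
qed

lemma homogeneous_single: "l \<in> lists (fibre V x) \<Longrightarrow> length l = n \<Longrightarrow> Poly_Mapping.single l c \<in> homogeneous n V x"
  by (auto simp: homogeneous_def split: if_splits)

lemma tensor_power_space_eq: "tensor_power_space n V x = tens V x ` homogeneous n V x"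
  by (simp add: tensor_power_space_def homogeneous_def)

lemma tensor_power_space_carrier: "tensor_power_space n V x \<subseteq> carrier (tensor_alg V x)"
  using homogeneous_words by (fastforce simp: tensor_power_space_eq carrier_tensor_alg)

lemma tensor_power_space_closed:
  assumes V: "fibre_closed V x" and t: "t \<in> tensor_power_space n V x" and s: "s \<in> tensor_power_space n V x"
  shows "t \<oplus>\<^bsub>tensor_alg V x\<^esub> s \<in> tensor_power_space n V x"
    and "tens V x (Poly_Mapping.single [] c) \<otimes>\<^bsub>tensor_alg V x\<^esub> t \<in> tensor_power_space n V x"
  using t s unfolding tensor_power_space_eq
  by (auto simp: tens_add[OF V] tens_scale[OF V] homogeneous_words intro!: imageI homogeneous_add homogeneous_scale)

lemma tensor_power_space_zero: "fibre_closed V x \<Longrightarrow> \<zero>\<^bsub>tensor_alg V x\<^esub> \<in> tensor_power_space n V x"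
  by (simp add: tensor_power_space_eq tens_zero homogeneous_zero)

lemma fibre_tensor_power_with:
  "fibre (tensor_power_with D n V) x = (if x \<in> points (base V) then Pair x ` tensor_power_space n V x else {})"
  by (auto simp: fibre_def preim_def tensor_power_with_def)

text \<open>Scalars act by multiples of the unit of the tensor algebra, so the module axioms are
  instances of the ring axioms.\<close>

lemma tensor_power_module:
  assumes V: "fibre_closed V x" and x: "x \<in> points (base V)"
  shows "Module.module real_fld (fibre_mod (tensor_power_with D n V) x)"
proof -
  interpret T: ring "tensor_alg V x" by (rule ring_tensor_alg[OF V])
  let ?M = "fibre_mod (tensor_power_with D n V) x"
  have M: "carrier ?M = Pair x ` tensor_power_space n V x" "\<zero>\<^bsub>?M\<^esub> = (x, \<zero>\<^bsub>tensor_alg V x\<^esub>)"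
    "(x, t) \<oplus>\<^bsub>?M\<^esub> (x, s) = (x, t \<oplus>\<^bsub>tensor_alg V x\<^esub> s)"
    "c \<odot>\<^bsub>?M\<^esub> (x, t) = (x, tens V x (Poly_Mapping.single [] c) \<otimes>\<^bsub>tensor_alg V x\<^esub> t)" for t s c
    using x by (simp_all add: fibre_mod_def fibre_tensor_power_with, simp_all add: tensor_power_with_def)
  note sub = subsetD[OF tensor_power_space_carrier[of n V x]]
  note closed = tensor_power_space_closed[OF V]
  have S: "carrier real_fld = UNIV" "a \<oplus>\<^bsub>real_fld\<^esub> b = a + b" "a \<otimes>\<^bsub>real_fld\<^esub> b = a * b" "\<one>\<^bsub>real_fld\<^esub> = 1" for a b
    by (simp_all add: ring_of_type_algebra_def)
  have single: "tens V x (Poly_Mapping.single [] c) \<in> carrier (tensor_alg V x)" for c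
    by (simp add: tens_closed words_single)
  have one: "tens V x (Poly_Mapping.single [] 1) = \<one>\<^bsub>tensor_alg V x\<^esub>"
    unfolding tens_one[OF V] by (metis single_one zero_list_def)
  have add: "tens V x (Poly_Mapping.single [] (c + d)) =
      tens V x (Poly_Mapping.single [] c) \<oplus>\<^bsub>tensor_alg V x\<^esub> tens V x (Poly_Mapping.single [] d)" for c d
    by (simp add: tens_add[OF V] words_single single_add)
  have mult: "tens V x (Poly_Mapping.single [] (c * d)) =
      tens V x (Poly_Mapping.single [] c) \<otimes>\<^bsub>tensor_alg V x\<^esub> tens V x (Poly_Mapping.single [] d)" for c d
    by (simp add: tens_mult[OF V] words_single mult_single plus_list_def)
  show ?thesis
  proof (rule Module.moduleI)
    show "cring real_fld" by (rule cring_from_type_algebra)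
    show "abelian_group ?M"
    proof (rule abelian_groupI)
      fix v assume "v \<in> carrier ?M"
      then obtain t where t: "v = (x, t)" "t \<in> tensor_power_space n V x" by (auto simp: M)
      \<comment> \<open>The additive inverse is taken as \<open>- 1\<close> times \<open>t\<close>,
        since closure of a tensor power under scaling is already known.\<close>
      let ?s = "tens V x (Poly_Mapping.single [] (- 1)) \<otimes>\<^bsub>tensor_alg V x\<^esub> t"
      have "?s \<oplus>\<^bsub>tensor_alg V x\<^esub> t = (tens V x (Poly_Mapping.single [] (- 1)) \<oplus>\<^bsub>tensor_alg V x\<^esub> tens V x (Poly_Mapping.single [] 1)) \<otimes>\<^bsub>tensor_alg V x\<^esub> t"
        using sub[OF t(2)] by (simp add: T.l_distr single one)
      also have "\<dots> = \<zero>\<^bsub>tensor_alg V x\<^esub>"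
        using sub[OF t(2)] by (simp add: add[symmetric] tens_zero[OF V, symmetric])
      finally show "\<exists>w\<in>carrier ?M. w \<oplus>\<^bsub>?M\<^esub> v = \<zero>\<^bsub>?M\<^esub>"
        using closed(2)[OF t(2) t(2), of "- 1"] by (intro bexI[of _ "(x, ?s)"]) (auto simp: M t)
    qed ((unfold M(1))?, (elim imageE)?, simp add: M closed tensor_power_space_zero[OF V] sub T.a_ac)+
  qed ((unfold M(1))?, (elim imageE)?, simp add: M S closed sub single one add mult T.l_distr T.r_distr T.m_assoc)+
qed

section \<open>Transport along isomorphisms of pseudo-bundles\<close>

text \<open>The preimage of the ideal generated by the image of \<open>G\<close> is an ideal
  containing \<open>G\<close>, hence contains the ideal generated by \<open>G\<close>.\<close>

lemma genideal_hom_image: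
  assumes f: "ring_hom_ring R S f" and G: "G \<subseteq> carrier R" and r: "r \<in> Idl\<^bsub>R\<^esub> G"
  shows "f r \<in> Idl\<^bsub>S\<^esub> (f ` G)"
proof -
  interpret f: ring_hom_ring R S f by (rule f)
  have fG: "f ` G \<subseteq> carrier S" using G by auto
  have "ideal {r \<in> carrier R. f r \<in> Idl\<^bsub>S\<^esub> (f ` G)} R"
    by (rule f.ideal_vimage[OF f.S.genideal_ideal[OF fG]])
  moreover have "G \<subseteq> {r \<in> carrier R. f r \<in> Idl\<^bsub>S\<^esub> (f ` G)}"
    using G f.S.genideal_self[OF fG] by auto
  ultimately show ?thesis using f.R.genideal_minimal r by blast
qed

text \<open>One inclusion is the statement on homomorphisms for \<open>h\<close>; the other is the
  same statement for the inverse \<open>h'\<close>.\<close>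

lemma genideal_ring_iso:
  assumes h: "ring_hom_ring R S h" and h': "ring_hom_ring S R h'"
    and inv: "\<And>r. r \<in> carrier R \<Longrightarrow> h' (h r) = r" "\<And>s. s \<in> carrier S \<Longrightarrow> h (h' s) = s"
    and G: "G \<subseteq> carrier R"
  shows "h ` (Idl\<^bsub>R\<^esub> G) = Idl\<^bsub>S\<^esub> (h ` G)"
proof -
  interpret h: ring_hom_ring R S h by (rule h)
  have hG: "h ` G \<subseteq> carrier S" using G by auto
  have "h' (h r) = r" if "r \<in> G" for r using inv(1) G that by blast
  then have G': "h' ` h ` G = G" by (simp add: image_image)
  have "s \<in> h ` (Idl\<^bsub>R\<^esub> G)" if s: "s \<in> Idl\<^bsub>S\<^esub> (h ` G)" for s
  proof -
    have "s \<in> carrier S"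
      using ideal.Icarr[OF h.S.genideal_ideal[OF hG] s] .
    then have "s = h (h' s)" using inv(2) by simp
    moreover have "h' s \<in> Idl\<^bsub>R\<^esub> G" using genideal_hom_image[OF h' hG s] by (simp add: G')
    ultimately show ?thesis by blast
  qed
  then show ?thesis using genideal_hom_image[OF h G] by blast
qed

lemma tens_cong: "r \<in> tensor_rels V x \<Longrightarrow> tens V x (r + p) = tens V x p"
proof -
  assume r: "r \<in> tensor_rels V x"
  have "s + (r + p) \<in> tens V x p" "s + p \<in> tens V x (r + p)" if "s \<in> tensor_rels V x" for s
  proof -
    have "s + r \<in> tensor_rels V x" "s - r \<in> tensor_rels V x"
      using r that by (simp_all add: tensor_rels_span pm.span_add pm.span_diff)
    moreover have "s + (r + p) = (s + r) + p" "s + p = (s - r) + (r + p)" by simp_all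
    ultimately show "s + (r + p) \<in> tens V x p" "s + p \<in> tens V x (r + p)"
      unfolding tens_eq by blast+
  qed
  then show ?thesis unfolding tens_eq[of V x "r + p"] tens_eq[of V x p]
    by (auto simp: tens_eq)
qed

definition cl_rel :: "('x \<Rightarrow> 'v \<Rightarrow> 'v \<Rightarrow> real) \<Rightarrow> 'x \<Rightarrow> 'v \<Rightarrow> 'v \<Rightarrow> ('v list \<Rightarrow>\<^sub>0 real)" where
  "cl_rel g x v w = Poly_Mapping.single [v, w] 1 + Poly_Mapping.single [w, v] 1
      + Poly_Mapping.single [] (2 * g x v w)"

lemma cl_ideal_eq:
  "cl_ideal V g x = Idl\<^bsub>tensor_alg V x\<^esub> {tens V x (cl_rel g x v w) | v w. v \<in> fibre V x \<and> w \<in> fibre V x}"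
  by (simp add: cl_ideal_def cl_rel_def)

lemma cl_gens_carrier: "v \<in> fibre V x \<Longrightarrow> w \<in> fibre V x \<Longrightarrow> cl_rel g x v w \<in> words V x"
  unfolding cl_rel_def by (intro words_add words_single) auto

lemma cl_ideal_ideal: "fibre_closed V x \<Longrightarrow> ideal (cl_ideal V g x) (tensor_alg V x)"
  unfolding cl_ideal_eq
  by (rule ring.genideal_ideal[OF ring_tensor_alg]) (auto intro!: tens_closed cl_gens_carrier)

locale fibre_iso =
  fixes A :: "('v, 'x) pbundle" and x :: 'x and B :: "('w, 'y) pbundle" and y :: 'y
    and \<Phi> :: "'v \<Rightarrow> 'w" and \<Phi>' :: "'w \<Rightarrow> 'v"
  assumes closed: "fibre_closed A x"
    and maps: "v \<in> fibre A x \<Longrightarrow> \<Phi> v \<in> fibre B y" and maps': "w \<in> fibre B y \<Longrightarrow> \<Phi>' w \<in> fibre A x"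
    and inv: "v \<in> fibre A x \<Longrightarrow> \<Phi>' (\<Phi> v) = v" and inv': "w \<in> fibre B y \<Longrightarrow> \<Phi> (\<Phi>' w) = w"
    and add: "v \<in> fibre A x \<Longrightarrow> v' \<in> fibre A x \<Longrightarrow> \<Phi> (vadd A v v') = vadd B (\<Phi> v) (\<Phi> v')"
    and scale: "v \<in> fibre A x \<Longrightarrow> \<Phi> (vscale A c v) = vscale B c (\<Phi> v)"
    and zero: "\<Phi> (vzero A x) = vzero B y"
begin

text \<open>The inverse of a linear bijection is linear, and the target fibre inherits closure under
  the operations. Each later fact about \<open>wmap\<close> is thereby available for
  \<open>wmap'\<close> as well.\<close>

lemma sym: "fibre_iso B y A x \<Phi>' \<Phi>"
proof -
  note cl = closed[unfolded fibre_closed_def]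
  have add': "\<Phi>' (vadd B w w') = vadd A (\<Phi>' w) (\<Phi>' w')" "vadd B w w' \<in> fibre B y"
    if "w \<in> fibre B y" "w' \<in> fibre B y" for w w'
    using that add[of "\<Phi>' w" "\<Phi>' w'"] cl maps maps' inv inv' by metis+
  have scale': "\<Phi>' (vscale B c w) = vscale A c (\<Phi>' w)" "vscale B c w \<in> fibre B y" if "w \<in> fibre B y" for w c
    using that scale[of "\<Phi>' w" c] cl maps maps' inv inv' by metis+
  have zero': "\<Phi>' (vzero B y) = vzero A x" "vzero B y \<in> fibre B y"
    using cl zero inv maps by metis+
  show ?thesis
    by unfold_locales (auto simp: fibre_closed_def add' scale' zero' maps maps' inv inv')
qed

abbreviation "wmap \<equiv> map_words \<Phi>"
abbreviation "wmap' \<equiv> map_words \<Phi>'"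

lemma map_lists: "l \<in> lists (fibre A x) \<Longrightarrow> map \<Phi> l \<in> lists (fibre B y)"
  using maps by (auto simp: in_lists_conv_set)

lemma hom_words: "p \<in> words A x \<Longrightarrow> wmap p \<in> words B y"
proof -
  assume "p \<in> words A x"
  then have "k \<in> lists (fibre B y)" if "k \<in> Poly_Mapping.keys (wmap p)" for k
    using subsetD[OF keys_map_words that] map_lists unfolding words_def by blast
  then show ?thesis by (auto simp: words_def)
qed

lemma hom_inv: "p \<in> words A x \<Longrightarrow> wmap' (wmap p) = p"
proof (rule map_words_comp)
  fix l assume "p \<in> words A x" "l \<in> Poly_Mapping.keys p"
  then have "l \<in> lists (fibre A x)" by (auto simp: words_def)
  then show "map \<Phi>' (map \<Phi> l) = l" using inv by (auto simp: in_lists_conv_set map_idI)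
qed

lemma hom_homogeneous: "p \<in> homogeneous n A x \<Longrightarrow> wmap p \<in> homogeneous n B y"
proof -
  assume "p \<in> homogeneous n A x"
  then have "k \<in> lists (fibre B y) \<and> length k = n" if "k \<in> Poly_Mapping.keys (wmap p)" for k
    using subsetD[OF keys_map_words that] map_lists length_map unfolding homogeneous_def by blast
  then show ?thesis by (auto simp: homogeneous_def)
qed

lemma hom_gens: "r \<in> tensor_gens A x \<Longrightarrow> wmap r \<in> tensor_gens B y"
proof (cases rule: tensor_gens_cases)
  fix xs ys v w
  assume "xs \<in> lists (fibre A x)" "ys \<in> lists (fibre A x)" "v \<in> fibre A x" "w \<in> fibre A x"
    "r = Poly_Mapping.single (xs @ [vadd A v w] @ ys) 1
         - Poly_Mapping.single (xs @ [v] @ ys) 1 - Poly_Mapping.single (xs @ [w] @ ys) 1"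
  then show ?thesis
    using tensor_gens_add[OF map_lists map_lists maps maps, of xs ys v w]
    by (simp add: map_words_diff add)
next
  fix xs ys c v
  assume "xs \<in> lists (fibre A x)" "ys \<in> lists (fibre A x)" "v \<in> fibre A x"
    "r = Poly_Mapping.single (xs @ [vscale A c v] @ ys) 1 - Poly_Mapping.single (xs @ [v] @ ys) c"
  then show ?thesis
    using tensor_gens_scale[OF map_lists map_lists maps, of xs ys v c]
    by (simp add: map_words_diff scale)
qed

lemma hom_rels: "r \<in> tensor_rels A x \<Longrightarrow> wmap r \<in> tensor_rels B y"
  unfolding tensor_rels_span
proof (induction rule: pm.span_induct_alt)
  case (step c g q)
  then show ?case
    using hom_gens[OF step(1)]
    by (simp add: map_words_add map_words_scale pm.span_add pm.span_scale pm.span_base)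
qed (simp add: pm.span_zero)

lemma hom_rels_image: "wmap ` tensor_rels A x = tensor_rels B y"
proof -
  interpret S: fibre_iso B y A x \<Phi>' \<Phi> by (rule sym)
  have "s \<in> wmap ` tensor_rels A x" if "s \<in> tensor_rels B y" for s
    using S.hom_rels[OF that] S.hom_inv[of s] tensor_rels_words[OF S.closed] that by (metis image_eqI subsetD)
  then show ?thesis using hom_rels by blast
qed

lemma hom_tens: "wmap ` tens A x p = tens B y (wmap p)"
proof -
  have "tens B y (wmap p) = {s + wmap p | s. s \<in> wmap ` tensor_rels A x}"
    by (simp add: tens_eq hom_rels_image)
  also have "\<dots> = wmap ` tens A x p"
    unfolding tens_eq setcompr_eq_image Collect_mem_eq image_image map_words_add ..
  finally show ?thesis ..
qed

text \<open>\<open>tensor_map\<close> takes a union over representatives. All of them give the same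
  coset, and as relations map onto relations this coset is the plain image of \<open>t\<close>. So
  \<open>tensor_map\<close> can be handled as an image map.\<close>

lemma Union_tens_hom: "t \<in> carrier (tensor_alg A x) \<Longrightarrow> (\<Union>p\<in>t. tens B y (wmap p)) = wmap ` t"
proof -
  assume "t \<in> carrier (tensor_alg A x)"
  then obtain p where t: "t = tens A x p" by (auto simp: carrier_tensor_alg)
  have "tens B y (wmap q) = tens B y (wmap p)" if "q \<in> t" for q
    using that hom_rels tens_cong[of _ B y "wmap p"] by (auto simp: t tens_eq[of A] map_words_add)
  then have "(\<Union>q\<in>t. tens B y (wmap q)) = (\<Union>q\<in>t. tens B y (wmap p))"
    by (rule SUP_cong[OF refl])
  moreover have "0 + p \<in> t" unfolding t tens_eq tensor_rels_span using pm.span_zero by blast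
  ultimately show ?thesis unfolding t hom_tens by auto
qed

lemma hom_carrier: "t \<in> carrier (tensor_alg A x) \<Longrightarrow> wmap ` t \<in> carrier (tensor_alg B y)"
  by (auto simp: carrier_tensor_alg hom_tens hom_words)

lemma hom_power_space: "t \<in> tensor_power_space n A x \<Longrightarrow> wmap ` t \<in> tensor_power_space n B y"
  by (auto simp: tensor_power_space_eq hom_tens hom_homogeneous)

lemma hom_carrier_inv: "t \<in> carrier (tensor_alg A x) \<Longrightarrow> wmap' ` wmap ` t = t"
proof -
  interpret S: fibre_iso B y A x \<Phi>' \<Phi> by (rule sym)
  assume "t \<in> carrier (tensor_alg A x)"
  then obtain p where "t = tens A x p" "p \<in> words A x" by (auto simp: carrier_tensor_alg)
  then show ?thesis by (simp only: hom_tens S.hom_tens hom_inv)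
qed

lemma hom_ring_hom: "ring_hom_ring (tensor_alg A x) (tensor_alg B y) ((`) wmap)"
proof -
  interpret S: fibre_iso B y A x \<Phi>' \<Phi> by (rule sym)
  have one: "wmap 1 = 1"
    using map_words_single[of \<Phi> "[]" 1] by (metis list.map_disc_iff single_one zero_list_def)
  show ?thesis
  proof (rule ring_hom_ringI2[OF ring_tensor_alg[OF closed] ring_tensor_alg[OF S.closed]], rule ring_hom_memI)
    fix t s assume "t \<in> carrier (tensor_alg A x)" "s \<in> carrier (tensor_alg A x)"
    then obtain p q where t: "t = tens A x p" "p \<in> words A x" and s: "s = tens A x q" "q \<in> words A x"
      by (auto simp: carrier_tensor_alg)
    show "wmap ` (t \<otimes>\<^bsub>tensor_alg A x\<^esub> s) = wmap ` t \<otimes>\<^bsub>tensor_alg B y\<^esub> wmap ` s"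
      "wmap ` (t \<oplus>\<^bsub>tensor_alg A x\<^esub> s) = wmap ` t \<oplus>\<^bsub>tensor_alg B y\<^esub> wmap ` s"
      using t(2) s(2) unfolding t(1) s(1)
      by (simp_all add: hom_tens tens_mult[OF closed] tens_mult[OF S.closed] tens_add[OF closed] tens_add[OF S.closed]
          hom_words map_words_mult map_words_add)
  qed (simp_all only: hom_carrier tens_one[OF closed] tens_one[OF S.closed] hom_tens one)
qed

lemma hom_add:
  "t \<in> carrier (tensor_alg A x) \<Longrightarrow> s \<in> carrier (tensor_alg A x) \<Longrightarrow>
    wmap ` (t \<oplus>\<^bsub>tensor_alg A x\<^esub> s) = wmap ` t \<oplus>\<^bsub>tensor_alg B y\<^esub> wmap ` s"
  using ring_hom_add[OF ring_hom_ring.homh[OF hom_ring_hom]] .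

lemma hom_scale:
  "t \<in> carrier (tensor_alg A x) \<Longrightarrow>
    wmap ` (tens A x (Poly_Mapping.single [] c) \<otimes>\<^bsub>tensor_alg A x\<^esub> t) =
      tens B y (Poly_Mapping.single [] c) \<otimes>\<^bsub>tensor_alg B y\<^esub> wmap ` t"
  using ring_hom_mult[OF ring_hom_ring.homh[OF hom_ring_hom], of "tens A x (Poly_Mapping.single [] c)" t]
  by (simp add: tens_closed words_single hom_tens)

lemma hom_zero: "wmap ` \<zero>\<^bsub>tensor_alg A x\<^esub> = \<zero>\<^bsub>tensor_alg B y\<^esub>"
  using ring_hom_zero[OF ring_hom_ring.homh[OF hom_ring_hom] ring_tensor_alg[OF closed]
      ring_tensor_alg[OF fibre_iso.closed[OF sym]]] .

text \<open>By isometry the Clifford relation of \<open>v\<close> and \<open>w\<close> is sent to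
  that of \<open>\<Phi> v\<close> and \<open>\<Phi> w\<close>, and every generator of the target
  ideal arises in this way.\<close>

lemma hom_cl_ideal:
  assumes g: "\<And>v w. v \<in> fibre A x \<Longrightarrow> w \<in> fibre A x \<Longrightarrow> gB y (\<Phi> v) (\<Phi> w) = gA x v w"
  shows "(`) wmap ` cl_ideal A gA x = cl_ideal B gB y"
proof -
  interpret S: fibre_iso B y A x \<Phi>' \<Phi> by (rule sym)
  let ?G = "{tens A x (cl_rel gA x v w) | v w. v \<in> fibre A x \<and> w \<in> fibre A x}"
  have "wmap (cl_rel gA x v w) = cl_rel gB y (\<Phi> v) (\<Phi> w)" if "v \<in> fibre A x" "w \<in> fibre A x" for v w
    using g[OF that] by (simp add: cl_rel_def map_words_add)
  then have *: "wmap ` tens A x (cl_rel gA x v w) = tens B y (cl_rel gB y (\<Phi> v) (\<Phi> w))"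
    if "v \<in> fibre A x" "w \<in> fibre A x" for v w
    using that by (simp add: hom_tens)
  have "(`) wmap ` ?G = {tens B y (cl_rel gB y v w) | v w. v \<in> fibre B y \<and> w \<in> fibre B y}"
  proof (intro equalityI subsetI)
    fix t assume "t \<in> (`) wmap ` ?G"
    then show "t \<in> {tens B y (cl_rel gB y v w) | v w. v \<in> fibre B y \<and> w \<in> fibre B y}"
      using * maps by blast
  next
    fix t assume "t \<in> {tens B y (cl_rel gB y v w) | v w. v \<in> fibre B y \<and> w \<in> fibre B y}"
    then obtain v w where t: "t = tens B y (cl_rel gB y v w)" "v \<in> fibre B y" "w \<in> fibre B y" by blast
    then have "t = wmap ` tens A x (cl_rel gA x (\<Phi>' v) (\<Phi>' w))" using *[of "\<Phi>' v" "\<Phi>' w"] maps' inv' by simp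
    then show "t \<in> (`) wmap ` ?G" using maps' t(2,3) by blast
  qed
  moreover have "?G \<subseteq> carrier (tensor_alg A x)"
    by (auto intro!: tens_closed cl_gens_carrier)
  ultimately show ?thesis
    using genideal_ring_iso[OF hom_ring_hom S.hom_ring_hom hom_carrier_inv S.hom_carrier_inv, of ?G]
    by (simp add: cl_ideal_eq)
qed

lemma hom_coset:
  assumes J: "J \<subseteq> carrier (tensor_alg A x)" and t: "t \<in> carrier (tensor_alg A x)"
  shows "(`) wmap ` (J +>\<^bsub>tensor_alg A x\<^esub> t) = ((`) wmap ` J) +>\<^bsub>tensor_alg B y\<^esub> (wmap ` t)"
proof -
  have "wmap ` (s \<oplus>\<^bsub>tensor_alg A x\<^esub> t) = wmap ` s \<oplus>\<^bsub>tensor_alg B y\<^esub> wmap ` t" if "s \<in> J" for s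
    using hom_add J t that by blast
  then have "(\<lambda>s. wmap ` (s \<oplus>\<^bsub>tensor_alg A x\<^esub> t)) ` J = (\<lambda>s. wmap ` s \<oplus>\<^bsub>tensor_alg B y\<^esub> wmap ` t) ` J"
    by (rule image_cong[OF refl])
  moreover have "J +>\<^bsub>tensor_alg A x\<^esub> t = (\<lambda>s. s \<oplus>\<^bsub>tensor_alg A x\<^esub> t) ` J"
    by (auto simp: a_r_coset_def')
  moreover have "((`) wmap ` J) +>\<^bsub>tensor_alg B y\<^esub> (wmap ` t) = (\<lambda>s. wmap ` s \<oplus>\<^bsub>tensor_alg B y\<^esub> wmap ` t) ` J"
    by (auto simp: a_r_coset_def')
  ultimately show ?thesis by (simp only: image_image)
qed

end

section \<open>Pulling back pseudo-bundle diffeologies; values of plots of tensor powers\<close>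

definition plots_extensional :: "'a dspace \<Rightarrow> bool" where
  "plots_extensional Z \<longleftrightarrow> (\<forall>n U p q. plots Z n U p \<longrightarrow> (\<forall>u\<in>U. p u = q u) \<longrightarrow> plots Z n U q)"

lemma plots_extensionalD:
  "plots_extensional Z \<Longrightarrow> plots Z n U p \<Longrightarrow> (\<And>u. u \<in> U \<Longrightarrow> p u = q u) \<Longrightarrow> plots Z n U q"
  by (simp add: plots_extensional_def)

lemma diffeology_extensional: "diffeology Z \<Longrightarrow> plots_extensional Z"
  using plot_cong unfolding plots_extensional_def by blast

lemma dsmoothI:
  "(\<And>z. z \<in> points Z \<Longrightarrow> f z \<in> points Z') \<Longrightarrow> (\<And>n U p. plots Z n U p \<Longrightarrow> plots Z' n U (\<lambda>u. f (p u))) \<Longrightarrow>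
    dsmooth Z Z' f"
  by (auto simp: dsmooth_def comp_def)

lemma fibreD: "v \<in> fibre V x \<Longrightarrow> v \<in> points (tot V) \<and> proj V v = x"
  by (simp add: fibre_def preim_def)

lemma fibreI: "v \<in> points (tot V) \<Longrightarrow> proj V v = x \<Longrightarrow> v \<in> fibre V x"
  by (simp add: fibre_def preim_def)

text \<open>The structure induced by a fibrewise linear \<open>T\<close>: a map into
  \<open>P\<close> is a plot when its composite with \<open>T\<close> is one. Each operation
  inherits smoothness because \<open>T\<close> commutes with it.\<close>

lemma pseudo_bundle_pullback:
  fixes P :: "('p, 'x) pbundle" and Q :: "('q, 'y) pbundle"
  assumes Q: "pseudo_bundle Q"
    and plots: "\<And>k U q. plots (tot P) k U q \<longleftrightarrow> q ` U \<subseteq> points (tot P) \<and> plots (tot Q) k U (\<lambda>u. T (q u))"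
    and T: "\<And>t. t \<in> points (tot P) \<Longrightarrow> T t \<in> points (tot Q)"
    and base: "diffeology (base P)" "dsmooth (base P) (base Q) \<phi>" "dsmooth (base Q) (base P) \<phi>'"
      "\<And>x. x \<in> points (base P) \<Longrightarrow> \<phi>' (\<phi> x) = x"
    and proj: "\<And>t. t \<in> points (tot P) \<Longrightarrow> proj P t \<in> points (base P)"
      "\<And>t. t \<in> points (tot P) \<Longrightarrow> proj Q (T t) = \<phi> (proj P t)"
    and closed: "\<And>x. x \<in> points (base P) \<Longrightarrow> fibre_closed P x"
    and module: "\<And>x. x \<in> points (base P) \<Longrightarrow> Module.module real_fld (fibre_mod P x)"
    and add: "\<And>x v w. x \<in> points (base P) \<Longrightarrow> v \<in> fibre P x \<Longrightarrow> w \<in> fibre P x \<Longrightarrow> T (vadd P v w) = vadd Q (T v) (T w)"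
    and scale: "\<And>x v c. x \<in> points (base P) \<Longrightarrow> v \<in> fibre P x \<Longrightarrow> T (vscale P c v) = vscale Q c (T v)"
    and zero: "\<And>x. x \<in> points (base P) \<Longrightarrow> T (vzero P x) = vzero Q (\<phi> x)"
  shows "pseudo_bundle P"
proof -
  note Qd = Q[unfolded pseudo_bundle_def]
  have dQ: "diffeology (tot Q)" using Qd by blast
  have add_Q: "plots (tot Q) n U (\<lambda>u. vadd Q (p u) (q u))"
    if "plots (tot Q) n U p" "plots (tot Q) n U q" "\<And>u. u \<in> U \<Longrightarrow> proj Q (p u) = proj Q (q u)" for n U p q
  proof -
    have "dsmooth (subset_ds (prod_ds (tot Q) (tot Q)) {(v, w). proj Q v = proj Q w}) (tot Q) (\<lambda>(v, w). vadd Q v w)"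
      using Qd by blast
    from dsmooth_plot[OF this, of n U "\<lambda>u. (p u, q u)"] show ?thesis
      using that by (auto simp: subset_ds_def prod_ds_def comp_def)
  qed
  have scale_Q: "plots (tot Q) n U (\<lambda>u. vscale Q (c u) (p u))"
    if "plots (tot Q) n U p" "plots real_ds n U c" for n U p c
  proof -
    have "dsmooth (prod_ds real_ds (tot Q)) (tot Q) (\<lambda>(c, v). vscale Q c v)" using Qd by blast
    from dsmooth_plot[OF this, of n U "\<lambda>u. (c u, p u)"] show ?thesis
      using that by (auto simp: prod_ds_def comp_def)
  qed
  have zero_Q: "dsmooth (base Q) (tot Q) (vzero Q)" using Qd by blast
  have proj_Q: "dsmooth (tot Q) (base Q) (proj Q)" using Qd by blast
  have in_fibre: "v \<in> fibre P (proj P v)" if "v \<in> points (tot P)" for v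
    using that by (simp add: fibreI)
  have add_closed: "vadd P v w \<in> points (tot P)" if "v \<in> points (tot P)" "w \<in> points (tot P)" "proj P v = proj P w" for v w
    using closed[OF proj(1)[OF that(1)]] in_fibre[OF that(1)] in_fibre[OF that(2)] that(3) fibreD
    unfolding fibre_closed_def by metis
  have scale_closed: "vscale P c v \<in> points (tot P)" if "v \<in> points (tot P)" for c v
    using closed[OF proj(1)[OF that(1)]] in_fibre[OF that(1)] fibreD
    unfolding fibre_closed_def by metis
  have zero_closed: "vzero P x \<in> points (tot P)" "proj P (vzero P x) = x" if "x \<in> points (base P)" for x
    using closed[OF that] fibreD unfolding fibre_closed_def by metis+
  have pts: "q u \<in> points (tot P)" if "plots (tot P) n U q" "u \<in> U" for n U q u
    using that plots by blast
  show ?thesis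
    unfolding pseudo_bundle_def
  proof (intro conjI ballI)
    show "diffeology (base P)" by fact
    show "diffeology (tot P)"
    proof (rule diffeologyI)
      show "openin (Euclidean_space n) U" if "plots (tot P) n U p" for n U p
        using that plots plot_open[OF dQ] by blast
      show "p u \<in> points (tot P)" if "plots (tot P) n U p" "u \<in> U" for n U p u
        using pts that .
      show "plots (tot P) n U q" if "plots (tot P) n U p" "\<And>u. u \<in> U \<Longrightarrow> p u = q u" for n U p q
        using that plot_cong[OF dQ, of n U "\<lambda>u. T (p u)" "\<lambda>u. T (q u)"] unfolding plots by auto
      show "plots (tot P) n U (\<lambda>_. a)" if "openin (Euclidean_space n) U" "a \<in> points (tot P)" for n U a
        using that plot_const[OF dQ that(1) T[OF that(2)]] unfolding plots by auto
      show "plots (tot P) n U p" if "openin (Euclidean_space n) U" "locally_on n U (\<lambda>W. plots (tot P) n W p)" for n U p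
      proof -
        have "locally_on n U (\<lambda>W. plots (tot Q) n W (\<lambda>u. T (p u)))"
          by (rule locally_on_mono[OF that(2)]) (simp add: plots)
        then have "plots (tot Q) n U (\<lambda>u. T (p u))" by (rule plot_locally[OF dQ that(1)])
        moreover have "p u \<in> points (tot P)" if u: "u \<in> U" for u
          using locally_onE[OF \<open>locally_on n U (\<lambda>W. plots (tot P) n W p)\<close> u] pts by metis
        ultimately show ?thesis unfolding plots by blast
      qed
      show "plots (tot P) m W (\<lambda>x. p (h x))" if "plots (tot P) n U p" "Cinf_map m W n h" "h ` W \<subseteq> U" for n U p m W h
        using that(1) plot_compose[OF dQ _ that(2,3), of "\<lambda>u. T (p u)"] that(3) unfolding plots by auto
    qed
    show "dsmooth (tot P) (base P) (proj P)"
    proof (rule dsmoothI)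
      fix n U p assume p: "plots (tot P) n U p"
      then have "plots (tot Q) n U (\<lambda>u. T (p u))" by (simp add: plots)
      \<comment> \<open>On points of \<open>P\<close> the projection is \<open>\<phi>'\<close> after
        \<open>proj Q\<close> after \<open>T\<close>; this is where the inverse of the base map
        enters.\<close>
      from dsmooth_plot[OF base(3) dsmooth_plot[OF proj_Q this]]
      show "plots (base P) n U (\<lambda>u. proj P (p u))"
        by (rule plot_cong[OF base(1)]) (simp add: proj(2) pts[OF p] base(4) proj(1))
    qed (rule proj(1))
    show "proj P ` points (tot P) = points (base P)"
      using proj(1) zero_closed by (metis (no_types, lifting) image_eqI image_subsetI subsetI subset_antisym)
    show "Module.module real_fld (fibre_mod P x)" if "x \<in> points (base P)" for x by (rule module[OF that])
    show "dsmooth (subset_ds (prod_ds (tot P) (tot P)) {(v, w). proj P v = proj P w}) (tot P) (\<lambda>(v, w). vadd P v w)"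
    proof (rule dsmoothI)
      fix z assume "z \<in> points (subset_ds (prod_ds (tot P) (tot P)) {(v, w). proj P v = proj P w})"
      then show "(case z of (v, w) \<Rightarrow> vadd P v w) \<in> points (tot P)"
        using add_closed by (auto simp: subset_ds_def prod_ds_def)
    next
      fix n U p assume "plots (subset_ds (prod_ds (tot P) (tot P)) {(v, w). proj P v = proj P w}) n U p"
      then have p: "plots (tot P) n U (\<lambda>u. fst (p u))" "plots (tot P) n U (\<lambda>u. snd (p u))"
        "\<And>u. u \<in> U \<Longrightarrow> proj P (fst (p u)) = proj P (snd (p u))"
        by (auto simp: subset_ds_def prod_ds_def comp_def)
      note in_pts = pts[OF p(1)] pts[OF p(2)]
      have "plots (tot Q) n U (\<lambda>u. vadd Q (T (fst (p u))) (T (snd (p u))))"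
        using p in_pts by (intro add_Q) (simp_all add: plots proj(2))
      then have "plots (tot Q) n U (\<lambda>u. T (vadd P (fst (p u)) (snd (p u))))"
      proof (rule plot_cong[OF dQ])
        fix u assume u: "u \<in> U"
        have "snd (p u) \<in> fibre P (proj P (fst (p u)))" using in_pts(2)[OF u] p(3)[OF u] by (simp add: fibreI)
        then show "vadd Q (T (fst (p u))) (T (snd (p u))) = T (vadd P (fst (p u)) (snd (p u)))"
          using add[OF proj(1) in_fibre] in_pts(1)[OF u] by simp
      qed
      then show "plots (tot P) n U (\<lambda>u. case p u of (v, w) \<Rightarrow> vadd P v w)"
        using add_closed in_pts p(3) by (auto simp: plots split_beta)
    qed
    show "dsmooth (prod_ds real_ds (tot P)) (tot P) (\<lambda>(c, v). vscale P c v)"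
    proof (rule dsmoothI)
      fix z assume "z \<in> points (prod_ds real_ds (tot P))"
      then show "(case z of (c, v) \<Rightarrow> vscale P c v) \<in> points (tot P)"
        using scale_closed by (auto simp: prod_ds_def)
    next
      fix n U p assume "plots (prod_ds real_ds (tot P)) n U p"
      then have p: "plots real_ds n U (\<lambda>u. fst (p u))" "plots (tot P) n U (\<lambda>u. snd (p u))"
        by (auto simp: prod_ds_def comp_def)
      note in_pts = pts[OF p(2)]
      have "plots (tot Q) n U (\<lambda>u. vscale Q (fst (p u)) (T (snd (p u))))"
        using p by (intro scale_Q) (simp_all add: plots)
      then have "plots (tot Q) n U (\<lambda>u. T (vscale P (fst (p u)) (snd (p u))))"
        by (rule plot_cong[OF dQ]) (use scale[OF proj(1) in_fibre] in_pts in simp)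
      then show "plots (tot P) n U (\<lambda>u. case p u of (c, v) \<Rightarrow> vscale P c v)"
        using scale_closed in_pts by (auto simp: plots split_beta)
    qed
    show "dsmooth (base P) (tot P) (vzero P)"
    proof (rule dsmoothI)
      fix n U p assume p: "plots (base P) n U p"
      have "plots (tot Q) n U (\<lambda>u. T (vzero P (p u)))"
        using dsmooth_plot[OF zero_Q dsmooth_plot[OF base(2) p]]
        by (rule plot_cong[OF dQ]) (simp add: zero plot_points[OF base(1) p])
      then show "plots (tot P) n U (\<lambda>u. vzero P (p u))"
        using zero_closed(1) plot_points[OF base(1) p] by (auto simp: plots)
    qed (rule zero_closed(1))
  qed
qed

lemma tensor_power_with_simps [simp]:
  "points (tot (tensor_power_with D n V)) = Sigma (points (base V)) (tensor_power_space n V)"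
  "plots (tot (tensor_power_with D n V)) = D"
  "base (tensor_power_with D n V) = base V"
  "proj (tensor_power_with D n V) = fst"
  "vadd (tensor_power_with D n V) (x, s) (x', t) = (x, s \<oplus>\<^bsub>tensor_alg V x\<^esub> t)"
  "vscale (tensor_power_with D n V) c (x, t) = (x, tens V x (Poly_Mapping.single [] c) \<otimes>\<^bsub>tensor_alg V x\<^esub> t)"
  "vzero (tensor_power_with D n V) x = (x, \<zero>\<^bsub>tensor_alg V x\<^esub>)"
  by (simp_all add: tensor_power_with_def)

lemma tensor_power_with_closed:
  assumes "fibre_closed V x" "x \<in> points (base V)"
  shows "fibre_closed (tensor_power_with D n V) x"
  using assms tensor_power_space_closed[OF assms(1)] tensor_power_space_zero[OF assms(1)]
  by (auto simp: fibre_closed_def fibre_tensor_power_with)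

definition tensor_univ :: "('v, 'x) pbundle \<Rightarrow> 'x \<times> 'v list \<Rightarrow> 'x \<times> ('v list \<Rightarrow>\<^sub>0 real) set" where
  "tensor_univ V = (\<lambda>(x, l). (x, tens V x (Poly_Mapping.single l 1)))"

lemma plots_tensor_power:
  "plots (tot (tensor_power n V)) k U q \<longleftrightarrow>
     (\<forall>D. pseudo_bundle (tensor_power_with D n V) \<longrightarrow>
        dsmooth (fibre_power n V) (tot (tensor_power_with D n V)) (tensor_univ V) \<longrightarrow> D k U q)"
  by (auto simp: tensor_power_def tensor_univ_def)

lemma tensor_univ_points:
  "x \<in> points (base V) \<Longrightarrow> l \<in> lists (fibre V x) \<Longrightarrow> length l = n \<Longrightarrow>
    tensor_univ V (x, l) \<in> Sigma (points (base V)) (tensor_power_space n V)"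
  by (auto simp: tensor_univ_def tensor_power_space_eq intro!: imageI homogeneous_single)

text \<open>Fibrewise indiscrete, this is the coarsest competitor in the definition of the tensor power.\<close>

lemma tensor_power_plot_points:
  fixes V :: "('v, 'x) pbundle"
  assumes base: "diffeology (base V)" and closed: "\<And>x. x \<in> points (base V) \<Longrightarrow> fibre_closed V x"
    and q: "plots (tot (tensor_power n V)) k U q"
  shows "u \<in> U \<Longrightarrow> q u \<in> Sigma (points (base V)) (tensor_power_space n V)"
proof -
  let ?S = "Sigma (points (base V)) (tensor_power_space n V)"
  define D where "D k U q \<longleftrightarrow> q ` U \<subseteq> ?S \<and> plots (base V) k U (\<lambda>u. fst (q u))"
    for k U and q :: "(nat \<Rightarrow> real) \<Rightarrow> 'x \<times> ('v list \<Rightarrow>\<^sub>0 real) set"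
  have DI: "D k U q" if "\<And>u. u \<in> U \<Longrightarrow> q u \<in> ?S" "plots (base V) k U (\<lambda>u. fst (q u))" for k U q
    unfolding D_def using that by blast
  let ?P = "tensor_power_with D n V"
  have scale: "tens V x (Poly_Mapping.single [] c) \<otimes>\<^bsub>tensor_alg V x\<^esub> t \<in> tensor_power_space n V x"
    if "x \<in> points (base V)" "t \<in> tensor_power_space n V x" for x t c
    using tensor_power_space_closed(2)[OF closed] that by blast
  note cl = tensor_power_space_closed(1)[OF closed] scale tensor_power_space_zero[OF closed]
  \<comment> \<open>A competitor has to be exhibited: plots of the tensor power are defined by
    quantifying over all competitors, which says nothing about their values unless there is
    one.\<close>
  have "pseudo_bundle ?P"
    unfolding pseudo_bundle_def
  proof (intro conjI ballI)
    show "diffeology (tot ?P)"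
    proof (rule diffeologyI, unfold tensor_power_with_simps)
      show "openin (Euclidean_space n) U" if "D n U p" for n U p
        using that plot_open[OF base] unfolding D_def by blast
      show "p u \<in> ?S" if "D n U p" "u \<in> U" for n U p u using that unfolding D_def by blast
      show "D n U q" if "D n U p" "\<And>u. u \<in> U \<Longrightarrow> p u = q u" for n U p q
        using that plot_cong[OF base, of n U "\<lambda>u. fst (p u)" "\<lambda>u. fst (q u)"] unfolding D_def by auto
      show "D n U (\<lambda>_. a)" if "openin (Euclidean_space n) U" "a \<in> ?S" for n U a
        using that plot_const[OF base that(1), of "fst a"] unfolding D_def by auto
      show "D n U p" if "openin (Euclidean_space n) U" and loc: "locally_on n U (\<lambda>W. D n W p)" for n U p
      proof -
        have "locally_on n U (\<lambda>W. plots (base V) n W (\<lambda>u. fst (p u)))"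
          by (rule locally_on_mono[OF loc]) (simp add: D_def)
        then have "plots (base V) n U (\<lambda>u. fst (p u))" by (rule plot_locally[OF base that(1)])
        moreover have "p u \<in> ?S" if u: "u \<in> U" for u
          by (rule locally_onE[OF loc u]) (auto simp: D_def)
        ultimately show ?thesis unfolding D_def by blast
      qed
      show "D m W (\<lambda>x. p (h x))" if "D n U p" "Cinf_map m W n h" "h ` W \<subseteq> U" for n U p m W h
        using that(1) plot_compose[OF base _ that(2,3), of "\<lambda>u. fst (p u)"] that(3) unfolding D_def by auto
    qed
    show "diffeology (base ?P)" by (simp add: base)
    show "dsmooth (tot ?P) (base ?P) (proj ?P)" by (rule dsmoothI) (auto simp: D_def)
    show "proj ?P ` points (tot ?P) = points (base ?P)"
      using cl(3) fst_image_Sigma[of "points (base V)" "tensor_power_space n V"] by auto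
    show "Module.module real_fld (fibre_mod ?P x)" if "x \<in> points (base ?P)" for x
      using that by (intro tensor_power_module closed) simp_all
    show "dsmooth (subset_ds (prod_ds (tot ?P) (tot ?P)) {(v, w). proj ?P v = proj ?P w}) (tot ?P) (\<lambda>(v, w). vadd ?P v w)"
    proof (rule dsmoothI)
      fix z assume "z \<in> points (subset_ds (prod_ds (tot ?P) (tot ?P)) {(v, w). proj ?P v = proj ?P w})"
      then obtain x s t where "z = ((x, s), (x, t))" "x \<in> points (base V)"
        "s \<in> tensor_power_space n V x" "t \<in> tensor_power_space n V x"
        by (auto simp: subset_ds_def prod_ds_def)
      then show "(case z of (v, w) \<Rightarrow> vadd ?P v w) \<in> points (tot ?P)"
        by (simp add: cl)
    next
      fix k U p assume "plots (subset_ds (prod_ds (tot ?P) (tot ?P)) {(v, w). proj ?P v = proj ?P w}) k U p"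
      then have p: "D k U (\<lambda>u. fst (p u))" "D k U (\<lambda>u. snd (p u))" "\<And>u. u \<in> U \<Longrightarrow> fst (fst (p u)) = fst (snd (p u))"
        by (auto simp: subset_ds_def prod_ds_def comp_def)
      have mem: "(case p u of (v, w) \<Rightarrow> vadd ?P v w) \<in> ?S" if "u \<in> U" for u
      proof -
        obtain x s y t where e: "p u = ((x, s), (y, t))" by (metis prod.collapse)
        have "fst (p u) \<in> ?S" "snd (p u) \<in> ?S" using p(1,2) that unfolding D_def by blast+
        then show ?thesis using p(3)[OF that] by (simp add: e cl)
      qed
      have fst_eq: "fst (case p u of (v, w) \<Rightarrow> vadd ?P v w) = fst (fst (p u))" for u
      proof -
        obtain x s y t where e: "p u = ((x, s), (y, t))" by (metis prod.collapse)
        show ?thesis by (simp add: e)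
      qed
      show "plots (tot ?P) k U (\<lambda>u. case p u of (v, w) \<Rightarrow> vadd ?P v w)"
        unfolding tensor_power_with_simps(2)
        by (rule DI[OF mem]) (use p(1) in \<open>simp_all only: fst_eq D_def\<close>)
    qed
    show "dsmooth (prod_ds real_ds (tot ?P)) (tot ?P) (\<lambda>(c, v). vscale ?P c v)"
    proof (rule dsmoothI)
      fix z assume "z \<in> points (prod_ds real_ds (tot ?P))"
      then obtain c x t where "z = (c, (x, t))" "x \<in> points (base V)" "t \<in> tensor_power_space n V x"
        by (auto simp: prod_ds_def)
      then show "(case z of (c, v) \<Rightarrow> vscale ?P c v) \<in> points (tot ?P)"
        by (simp add: cl)
    next
      fix k U p assume "plots (prod_ds real_ds (tot ?P)) k U p"
      then have p: "D k U (\<lambda>u. snd (p u))" by (auto simp: prod_ds_def comp_def)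
      have mem: "(case p u of (c, v) \<Rightarrow> vscale ?P c v) \<in> ?S" if "u \<in> U" for u
      proof -
        obtain c y t where e: "p u = (c, (y, t))" by (metis prod.collapse)
        have "snd (p u) \<in> ?S" using p that unfolding D_def by blast
        then show ?thesis by (simp add: e cl)
      qed
      have fst_eq: "fst (case p u of (c, v) \<Rightarrow> vscale ?P c v) = fst (snd (p u))" for u
      proof -
        obtain c y t where e: "p u = (c, (y, t))" by (metis prod.collapse)
        show ?thesis by (simp add: e)
      qed
      show "plots (tot ?P) k U (\<lambda>u. case p u of (c, v) \<Rightarrow> vscale ?P c v)"
        unfolding tensor_power_with_simps(2)
        by (rule DI[OF mem]) (use p in \<open>simp_all only: fst_eq D_def\<close>)
    qed
    show "dsmooth (base ?P) (tot ?P) (vzero ?P)"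
      by (rule dsmoothI) (auto simp: D_def cl plot_points[OF base])
  qed
  moreover have "dsmooth (fibre_power n V) (tot ?P) (tensor_univ V)"
  proof (rule dsmoothI)
    fix z assume "z \<in> points (fibre_power n V)"
    then obtain x l where "z = (x, l)" "x \<in> points (base V)" "l \<in> lists (fibre V x)" "length l = n"
      unfolding fibre_power_def Let_def by auto
    then show "tensor_univ V z \<in> points (tot ?P)"
      by (simp only: tensor_power_with_simps tensor_univ_points)
  next
    fix k U p assume p: "plots (fibre_power n V) k U p"
    have mem: "tensor_univ V (p u) \<in> ?S" if "u \<in> U" for u
    proof -
      have "p u \<in> (SIGMA x:points (base V). {l \<in> lists (fibre V x). length l = n})"
        using p that unfolding fibre_power_def Let_def by auto
      then obtain x l where "p u = (x, l)" "x \<in> points (base V)" "l \<in> lists (fibre V x)" "length l = n" by blast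
      then show ?thesis by (simp only: tensor_univ_points)
    qed
    have "fst (tensor_univ V z) = fst z" for z by (cases z) (simp add: tensor_univ_def)
    then show "plots (tot ?P) k U (\<lambda>u. tensor_univ V (p u))"
      unfolding tensor_power_with_simps(2)
      using p by (intro DI[OF mem]) (simp_all add: fibre_power_def Let_def comp_def)
  qed
  ultimately have "D k U q" by (rule q[unfolded plots_tensor_power, rule_format])
  then show "u \<in> U \<Longrightarrow> ?thesis" unfolding D_def by blast
qed

text \<open>A Clifford element is a set of cosets of formal combinations of words, so the word map
  acts through two levels of images.\<close>

definition cl_map :: "('v \<Rightarrow> 'w) \<Rightarrow> ('x \<Rightarrow> 'y) \<Rightarrow> 'x \<times> ('v list \<Rightarrow>\<^sub>0 real) set set \<Rightarrow> 'y \<times> ('w list \<Rightarrow>\<^sub>0 real) set set" where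
  "cl_map \<Phi> \<phi> = (\<lambda>(x, c). (\<phi> x, (`) (map_words \<Phi>) ` c))"

lemma points_tensor_ds: "points (tensor_ds V) = Sigma (points (base V)) (\<lambda>x. carrier (tensor_alg V x))"
  by (simp add: tensor_ds_def Let_def)

lemma points_cl_ds: "points (cl_ds V g) = cl_proj V g ` points (tensor_ds V)"
  unfolding points_tensor_ds
  by (auto simp: cl_ds_def cl_alg_def cl_proj_def FactRing_def A_RCOSETS_def' image_iff)

lemma plots_cl_ds:
  "plots (cl_ds V g) n U p \<longleftrightarrow> openin (Euclidean_space n) U \<and>
       locally_on n U (\<lambda>W. \<exists>q. plots (tensor_ds V) n W q \<and> (\<forall>u\<in>W. p u = cl_proj V g (q u)))"
  by (simp add: cl_ds_def quotient_ds_def)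

lemma tensor_ds_plot_points: "plots (tensor_ds V) n U q \<Longrightarrow> u \<in> U \<Longrightarrow> q u \<in> points (tensor_ds V)"
  by (auto simp: tensor_ds_def Let_def)

section \<open>Isomorphisms of pseudo-bundles acting on tensor powers and tensor algebras\<close>

locale bundle_iso =
  fixes A :: "('v, 'x) pbundle" and B :: "('w, 'y) pbundle"
    and \<Phi> :: "'v \<Rightarrow> 'w" and \<Phi>' :: "'w \<Rightarrow> 'v" and \<phi> :: "'x \<Rightarrow> 'y" and \<phi>' :: "'y \<Rightarrow> 'x"
  assumes base_A: "diffeology (base A)" and base_B: "diffeology (base B)"
    and base_map: "dsmooth (base A) (base B) \<phi>" and base_map': "dsmooth (base B) (base A) \<phi>'"
    and base_inv: "x \<in> points (base A) \<Longrightarrow> \<phi>' (\<phi> x) = x"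
    and base_inv': "y \<in> points (base B) \<Longrightarrow> \<phi> (\<phi>' y) = y"
    and ext_A: "plots_extensional (tot A)" and ext_B: "plots_extensional (tot B)"
    and tot_map: "dsmooth (tot A) (tot B) \<Phi>" and tot_map': "dsmooth (tot B) (tot A) \<Phi>'"
    and tot_inv: "v \<in> points (tot A) \<Longrightarrow> \<Phi>' (\<Phi> v) = v"
    and tot_inv': "w \<in> points (tot B) \<Longrightarrow> \<Phi> (\<Phi>' w) = w"
    and proj_A: "v \<in> points (tot A) \<Longrightarrow> proj A v \<in> points (base A)"
    and proj_map: "v \<in> points (tot A) \<Longrightarrow> proj B (\<Phi> v) = \<phi> (proj A v)"
    and closed: "x \<in> points (base A) \<Longrightarrow> fibre_closed A x"
    and map_add: "x \<in> points (base A) \<Longrightarrow> v \<in> fibre A x \<Longrightarrow> v' \<in> fibre A x \<Longrightarrow>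
      \<Phi> (vadd A v v') = vadd B (\<Phi> v) (\<Phi> v')"
    and map_scale: "x \<in> points (base A) \<Longrightarrow> v \<in> fibre A x \<Longrightarrow> \<Phi> (vscale A c v) = vscale B c (\<Phi> v)"
    and map_zero: "x \<in> points (base A) \<Longrightarrow> \<Phi> (vzero A x) = vzero B (\<phi> x)"
begin

lemma base_in: "x \<in> points (base A) \<Longrightarrow> \<phi> x \<in> points (base B)"
  using base_map dsmooth_points by metis

lemma base_in': "y \<in> points (base B) \<Longrightarrow> \<phi>' y \<in> points (base A)"
  using base_map' dsmooth_points by metis

lemma proj_map': "w \<in> points (tot B) \<Longrightarrow> proj A (\<Phi>' w) = \<phi>' (proj B w)"
  using proj_map[of "\<Phi>' w"] tot_inv' base_inv proj_A dsmooth_points[OF tot_map'] by metis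

lemma fibre_iso: "x \<in> points (base A) \<Longrightarrow> fibre_iso A x B (\<phi> x) \<Phi> \<Phi>'"
  using dsmooth_points[OF tot_map] dsmooth_points[OF tot_map'] proj_map'
  by unfold_locales
    (auto simp: closed map_add map_scale map_zero tot_inv tot_inv' base_inv proj_map dest!: fibreD intro!: fibreI
      intro: fibreI)

lemma sym: "bundle_iso B A \<Phi>' \<Phi> \<phi>' \<phi>"
proof -
  have fi: "fibre_iso B y A (\<phi>' y) \<Phi>' \<Phi>" if "y \<in> points (base B)" for y
    using fibre_iso.sym[OF fibre_iso[OF base_in'[OF that]]] base_inv'[OF that] by simp
  show ?thesis
  proof unfold_locales
    show "proj B w \<in> points (base B)" if "w \<in> points (tot B)" for w
      using that proj_map[of "\<Phi>' w"] tot_inv'[OF that] dsmooth_points[OF tot_map' that] base_in proj_A by metis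
  qed (use fi in \<open>auto simp: fibre_iso_def base_A base_B base_map base_map' base_inv base_inv' ext_A ext_B tot_map tot_map'
      tot_inv tot_inv' proj_map'\<close>)
qed

lemma tensor_map_eq:
  assumes "x \<in> points (base A)" "t \<in> carrier (tensor_alg A x)"
  shows "tensor_map A B \<Phi> (x, t) = (\<phi> x, map_words \<Phi> ` t)"
proof -
  have z: "vzero A x \<in> fibre A x" using closed[OF assms(1)] by (simp add: fibre_closed_def)
  then have "proj B (\<Phi> (vzero A x)) = \<phi> x" using proj_map fibreD by metis
  then show ?thesis
    using fibre_iso.Union_tens_hom[OF fibre_iso[OF assms(1)] assms(2)] by (simp add: tensor_map_def Let_def)
qed

lemma tensor_power_map_plot:
  assumes "plots (tot (tensor_power n A)) k U q"
  shows "plots (tot (tensor_power n B)) k U (\<lambda>u. tensor_map A B \<Phi> (q u))"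
  unfolding plots_tensor_power
proof (intro allI impI)
  fix D' assume PB: "pseudo_bundle (tensor_power_with D' n B)"
    and univ: "dsmooth (fibre_power n B) (tot (tensor_power_with D' n B)) (tensor_univ B)"
  define T where "T = tensor_map A B \<Phi>"
  let ?SA = "Sigma (points (base A)) (tensor_power_space n A)"
  let ?SB = "Sigma (points (base B)) (tensor_power_space n B)"
  \<comment> \<open>The pullback of the competitor \<open>D'\<close> along \<open>T\<close>. Once it
    is known to be a competitor on the source, \<open>q\<close> is a plot for it, and this contains
    the goal.\<close>
  define D where "D k U q \<longleftrightarrow> q ` U \<subseteq> ?SA \<and> D' k U (\<lambda>u. T (q u))"
    for k U and q :: "(nat \<Rightarrow> real) \<Rightarrow> 'x \<times> ('v list \<Rightarrow>\<^sub>0 real) set"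
  have T: "T (x, t) = (\<phi> x, map_words \<Phi> ` t)" if "x \<in> points (base A)" "t \<in> tensor_power_space n A x" for x t
    unfolding T_def using that tensor_power_space_carrier[of n A x] by (intro tensor_map_eq) auto
  have TS: "T z \<in> ?SB" if "z \<in> ?SA" for z
    using that fibre_iso.hom_power_space[OF fibre_iso] base_in by (auto simp: T)
  have "pseudo_bundle (tensor_power_with D n A)"
  proof (rule pseudo_bundle_pullback[OF PB, where T = T and \<phi> = \<phi> and \<phi>' = \<phi>'], unfold tensor_power_with_simps(1-4))
    show "D k U q = (q ` U \<subseteq> ?SA \<and> D' k U (\<lambda>u. T (q u)))" for k U q by (simp add: D_def)
    show "T t \<in> ?SB" if "t \<in> ?SA" for t using TS[OF that] .
    show "fst t \<in> points (base A)" if "t \<in> ?SA" for t using that by auto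
    show "fst (T t) = \<phi> (fst t)" if "t \<in> ?SA" for t using that by (auto simp: T)
    fix x assume x: "x \<in> points (base A)"
    interpret F: fibre_iso A x B "\<phi> x" \<Phi> \<Phi>' by (rule fibre_iso[OF x])
    note sub = subsetD[OF tensor_power_space_carrier[of n A x]]
    show "fibre_closed (tensor_power_with D n A) x" by (rule tensor_power_with_closed[OF F.closed x])
    show "Module.module real_fld (fibre_mod (tensor_power_with D n A) x)" by (rule tensor_power_module[OF F.closed x])
    show "T (vzero (tensor_power_with D n A) x) = vzero (tensor_power_with D' n B) (\<phi> x)"
      by (simp add: T x tensor_power_space_zero[OF F.closed] F.hom_zero)
    fix v assume "v \<in> fibre (tensor_power_with D n A) x"
    then obtain s where s: "v = (x, s)" "s \<in> tensor_power_space n A x" using x by (auto simp: fibre_tensor_power_with)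
    show "T (vscale (tensor_power_with D n A) c v) = vscale (tensor_power_with D' n B) c (T v)" for c
      using tensor_power_space_closed(2)[OF F.closed s(2) s(2)] by (simp add: s T x F.hom_scale sub)
    fix w assume "w \<in> fibre (tensor_power_with D n A) x"
    then obtain t where t: "w = (x, t)" "t \<in> tensor_power_space n A x" using x by (auto simp: fibre_tensor_power_with)
    show "T (vadd (tensor_power_with D n A) v w) = vadd (tensor_power_with D' n B) (T v) (T w)"
      using tensor_power_space_closed(1)[OF F.closed s(2) t(2)] s t by (simp add: T x F.hom_add sub)
  qed (simp_all add: base_A base_map base_map' base_inv)
  moreover have "dsmooth (fibre_power n A) (tot (tensor_power_with D n A)) (tensor_univ A)"
  proof (rule dsmoothI)
    fix z assume "z \<in> points (fibre_power n A)"
    then obtain x l where "z = (x, l)" "x \<in> points (base A)" "l \<in> lists (fibre A x)" "length l = n"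
      unfolding fibre_power_def Let_def by auto
    then show "tensor_univ A z \<in> points (tot (tensor_power_with D n A))"
      by (simp only: tensor_power_with_simps tensor_univ_points)
  next
    fix k U p assume "plots (fibre_power n A) k U p"
    then have p: "p ` U \<subseteq> (SIGMA x:points (base A). {l \<in> lists (fibre A x). length l = n})"
      "plots (base A) k U (\<lambda>u. fst (p u))" "\<And>i. i < n \<Longrightarrow> plots (tot A) k U (\<lambda>u. snd (p u) ! i)"
      by (auto simp: fibre_power_def Let_def comp_def)
    have pu: "fst (p u) \<in> points (base A)" "snd (p u) \<in> lists (fibre A (fst (p u)))" "length (snd (p u)) = n"
      if "u \<in> U" for u
      using p(1) that by (auto simp: image_subset_iff mem_Times_iff)
    have univ_in: "tensor_univ A (p u) \<in> ?SA" if "u \<in> U" for u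
      using tensor_univ_points[OF pu[OF that]] by simp
    \<comment> \<open>Naturality of the universal multilinear map: \<open>T\<close> after
      \<open>tensor_univ A\<close> along \<open>p\<close> equals \<open>tensor_univ B\<close> along
      the letterwise image \<open>p'\<close>, which is smooth for \<open>D'\<close>.\<close>
    define p' where "p' u = (\<phi> (fst (p u)), map \<Phi> (snd (p u)))" for u
    have "plots (fibre_power n B) k U p'"
    proof -
      have "p' u \<in> (SIGMA x:points (base B). {l \<in> lists (fibre B x). length l = n})" if "u \<in> U" for u
        using pu[OF that] base_in fibre_iso.map_lists[OF fibre_iso] unfolding p'_def by simp
      then have "p' ` U \<subseteq> (SIGMA x:points (base B). {l \<in> lists (fibre B x). length l = n})" by blast
      moreover have "plots (base B) k U (\<lambda>u. fst (p' u))"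
        using dsmooth_plot[OF base_map p(2)] by (simp add: p'_def)
      moreover have "plots (tot B) k U (\<lambda>u. snd (p' u) ! i)" if "i < n" for i
        using dsmooth_plot[OF tot_map p(3)[OF that]]
        by (rule plots_extensionalD[OF ext_B]) (simp add: p'_def pu that)
      ultimately show ?thesis by (simp add: fibre_power_def Let_def comp_def)
    qed
    from dsmooth_plot[OF univ this] have D': "D' k U (\<lambda>u. tensor_univ B (p' u))" by simp
    have dB: "diffeology (tot (tensor_power_with D' n B))" using PB by (simp add: pseudo_bundle_def)
    have "tensor_univ B (p' u) = T (tensor_univ A (p u))" if "u \<in> U" for u
    proof -
      obtain x l where e: "p u = (x, l)" by (metis prod.collapse)
      have "tens A x (Poly_Mapping.single l 1) \<in> tensor_power_space n A x" "x \<in> points (base A)"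
        using univ_in[OF that] by (auto simp: e tensor_univ_def)
      then show ?thesis by (simp add: p'_def e tensor_univ_def T fibre_iso.hom_tens[OF fibre_iso])
    qed
    then have "D' k U (\<lambda>u. T (tensor_univ A (p u)))"
      by (rule plot_cong[OF dB, unfolded tensor_power_with_simps, OF D'])
    moreover have "(\<lambda>u. tensor_univ A (p u)) ` U \<subseteq> ?SA" using univ_in by blast
    ultimately show "plots (tot (tensor_power_with D n A)) k U (\<lambda>u. tensor_univ A (p u))"
      by (simp add: D_def)
  qed
  ultimately have "D k U q"
    by (rule assms[unfolded plots_tensor_power, rule_format])
  then show "D' k U (\<lambda>u. tensor_map A B \<Phi> (q u))" by (simp add: D_def T_def)
qed

lemma tensor_map_points:
  assumes "t \<in> points (tensor_ds A)"
  shows "tensor_map A B \<Phi> t \<in> points (tensor_ds B)"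
  using assms tensor_map_eq base_in fibre_iso.hom_carrier[OF fibre_iso] by (auto simp: points_tensor_ds)

lemma tensor_map_inv:
  assumes "t \<in> points (tensor_ds A)"
  shows "tensor_map B A \<Phi>' (tensor_map A B \<Phi> t) = t"
proof -
  interpret S: bundle_iso B A \<Phi>' \<Phi> \<phi>' \<phi> by (rule sym)
  obtain x s where t: "t = (x, s)" "x \<in> points (base A)" "s \<in> carrier (tensor_alg A x)"
    using assms by (auto simp: points_tensor_ds)
  interpret F: fibre_iso A x B "\<phi> x" \<Phi> \<Phi>' by (rule fibre_iso[OF t(2)])
  show ?thesis
    using t(2,3) by (simp add: t(1) tensor_map_eq S.tensor_map_eq base_in F.hom_carrier F.hom_carrier_inv base_inv)
qed

lemma tensor_map_plot:
  assumes q: "plots (tensor_ds A) k U q"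
  shows "plots (tensor_ds B) k U (\<lambda>u. tensor_map A B \<Phi> (q u))"
proof -
  let ?T = "tensor_map A B \<Phi>"
  define loc where "loc V q = (\<lambda>W. \<exists>N r.
           (\<forall>n\<le>N. plots (tot (tensor_power n V)) k W (r n)) \<and>
           (\<forall>u\<in>W. (\<forall>n\<le>N. fst (r n u) = fst (q u)) \<and>
              snd (q u) = (\<Oplus>\<^bsub>tensor_alg V (fst (q u))\<^esub>n\<in>{..N}. snd (r n u))))"
    for V :: "('v, 'x) pbundle" and q
  define loc' where "loc' V q = (\<lambda>W. \<exists>N r.
           (\<forall>n\<le>N. plots (tot (tensor_power n V)) k W (r n)) \<and>
           (\<forall>u\<in>W. (\<forall>n\<le>N. fst (r n u) = fst (q u)) \<and>
              snd (q u) = (\<Oplus>\<^bsub>tensor_alg V (fst (q u))\<^esub>n\<in>{..N}. snd (r n u))))"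
    for V :: "('w, 'y) pbundle" and q
  have U: "openin (Euclidean_space k) U" and qU: "\<And>u. u \<in> U \<Longrightarrow> q u \<in> points (tensor_ds A)"
    and lq: "locally_on k U (loc A q)"
    using q by (auto simp: tensor_ds_def Let_def loc_def)
  have "locally_on k U (loc' B (\<lambda>u. ?T (q u)))"
    using lq
  proof (rule locally_on_mono)
    fix W assume W: "W \<subseteq> U" and "loc A q W"
    then obtain N r where r: "\<And>n. n \<le> N \<Longrightarrow> plots (tot (tensor_power n A)) k W (r n)"
      "\<And>u n. u \<in> W \<Longrightarrow> n \<le> N \<Longrightarrow> fst (r n u) = fst (q u)"
      "\<And>u. u \<in> W \<Longrightarrow> snd (q u) = (\<Oplus>\<^bsub>tensor_alg A (fst (q u))\<^esub>n\<in>{..N}. snd (r n u))"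
      unfolding loc_def by blast
    have main: "fst (?T (r n u)) = fst (?T (q u)) \<and>
      snd (?T (q u)) = (\<Oplus>\<^bsub>tensor_alg B (fst (?T (q u)))\<^esub>n\<in>{..N}. snd (?T (r n u)))"
      if u: "u \<in> W" and n: "n \<le> N" for u n
    proof -
      obtain x t where qu: "q u = (x, t)" by (metis prod.collapse)
      have x: "x \<in> points (base A)" "t \<in> carrier (tensor_alg A x)"
        using qU[of u] W u qu by (auto simp: points_tensor_ds)
      have ru: "r n u = (x, snd (r n u))" if "n \<le> N" for n using r(2)[OF u that] qu by (metis fst_conv prod.collapse)
      \<comment> \<open>The summands have to lie in the carrier before the ring homomorphism may be
        moved inside the finite sum. The coarsest competitor provides exactly this.\<close>
      have rc: "snd (r n u) \<in> carrier (tensor_alg A x)" if "n \<le> N" for n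
      proof -
        have "r n u \<in> Sigma (points (base A)) (tensor_power_space n A)"
          by (rule tensor_power_plot_points[OF base_A closed r(1)[OF that] u])
        then show ?thesis using ru[OF that] tensor_power_space_carrier by (metis mem_Sigma_iff subsetD)
      qed
      have Tr: "?T (r n u) = (\<phi> x, map_words \<Phi> ` snd (r n u))" if "n \<le> N" for n
        using tensor_map_eq[OF x(1) rc[OF that]] ru[OF that] by simp
      interpret F: fibre_iso A x B "\<phi> x" \<Phi> \<Phi>' by (rule fibre_iso[OF x(1)])
      interpret H: ring_hom_ring "tensor_alg A x" "tensor_alg B (\<phi> x)" "(`) (map_words \<Phi>)" by (rule F.hom_ring_hom)
      have "t = (\<Oplus>\<^bsub>tensor_alg A x\<^esub>n\<in>{..N}. snd (r n u))" using r(3)[OF u] qu by simp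
      then have "map_words \<Phi> ` t = (\<Oplus>\<^bsub>tensor_alg B (\<phi> x)\<^esub>n\<in>{..N}. map_words \<Phi> ` snd (r n u))"
        using H.hom_finsum[of "\<lambda>n. snd (r n u)" "{..N}"] rc by (simp add: comp_def)
      also have "\<dots> = (\<Oplus>\<^bsub>tensor_alg B (\<phi> x)\<^esub>n\<in>{..N}. snd (?T (r n u)))"
        using rc F.hom_carrier by (intro H.S.add.finprod_cong') (auto simp: Tr)
      finally show ?thesis using Tr[OF n] tensor_map_eq[OF x] qu by simp
    qed
    show "loc' B (\<lambda>u. ?T (q u)) W"
      unfolding loc'_def
      using main tensor_power_map_plot[OF r(1)]
      by (intro exI[of _ N] exI[of _ "\<lambda>n u. ?T (r n u)"]) auto
  qed
  moreover have "(\<lambda>u. ?T (q u)) ` U \<subseteq> points (tensor_ds B)" using tensor_map_points[OF qU] by blast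
  ultimately show ?thesis
    using U by (simp add: tensor_ds_def Let_def loc'_def)
qed

end

section \<open>Isometric isomorphisms and the induced diffeomorphism of Clifford algebras\<close>

locale isometric_bundle_iso = bundle_iso +
  fixes gA :: "'b \<Rightarrow> 'a \<Rightarrow> 'a \<Rightarrow> real" and gB :: "'d \<Rightarrow> 'c \<Rightarrow> 'c \<Rightarrow> real"
  assumes isometric: "x \<in> points (base A) \<Longrightarrow> v \<in> fibre A x \<Longrightarrow> w \<in> fibre A x \<Longrightarrow> gB (\<phi> x) (\<Phi> v) (\<Phi> w) = gA x v w"
begin

lemma sym_isometric: "isometric_bundle_iso B A \<Phi>' \<Phi> \<phi>' \<phi> gB gA"
proof -
  interpret S: bundle_iso B A \<Phi>' \<Phi> \<phi>' \<phi> by (rule sym)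
  show ?thesis
  proof unfold_locales
    fix y v w assume y: "y \<in> points (base B)" and v: "v \<in> fibre B y" and w: "w \<in> fibre B y"
    interpret F: fibre_iso B y A "\<phi>' y" \<Phi>' \<Phi> by (rule S.fibre_iso[OF y])
    show "gA (\<phi>' y) (\<Phi>' v) (\<Phi>' w) = gB y v w"
      using isometric[OF base_in'[OF y] F.maps[OF v] F.maps[OF w]] by (simp add: base_inv' y F.inv v w)
  qed
qed

lemma cl_map_proj:
  assumes "t \<in> points (tensor_ds A)"
  shows "cl_map \<Phi> \<phi> (cl_proj A gA t) = cl_proj B gB (tensor_map A B \<Phi> t)"
proof -
  obtain x s where t: "t = (x, s)" "x \<in> points (base A)" "s \<in> carrier (tensor_alg A x)"
    using assms by (auto simp: points_tensor_ds)
  interpret F: fibre_iso A x B "\<phi> x" \<Phi> \<Phi>' by (rule fibre_iso[OF t(2)])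
  have "cl_ideal A gA x \<subseteq> carrier (tensor_alg A x)"
    using ideal.Icarr[OF cl_ideal_ideal[OF F.closed]] by blast
  from F.hom_coset[OF this t(3)] F.hom_cl_ideal[where gA = gA and gB = gB, OF isometric[OF t(2)]]
  show ?thesis using t(2,3) by (simp add: t(1) cl_map_def cl_proj_def tensor_map_eq)
qed

lemma cl_map_points: "c \<in> points (cl_ds A gA) \<Longrightarrow> cl_map \<Phi> \<phi> c \<in> points (cl_ds B gB)"
  using cl_map_proj tensor_map_points by (auto simp: points_cl_ds)

lemma cl_map_inv: "c \<in> points (cl_ds A gA) \<Longrightarrow> cl_map \<Phi>' \<phi>' (cl_map \<Phi> \<phi> c) = c"
proof -
  interpret S: isometric_bundle_iso B A \<Phi>' \<Phi> \<phi>' \<phi> gB gA by (rule sym_isometric)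
  assume "c \<in> points (cl_ds A gA)"
  then obtain t where t: "t \<in> points (tensor_ds A)" "c = cl_proj A gA t" by (auto simp: points_cl_ds)
  then show ?thesis
    by (simp add: cl_map_proj S.cl_map_proj[OF tensor_map_points] tensor_map_inv)
qed

text \<open>A local lift to the tensor algebra is pushed forward by \<open>tensor_map\<close>. The
  general \<open>\<Theta>\<close> covers both the restriction of \<open>cl_map\<close> and the
  inverse obtained by \<open>inv_into\<close>.\<close>

lemma cl_map_plot:
  assumes "plots (cl_ds A gA) n U p" and eq: "\<And>c. c \<in> points (cl_ds A gA) \<Longrightarrow> \<Theta> c = cl_map \<Phi> \<phi> c"
  shows "plots (cl_ds B gB) n U (\<lambda>u. \<Theta> (p u))"
proof -
  have "locally_on n U (\<lambda>W. \<exists>q. plots (tensor_ds A) n W q \<and> (\<forall>u\<in>W. p u = cl_proj A gA (q u)))"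
    using assms by (simp add: plots_cl_ds)
  then have "locally_on n U (\<lambda>W. \<exists>q. plots (tensor_ds B) n W q \<and> (\<forall>u\<in>W. \<Theta> (p u) = cl_proj B gB (q u)))"
  proof (rule locally_on_mono)
    fix W assume "\<exists>q. plots (tensor_ds A) n W q \<and> (\<forall>u\<in>W. p u = cl_proj A gA (q u))"
    then obtain q where q: "plots (tensor_ds A) n W q" "\<forall>u\<in>W. p u = cl_proj A gA (q u)" by blast
    have "\<Theta> (p u) = cl_proj B gB (tensor_map A B \<Phi> (q u))" if "u \<in> W" for u
      using q(2) that tensor_ds_plot_points[OF q(1) that] cl_map_proj eq by (simp add: points_cl_ds)
    then show "\<exists>q. plots (tensor_ds B) n W q \<and> (\<forall>u\<in>W. \<Theta> (p u) = cl_proj B gB (q u))"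
      using tensor_map_plot[OF q(1)] by (intro exI[of _ "\<lambda>u. tensor_map A B \<Phi> (q u)"]) simp
  qed
  then show ?thesis using assms(1) by (simp add: plots_cl_ds)
qed

theorem clifford_diffeomorphism:
  "\<exists>\<Theta>. \<Theta> \<in> points (cl_ds A gA) \<rightarrow>\<^sub>E points (cl_ds B gB) \<and>
    (\<forall>t\<in>points (tensor_ds A). \<Theta> (cl_proj A gA t) = cl_proj B gB (tensor_map A B \<Phi> t)) \<and>
    (\<forall>\<Theta>'. \<Theta>' \<in> points (cl_ds A gA) \<rightarrow>\<^sub>E points (cl_ds B gB) \<and>
       (\<forall>t\<in>points (tensor_ds A). \<Theta>' (cl_proj A gA t) = cl_proj B gB (tensor_map A B \<Phi> t))
       \<longrightarrow> \<Theta>' = \<Theta>) \<and>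
    diffeomorphism (cl_ds A gA) (cl_ds B gB) \<Theta>"
proof -
  interpret S: isometric_bundle_iso B A \<Phi>' \<Phi> \<phi>' \<phi> gB gA by (rule sym_isometric)
  define \<Theta> where "\<Theta> = restrict (cl_map \<Phi> \<phi>) (points (cl_ds A gA))"
  have \<Theta>: "\<Theta> c = cl_map \<Phi> \<phi> c" if "c \<in> points (cl_ds A gA)" for c using that by (simp add: \<Theta>_def)
  have bij: "bij_betw \<Theta> (points (cl_ds A gA)) (points (cl_ds B gB))"
    by (rule bij_betwI[where g = "cl_map \<Phi>' \<phi>'"])
      (auto simp: \<Theta> cl_map_points S.cl_map_points cl_map_inv S.cl_map_inv)
  have inv: "inv_into (points (cl_ds A gA)) \<Theta> c = cl_map \<Phi>' \<phi>' c" if "c \<in> points (cl_ds B gB)" for c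
    using that bij S.cl_map_points[OF that] S.cl_map_inv[OF that] \<Theta>
    by (metis bij_betw_imp_inj_on inv_into_f_f)
  have "dsmooth (cl_ds A gA) (cl_ds B gB) \<Theta>"
    by (rule dsmoothI) (auto simp: \<Theta> cl_map_points intro: cl_map_plot)
  moreover have "dsmooth (cl_ds B gB) (cl_ds A gA) (inv_into (points (cl_ds A gA)) \<Theta>)"
    by (rule dsmoothI) (auto simp: inv S.cl_map_points intro: S.cl_map_plot)
  moreover have "\<Theta> \<in> points (cl_ds A gA) \<rightarrow>\<^sub>E points (cl_ds B gB)"
    by (auto simp: \<Theta>_def cl_map_points)
  moreover have val: "\<forall>t\<in>points (tensor_ds A). \<Theta> (cl_proj A gA t) = cl_proj B gB (tensor_map A B \<Phi> t)"
    using cl_map_proj by (auto simp: \<Theta> points_cl_ds)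
  \<comment> \<open>The quotient projection is onto the points of the Clifford bundle, so the
    identity fixes all values there; off the points both maps are extensional.\<close>
  moreover have "\<Theta>' = \<Theta>" if "\<Theta>' \<in> points (cl_ds A gA) \<rightarrow>\<^sub>E points (cl_ds B gB)"
    "\<forall>t\<in>points (tensor_ds A). \<Theta>' (cl_proj A gA t) = cl_proj B gB (tensor_map A B \<Phi> t)" for \<Theta>'
  proof (rule extensionalityI[of _ "points (cl_ds A gA)"])
    show "\<Theta>' \<in> extensional (points (cl_ds A gA))" "\<Theta> \<in> extensional (points (cl_ds A gA))"
      using that(1) by (auto simp: \<Theta>_def PiE_def)
    fix c assume "c \<in> points (cl_ds A gA)"
    then show "\<Theta>' c = \<Theta> c" using that(2) val by (auto simp: points_cl_ds)
  qed
  ultimately show ?thesis using bij unfolding diffeomorphism_def by blast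
qed

end

section \<open>Dual pseudo-bundles\<close>

lemma dual_simps [simp]:
  "points (tot (dual V)) = Sigma (points (base V)) (dual_space V)"
  "base (dual V) = base V" "proj (dual V) = fst"
  "vadd (dual V) (x, \<xi>) (x', \<eta>) = (x, \<lambda>v\<in>fibre V x. \<xi> v + \<eta> v)"
  "vscale (dual V) c (x, \<xi>) = (x, \<lambda>v\<in>fibre V x. c * \<xi> v)"
  "vzero (dual V) x = (x, \<lambda>v\<in>fibre V x. 0)"
  by (simp_all add: dual_def)

lemma fibre_dual: "fibre (dual V) x = (if x \<in> points (base V) then Pair x ` dual_space V x else {})"
  by (auto simp: fibre_def preim_def)

lemma lin_map_real_iff:
  "lin_map (fibre_mod V x) real_mod \<xi> \<longleftrightarrow>
     (\<forall>v\<in>fibre V x. \<forall>w\<in>fibre V x. \<xi> (vadd V v w) = \<xi> v + \<xi> w) \<and> (\<forall>c. \<forall>v\<in>fibre V x. \<xi> (vscale V c v) = c * \<xi> v)"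
  by (auto simp: lin_map_def fibre_mod_def real_mod_def)

lemma dsmooth_real_iff:
  "dsmooth (subset_ds Z S) real_ds \<xi> \<longleftrightarrow> (\<forall>k W p. plots Z k W p \<longrightarrow> p ` W \<subseteq> S \<longrightarrow> Cinf_on k W (\<lambda>w. \<xi> (p w)))"
  by (auto simp: dsmooth_def subset_ds_def real_ds_def comp_def)

lemma dual_space_iff:
  "\<xi> \<in> dual_space V x \<longleftrightarrow> \<xi> \<in> extensional (fibre V x) \<and>
     (\<forall>v\<in>fibre V x. \<forall>w\<in>fibre V x. \<xi> (vadd V v w) = \<xi> v + \<xi> w) \<and> (\<forall>c. \<forall>v\<in>fibre V x. \<xi> (vscale V c v) = c * \<xi> v) \<and>
     (\<forall>k W p. plots (tot V) k W p \<longrightarrow> p ` W \<subseteq> fibre V x \<longrightarrow> Cinf_on k W (\<lambda>w. \<xi> (p w)))"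
  by (auto simp: dual_space_def lin_map_real_iff dsmooth_real_iff)

lemma dual_space_restrictI:
  assumes closed: "fibre_closed V x"
    and "\<And>v w. v \<in> fibre V x \<Longrightarrow> w \<in> fibre V x \<Longrightarrow> \<xi> (vadd V v w) = \<xi> v + \<xi> w"
    and "\<And>c v. v \<in> fibre V x \<Longrightarrow> \<xi> (vscale V c v) = c * \<xi> v"
    and smooth: "\<And>k W p. plots (tot V) k W p \<Longrightarrow> p ` W \<subseteq> fibre V x \<Longrightarrow> Cinf_on k W (\<lambda>w. \<xi> (p w))"
  shows "restrict \<xi> (fibre V x) \<in> dual_space V x"
proof -
  have "Cinf_on k W (\<lambda>w. restrict \<xi> (fibre V x) (p w))" if p: "plots (tot V) k W p" "p ` W \<subseteq> fibre V x" for k W p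
    by (rule Cinf_on_cong[OF _ smooth[OF p]]) (use p(2) in auto)
  then show ?thesis
    using assms(2,3) closed by (auto simp: dual_space_iff fibre_closed_def)
qed

lemma fibre_closed_dual:
  assumes V: "diffeology (tot V)" and closed: "fibre_closed V x" and x: "x \<in> points (base V)"
  shows "fibre_closed (dual V) x"
proof -
  have "(\<lambda>v\<in>fibre V x. 0) \<in> dual_space V x"
    by (rule dual_space_restrictI[OF closed]) (auto intro: Cinf_on_const plot_open[OF V])
  moreover have "(\<lambda>v\<in>fibre V x. \<xi> v + \<eta> v) \<in> dual_space V x"
    if "\<xi> \<in> dual_space V x" "\<eta> \<in> dual_space V x" for \<xi> \<eta>
    using that by (intro dual_space_restrictI[OF closed]) (auto simp: dual_space_iff algebra_simps intro!: Cinf_on_add)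
  moreover have "(\<lambda>v\<in>fibre V x. c * \<xi> v) \<in> dual_space V x" if "\<xi> \<in> dual_space V x" for \<xi> c
    using that by (intro dual_space_restrictI[OF closed])
      (auto simp: dual_space_iff algebra_simps intro!: Cinf_on_mult Cinf_on_const plot_open[OF V])
  ultimately show ?thesis using x by (auto simp: fibre_closed_def fibre_dual)
qed

text \<open>The two parameters of the evaluation condition may be tested simultaneously, along a
  common parametrization.\<close>

lemma dual_plot_iff:
  assumes V: "diffeology (tot V)"
  shows "plots (tot (dual V)) m U q \<longleftrightarrow>
    q ` U \<subseteq> Sigma (points (base V)) (dual_space V) \<and> plots (base V) m U (\<lambda>u. fst (q u)) \<and>
    (\<forall>k W h p. Cinf_map k W m h \<longrightarrow> h ` W \<subseteq> U \<longrightarrow> plots (tot V) k W p \<longrightarrow>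
       (\<forall>w\<in>W. fst (q (h w)) = proj V (p w)) \<longrightarrow> Cinf_on k W (\<lambda>w. snd (q (h w)) (p w)))" (is "_ \<longleftrightarrow> ?pts \<and> ?base \<and> ?ev")
proof -
  let ?S = "\<lambda>U' p. {w. fst_part m w \<in> U \<and> snd_part m w \<in> U' \<and> fst (q (fst_part m w)) = proj V (p (snd_part m w))}"
  let ?f = "\<lambda>p w. snd (q (fst_part m w)) (p (snd_part m w))"
  have plots: "plots (tot (dual V)) m U q \<longleftrightarrow> ?pts \<and> ?base \<and>
     (\<forall>n U' p. plots (tot V) n U' p \<longrightarrow> dsmooth (subset_ds (euclid_ds (m + n)) (?S U' p)) real_ds (?f p))"
    by (simp add: dual_def comp_def)
  have "?ev" if *: "\<forall>n U' p. plots (tot V) n U' p \<longrightarrow> dsmooth (subset_ds (euclid_ds (m + n)) (?S U' p)) real_ds (?f p)"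
  proof (intro allI impI)
    fix k W h p
    assume h: "Cinf_map k W m h" "h ` W \<subseteq> U" and p: "plots (tot V) k W p"
      and eq: "\<forall>w\<in>W. fst (q (h w)) = proj V (p w)"
    \<comment> \<open>The point \<open>(h w, w)\<close> of the product, in concatenated coordinates:
      its first part is the parameter for \<open>q\<close>, its second the parameter for
      \<open>p\<close>.\<close>
    define c where "c w = (\<lambda>i. if i < m then h w i else w (i - m))" for w
    note W = Cinf_map_openin[OF h(1)]
    have hz: "h w i = 0" if "w \<in> W" "i \<ge> m" for w i
      using h(1) that by (auto simp: Cinf_map_def topspace_Euclidean_space image_subset_iff)
    have c1: "fst_part m (c w) = h w" if "w \<in> W" for w
      using hz[OF that] by (auto simp: fst_part_def c_def fun_eq_iff)
    have c2: "snd_part m (c w) = w" for w by (simp add: snd_part_def c_def fun_eq_iff)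
    have "Cinf_on k W (\<lambda>w. c w i)" for i
      unfolding c_def using Cinf_map_component[OF h(1)] Cinf_on_coordinate[OF W] by (cases "i < m") auto
    then have "Cinf_map k W (m + k) c"
      using W open_subset_Euclidean[OF W] by (auto simp: Cinf_map_def topspace_Euclidean_space c_def)
    moreover have "c ` W \<subseteq> ?S W p" using h(2) eq c1 c2 by auto
    moreover have "dsmooth (subset_ds (euclid_ds (m + k)) (?S W p)) real_ds (?f p)" using * p by blast
    ultimately have "Cinf_on k W (\<lambda>w. ?f p (c w))"
      unfolding dsmooth_real_iff by (simp add: euclid_ds_def)
    then show "Cinf_on k W (\<lambda>w. snd (q (h w)) (p w))"
      by (rule Cinf_on_cong[rotated]) (simp add: c1 c2)
  qed
  \<comment> \<open>Conversely, a smooth map into the product splits into two smooth parts: the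
    first reparametrizes \<open>q\<close>, the second pulls back the plot \<open>p\<close>.\<close>
  moreover have "dsmooth (subset_ds (euclid_ds (m + n)) (?S U' p)) real_ds (?f p)"
    if ev: ?ev and p: "plots (tot V) n U' p" for n U' p
    unfolding dsmooth_real_iff
  proof (intro allI impI)
    fix k W c assume "plots (euclid_ds (m + n)) k W c" and S: "c ` W \<subseteq> ?S U' p"
    then have c: "Cinf_map k W (m + n) c" by (simp add: euclid_ds_def)
    note W = Cinf_map_openin[OF c]
    have cz: "c w i = 0" if "w \<in> W" "i \<ge> m + n" for w i
      using c that by (auto simp: Cinf_map_def topspace_Euclidean_space image_subset_iff)
    have h: "Cinf_map k W m (\<lambda>w. fst_part m (c w))"
      using W Cinf_map_component[OF c] by (auto simp: Cinf_map_def topspace_Euclidean_space fst_part_def)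
    have h': "Cinf_map k W n (\<lambda>w. snd_part m (c w))"
      using W Cinf_map_component[OF c] cz by (auto simp: Cinf_map_def topspace_Euclidean_space snd_part_def)
    have "plots (tot V) k W (\<lambda>w. p (snd_part m (c w)))"
      using plot_compose[OF V p h'] S by auto
    then show "Cinf_on k W (\<lambda>w. ?f p (c w))"
      using ev[rule_format, OF h] S by auto
  qed
  ultimately show ?thesis unfolding plots by blast
qed

text \<open>With the evaluation condition tested along arbitrary smooth \<open>h\<close>,
  reparametrization of \<open>q\<close> is absorbed by composing with \<open>h\<close>, and local
  plots are joined because smoothness of the evaluation is local.\<close>

lemma diffeology_dual:
  assumes V: "diffeology (tot V)" and base: "diffeology (base V)"
  shows "diffeology (tot (dual V))"
proof (rule diffeologyI, unfold dual_simps(1))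
  note iff = dual_plot_iff[OF V]
  show "openin (Euclidean_space n) U" if "plots (tot (dual V)) n U p" for n U p
    using that plot_open[OF base] unfolding iff by blast
  show pts: "p u \<in> Sigma (points (base V)) (dual_space V)" if "plots (tot (dual V)) n U p" "u \<in> U" for n U p u
    using that unfolding iff by blast
  show "plots (tot (dual V)) n U q" if p: "plots (tot (dual V)) n U p" and eq: "\<And>u. u \<in> U \<Longrightarrow> p u = q u" for n U p q
    unfolding iff
  proof (intro conjI allI impI)
    show "q ` U \<subseteq> Sigma (points (base V)) (dual_space V)" using pts[OF p] eq by force
    have "plots (base V) n U (\<lambda>u. fst (p u))" using p unfolding iff by blast
    then show "plots (base V) n U (\<lambda>u. fst (q u))" by (rule plot_cong[OF base]) (simp add: eq)
    fix k W h r
    assume h: "Cinf_map k W n h" "h ` W \<subseteq> U" and r: "plots (tot V) k W r" "\<forall>w\<in>W. fst (q (h w)) = proj V (r w)"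
    have e: "p (h w) = q (h w)" if "w \<in> W" for w using eq h(2) that by blast
    have "Cinf_on k W (\<lambda>w. snd (p (h w)) (r w))"
      using p[unfolded iff, THEN conjunct2, THEN conjunct2, rule_format, OF h r(1)] r(2) e by simp
    then show "Cinf_on k W (\<lambda>w. snd (q (h w)) (r w))"
      by (rule Cinf_on_cong[rotated]) (simp add: e)
  qed
  show "plots (tot (dual V)) n U (\<lambda>_. a)" if U: "openin (Euclidean_space n) U" and a: "a \<in> Sigma (points (base V)) (dual_space V)" for n U a
    unfolding iff
  proof (intro conjI allI impI)
    show "(\<lambda>_. a) ` U \<subseteq> Sigma (points (base V)) (dual_space V)" using a by auto
    show "plots (base V) n U (\<lambda>u. fst a)" using plot_const[OF base U] a by auto
    fix k W h r
    assume r: "plots (tot V) k W r" "\<forall>w\<in>W. fst a = proj V (r w)"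
    have "snd a \<in> dual_space V (fst a)" using a by (metis SigmaE snd_conv fst_conv)
    moreover have "r ` W \<subseteq> fibre V (fst a)" using r plot_points[OF V r(1)] by (auto intro!: fibreI)
    ultimately show "Cinf_on k W (\<lambda>w. snd a (r w))"
      using r(1) unfolding dual_space_iff by blast
  qed
  show "plots (tot (dual V)) n U p" if U: "openin (Euclidean_space n) U" and loc: "locally_on n U (\<lambda>W. plots (tot (dual V)) n W p)" for n U p
    unfolding iff
  proof (intro conjI allI impI)
    have "p u \<in> Sigma (points (base V)) (dual_space V)" if "u \<in> U" for u
    proof (rule locally_onE[OF loc that])
      fix W assume "plots (tot (dual V)) n W p" "u \<in> W"
      then show ?thesis by (rule pts)
    qed
    then show "p ` U \<subseteq> Sigma (points (base V)) (dual_space V)" by blast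
    show "plots (base V) n U (\<lambda>u. fst (p u))"
      by (rule plot_locally[OF base U locally_on_mono[OF loc]]) (simp add: iff)
    fix k W h r
    assume h: "Cinf_map k W n h" "h ` W \<subseteq> U" and r: "plots (tot V) k W r" "\<forall>w\<in>W. fst (p (h w)) = proj V (r w)"
    show "Cinf_on k W (\<lambda>w. snd (p (h w)) (r w))"
    proof (rule Cinf_on_locally[OF Cinf_map_openin[OF h(1)] locally_on_pullback[OF loc h]])
      fix U' W' assume p: "plots (tot (dual V)) n U' p" and W': "openin (Euclidean_space k) W'" "W' \<subseteq> W" "h ` W' \<subseteq> U'"
      show "Cinf_on k W' (\<lambda>w. snd (p (h w)) (r w))"
        using p[unfolded iff, THEN conjunct2, THEN conjunct2, rule_format,
            OF Cinf_map_subset[OF h(1) W'(1,2)] W'(3) plot_subset[OF V r(1) W'(1,2)]] r(2) W'(2) by blast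
    qed
  qed
  show "plots (tot (dual V)) m W (\<lambda>x. p (h x))" if p: "plots (tot (dual V)) n U p" and h: "Cinf_map m W n h" "h ` W \<subseteq> U" for n U p m W h
    unfolding iff
  proof (intro conjI allI impI)
    show "(\<lambda>x. p (h x)) ` W \<subseteq> Sigma (points (base V)) (dual_space V)" using pts[OF p] h(2) by blast
    have "plots (base V) n U (\<lambda>u. fst (p u))" using p unfolding iff by blast
    from plot_compose[OF base this h] show "plots (base V) m W (\<lambda>u. fst (p (h u)))" .
    fix k W' h' r
    assume h': "Cinf_map k W' m h'" "h' ` W' \<subseteq> W" and r: "plots (tot V) k W' r" "\<forall>w\<in>W'. fst (p (h (h' w))) = proj V (r w)"
    have "(\<lambda>w. h (h' w)) ` W' \<subseteq> U" using h(2) h'(2) by blast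
    from p[unfolded iff, THEN conjunct2, THEN conjunct2, rule_format, OF Cinf_map_compose[OF h(1) h'] this r(1)] r(2)
    show "Cinf_on k W' (\<lambda>w. snd (p (h (h' w))) (r w))" by blast
  qed
qed


section \<open>Dual pseudo-metrics\<close>

text \<open>The ambient space for the dimension count: covectors become real functions, to which
  span and independence apply.\<close>

interpretation fun_vs: vector_space "\<lambda>c (f :: 'a \<Rightarrow> real) w. c * f w"
  by unfold_locales (auto simp: fun_eq_iff algebra_simps)

lemma ex1_eqI: "\<exists>!c. P c \<Longrightarrow> P a \<Longrightarrow> P b \<Longrightarrow> a = b"
  by blast

context
  fixes V :: "('v, 'x) pbundle" and x :: 'x
begin

definition dual_subspace :: "('x \<times> ('v \<Rightarrow> real)) set \<Rightarrow> bool" where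
  "dual_subspace C \<longleftrightarrow> C \<subseteq> Pair x ` extensional (fibre V x) \<and> vzero (dual V) x \<in> C \<and>
     (\<forall>a\<in>C. \<forall>b\<in>C. vadd (dual V) a b \<in> C) \<and> (\<forall>c. \<forall>a\<in>C. vscale (dual V) c a \<in> C)"

abbreviation dual_mod :: "('x \<times> ('v \<Rightarrow> real)) set \<Rightarrow> (real, 'x \<times> ('v \<Rightarrow> real)) module" where
  "dual_mod C \<equiv> fibre_mod (dual V) x\<lparr>carrier := C\<rparr>"

text \<open>Extension by zero. Extensional functions are \<open>undefined\<close> off the fibre and
  need not be closed under pointwise sums; after this embedding the operations of the dual are the
  pointwise ones.\<close>

definition covec :: "'x \<times> ('v \<Rightarrow> real) \<Rightarrow> 'v \<Rightarrow> real" where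
  "covec a w = (if w \<in> fibre V x then snd a w else 0)"

lemma covec_inject:
  assumes "dual_subspace C" "a \<in> C" "b \<in> C" "covec a = covec b"
  shows "a = b"
proof -
  obtain \<xi> \<eta> where e: "a = (x, \<xi>)" "b = (x, \<eta>)" "\<xi> \<in> extensional (fibre V x)" "\<eta> \<in> extensional (fibre V x)"
    using assms(1-3) unfolding dual_subspace_def by blast
  have "\<xi> w = \<eta> w" if "w \<in> fibre V x" for w
    using fun_cong[OF assms(4), of w] that by (simp add: covec_def e)
  then show ?thesis using e by (auto intro: extensionalityI)
qed

lemma dual_subspaceE:
  assumes "dual_subspace C" "a \<in> C"
  obtains \<xi> where "\<xi> \<in> extensional (fibre V x)" "a = (x, \<xi>)"
  using assms unfolding dual_subspace_def by blast

lemma dual_subspace_closed: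
  assumes "dual_subspace C"
  shows "vzero (dual V) x \<in> C" "a \<in> C \<Longrightarrow> b \<in> C \<Longrightarrow> vadd (dual V) a b \<in> C" "a \<in> C \<Longrightarrow> vscale (dual V) c a \<in> C"
  using assms unfolding dual_subspace_def by blast+

lemma covec_add:
  assumes "dual_subspace C" "a \<in> C" "b \<in> C"
  shows "covec (vadd (dual V) a b) = covec a + covec b"
  by (rule dual_subspaceE[OF assms(1,2)], rule dual_subspaceE[OF assms(1,3)]) (simp add: covec_def fun_eq_iff)

lemma covec_scale:
  assumes "dual_subspace C" "a \<in> C"
  shows "covec (vscale (dual V) c a) = (\<lambda>w. c * covec a w)"
  by (rule dual_subspaceE[OF assms]) (simp add: covec_def fun_eq_iff)

lemma covec_zero: "covec (vzero (dual V) x) = 0"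
  by (simp add: covec_def fun_eq_iff)

lemma dual_mod_simps:
  "carrier (dual_mod C) = C" "a \<oplus>\<^bsub>dual_mod C\<^esub> b = vadd (dual V) a b" "c \<odot>\<^bsub>dual_mod C\<^esub> a = vscale (dual V) c a"
  "\<zero>\<^bsub>dual_mod C\<^esub> = vzero (dual V) x"
  by (simp_all add: fibre_mod_def)

lemma dual_mod_monoid:
  assumes C: "dual_subspace C"
  shows "abelian_monoid (dual_mod C)"
proof -
  have eqI: "a = b" if "a \<in> C" "b \<in> C" "covec a = covec b" for a b
    by (rule covec_inject[OF C that])
  note zero = dual_subspace_closed(1)[OF C] and add = dual_subspace_closed(2)[OF C]
  show ?thesis
    by (rule abelian_monoidI; unfold dual_mod_simps)
      (rule add zero | assumption | rule eqI | simp add: add zero covec_add[OF C] covec_zero add_ac del: dual_simps)+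
qed

lemma covec_finsum:
  assumes C: "dual_subspace C" and "finite B" "\<And>b. b \<in> B \<Longrightarrow> f b \<in> C"
  shows "(\<Oplus>\<^bsub>dual_mod C\<^esub>b\<in>B. f b) \<in> C \<and> covec (\<Oplus>\<^bsub>dual_mod C\<^esub>b\<in>B. f b) = (\<Sum>b\<in>B. covec (f b))"
proof -
  interpret M: abelian_monoid "dual_mod C" by (rule dual_mod_monoid[OF C])
  show ?thesis
    using assms(2,3)
  proof (induction B rule: finite_induct)
    case empty
    show ?case using dual_subspace_closed(1)[OF C] covec_zero
      by (simp only: M.finsum_empty dual_mod_simps sum.empty simp_thms)
  next
    case (insert b B)
    then have "(\<Oplus>\<^bsub>dual_mod C\<^esub>b\<in>insert b B. f b) = vadd (dual V) (f b) (\<Oplus>\<^bsub>dual_mod C\<^esub>b\<in>B. f b)"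
      using M.finsum_insert[of B b f, unfolded dual_mod_simps] by (simp add: Pi_iff)
    moreover have "f b \<in> C" "(\<Oplus>\<^bsub>dual_mod C\<^esub>b\<in>B. f b) \<in> C"
      "covec (\<Oplus>\<^bsub>dual_mod C\<^esub>b\<in>B. f b) = (\<Sum>b\<in>B. covec (f b))" using insert by simp_all
    ultimately show ?case
      using insert.hyps by (simp only: dual_subspace_closed(2)[OF C] covec_add[OF C] sum.insert simp_thms)
  qed
qed

text \<open>Unique coordinates become independence and spanning under the map \<open>covec\<close>,
  which is linear and injective on \<open>C\<close>.\<close>

lemma dual_basis:
  assumes C: "dual_subspace C" and B: "vs_basis (dual_mod C) B"
  shows "fun_vs.independent (covec ` B)" "covec ` C \<subseteq> fun_vs.span (covec ` B)" "card (covec ` B) = card B"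
proof -
  note Bd = B[unfolded vs_basis_def dual_mod_simps]
  have fin: "finite B" and BC: "B \<subseteq> C" using conjunct1[OF Bd] conjunct1[OF conjunct2[OF Bd]] .
  note unique = Bd[THEN conjunct2, THEN conjunct2, rule_format]
  have inj: "inj_on covec B" by (rule inj_onI, rule covec_inject[OF C]) (use BC in auto)
  then show "card (covec ` B) = card B" by (rule card_image)
  have sc: "vscale (dual V) c b \<in> C" if "b \<in> B" for c b
    by (rule dual_subspace_closed(3)[OF C subsetD[OF BC that]])
  have sum: "(\<Oplus>\<^bsub>dual_mod C\<^esub>b\<in>B. vscale (dual V) (c b) b) \<in> C"
    "covec (\<Oplus>\<^bsub>dual_mod C\<^esub>b\<in>B. vscale (dual V) (c b) b) = (\<Sum>b\<in>B. (\<lambda>w. c b * covec b w))" for c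
  proof -
    have "(\<Sum>b\<in>B. covec (vscale (dual V) (c b) b)) = (\<Sum>b\<in>B. (\<lambda>w. c b * covec b w))"
      by (intro sum.cong refl covec_scale[OF C]) (use BC in auto)
    then show "(\<Oplus>\<^bsub>dual_mod C\<^esub>b\<in>B. vscale (dual V) (c b) b) \<in> C"
      "covec (\<Oplus>\<^bsub>dual_mod C\<^esub>b\<in>B. vscale (dual V) (c b) b) = (\<Sum>b\<in>B. (\<lambda>w. c b * covec b w))"
      using covec_finsum[OF C fin, of "\<lambda>b. vscale (dual V) (c b) b"] sc by auto
  qed
  show "covec ` C \<subseteq> fun_vs.span (covec ` B)"
  proof
    fix f assume "f \<in> covec ` C"
    then obtain a where a: "a \<in> C" "f = covec a" by blast
    from ex1_implies_ex[OF unique[OF a(1)]]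
    obtain c where "a = (\<Oplus>\<^bsub>dual_mod C\<^esub>b\<in>B. vscale (dual V) (c b) b)" by (elim exE conjE)
    then have "f = (\<Sum>b\<in>B. (\<lambda>w. c b * covec b w))" using a sum(2) by simp
    then show "f \<in> fun_vs.span (covec ` B)"
      by (simp only:) (intro fun_vs.span_sum fun_vs.span_scale fun_vs.span_base imageI)
  qed
  show "fun_vs.independent (covec ` B)"
  proof (rule fun_vs.independent_if_scalars_zero)
    fix u f assume u: "(\<Sum>f\<in>covec ` B. (\<lambda>w. u f * f w)) = 0" and f: "f \<in> covec ` B"
    note zero = dual_subspace_closed(1)[OF C]
    \<comment> \<open>The coefficients of a vanishing combination and the zero coefficients both
      represent zero, so uniqueness identifies them. They are restricted to \<open>B\<close> because
      uniqueness holds among extensional families.\<close>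
    have *: "vzero (dual V) x = (\<Oplus>\<^bsub>dual_mod C\<^esub>b\<in>B. vscale (dual V) (restrict c B b) b)"
      if "(\<Sum>b\<in>B. (\<lambda>w. c b * covec b w)) = 0" for c
    proof (rule covec_inject[OF C zero sum(1)])
      have "(\<Sum>b\<in>B. (\<lambda>w. restrict c B b * covec b w)) = (\<Sum>b\<in>B. (\<lambda>w. c b * covec b w))"
        by (rule sum.cong) auto
      then show "covec (vzero (dual V) x) = covec (\<Oplus>\<^bsub>dual_mod C\<^esub>b\<in>B. vscale (dual V) (restrict c B b) b)"
        unfolding sum(2) covec_zero by (simp add: that)
    qed
    have 1: "vzero (dual V) x = (\<Oplus>\<^bsub>dual_mod C\<^esub>b\<in>B. vscale (dual V) (restrict (\<lambda>b. u (covec b)) B b) b)"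
      using u by (intro *) (simp add: sum.reindex[OF inj])
    have 2: "vzero (dual V) x = (\<Oplus>\<^bsub>dual_mod C\<^esub>b\<in>B. vscale (dual V) (restrict (\<lambda>b. 0) B b) b)"
      by (intro *) (simp add: zero_fun_def[symmetric])
    define rep where "rep c \<longleftrightarrow> c \<in> extensional B \<and>
      vzero (dual V) x = (\<Oplus>\<^bsub>dual_mod C\<^esub>b\<in>B. vscale (dual V) (c b) b)" for c
    have ex1: "\<exists>!c. rep c" unfolding rep_def by (rule unique[OF zero])
    have "rep (restrict (\<lambda>b. u (covec b)) B)" "rep (restrict (\<lambda>b. 0) B)"
      unfolding rep_def using 1 2 by (blast intro: restrict_extensional)+
    from ex1_eqI[of rep, OF ex1 this] have "restrict (\<lambda>b. u (covec b)) B = restrict (\<lambda>b. 0) B" .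
    from fun_cong[OF this] have "u (covec b) = 0" if "b \<in> B" for b using that by (metis restrict_apply')
    then show "u f = 0" using f by blast
  qed (use fin in simp)
qed

text \<open>An element of \<open>C\<close> outside \<open>C'\<close> would extend a basis of
  \<open>C'\<close> to \<open>n + 1\<close> independent vectors inside a span of
  \<open>n\<close>.\<close>

lemma dual_subspace_eqI:
  assumes C: "dual_subspace C" "vs_dim (dual_mod C) n" and C': "dual_subspace C'" "vs_dim (dual_mod C') n"
    and sub: "C' \<subseteq> C"
  shows "C' = C"
proof -
  obtain B B' where B: "vs_basis (dual_mod C) B" "card B = n" and B': "vs_basis (dual_mod C') B'" "card B' = n"
    using C(2) C'(2) unfolding vs_dim_def by (elim exE conjE)
  note b = dual_basis[OF C(1) B(1)] and b' = dual_basis[OF C'(1) B'(1)]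
  have fin: "finite B" "finite B'" "B' \<subseteq> C'" using B(1) B'(1) by (auto simp: vs_basis_def dual_mod_simps)
  have "fun_vs.subspace (covec ` C')"
  proof (rule fun_vs.subspaceI)
    show "0 \<in> covec ` C'" using imageI[OF dual_subspace_closed(1)[OF C'(1)], of covec] by (simp only: covec_zero)
  next
    fix f g assume "f \<in> covec ` C'" "g \<in> covec ` C'"
    then show "f + g \<in> covec ` C'"
      by (elim imageE) (simp only: covec_add[OF C'(1), symmetric] dual_subspace_closed(2)[OF C'(1)] imageI)
  next
    fix c f assume "f \<in> covec ` C'"
    then show "(\<lambda>w. c * f w) \<in> covec ` C'"
      by (elim imageE) (simp only: covec_scale[OF C'(1), symmetric] dual_subspace_closed(3)[OF C'(1)] imageI)
  qed
  then have span: "fun_vs.span (covec ` B') \<subseteq> covec ` C'"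
    using fin(3) by (intro fun_vs.span_minimal) auto
  have "a \<in> C'" if a: "a \<in> C" for a
  proof (rule ccontr)
    assume "a \<notin> C'"
    have "covec a \<notin> fun_vs.span (covec ` B')"
    proof
      assume "covec a \<in> fun_vs.span (covec ` B')"
      then obtain b where "b \<in> C'" "covec a = covec b" using span by blast
      then show False using covec_inject[OF C(1) a] sub \<open>a \<notin> C'\<close> by blast
    qed
    then have na: "covec a \<notin> covec ` B'" by (rule contra_subsetD[OF fun_vs.span_superset])
    have "fun_vs.independent (insert (covec a) (covec ` B'))"
      using \<open>covec a \<notin> fun_vs.span (covec ` B')\<close> b'(1) by (simp add: fun_vs.independent_insert)
    moreover have "insert (covec a) (covec ` B') \<subseteq> fun_vs.span (covec ` B)"
      using a b(2) fin(3) sub by blast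
    ultimately have "card (insert (covec a) (covec ` B')) \<le> card (covec ` B)"
      using fun_vs.independent_span_bound fin(1) by blast
    then show False using na fin(2) b(3) b'(3) B(2) B'(2) by simp
  qed
  then show ?thesis using sub by blast
qed

end

section \<open>Pairings by a pseudo-metric and the value of the dual pseudo-metric\<close>

lemma fibre_closed_pseudo_bundle:
  assumes V: "pseudo_bundle V" and x: "x \<in> points (base V)"
  shows "fibre_closed V x"
proof -
  interpret M: Module.module real_fld "fibre_mod V x" using V x by (simp add: pseudo_bundle_def)
  have S: "carrier real_fld = UNIV" by (simp add: ring_of_type_algebra_def)
  have "carrier (fibre_mod V x) = fibre V x" "\<zero>\<^bsub>fibre_mod V x\<^esub> = vzero V x"
    "v \<oplus>\<^bsub>fibre_mod V x\<^esub> w = vadd V v w" "c \<odot>\<^bsub>fibre_mod V x\<^esub> v = vscale V c v" for v w c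
    by (simp_all add: fibre_mod_def)
  then show ?thesis
    using M.zero_closed M.a_closed M.smult_closed S unfolding fibre_closed_def by fastforce
qed

lemma dual_space_sum:
  assumes V: "diffeology (tot V)" "fibre_closed V x" "x \<in> points (base V)"
    and "finite S" "\<And>l. l \<in> S \<Longrightarrow> \<eta> l \<in> dual_space V x"
  shows "(\<lambda>w\<in>fibre V x. \<Sum>l\<in>S. c l * \<eta> l w) \<in> dual_space V x"
proof -
  note cl = fibre_closed_dual[OF V, unfolded fibre_closed_def]
  have fib: "fibre (dual V) x = Pair x ` dual_space V x" using V(3) by (simp add: fibre_dual)
  have add: "(\<lambda>w\<in>fibre V x. \<xi> w + \<eta> w) \<in> dual_space V x" if "\<xi> \<in> dual_space V x" "\<eta> \<in> dual_space V x" for \<xi> \<eta>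
  proof -
    have "vadd (dual V) (x, \<xi>) (x, \<eta>) \<in> fibre (dual V) x" using cl that unfolding fib by blast
    then show ?thesis by (auto simp: fib)
  qed
  have scale: "(\<lambda>w\<in>fibre V x. c * \<xi> w) \<in> dual_space V x" if "\<xi> \<in> dual_space V x" for \<xi> c
  proof -
    have "vscale (dual V) c (x, \<xi>) \<in> fibre (dual V) x" using cl that unfolding fib by blast
    then show ?thesis by (auto simp: fib)
  qed
  show ?thesis
    using assms(4,5)
  proof (induction S rule: finite_induct)
    case empty
    have "vzero (dual V) x \<in> fibre (dual V) x" using cl by blast
    then show ?case by (auto simp: fib restrict_def)
  next
    case (insert l S)
    then have "(\<lambda>w\<in>fibre V x. (\<lambda>w\<in>fibre V x. c l * \<eta> l w) w + (\<lambda>w\<in>fibre V x. \<Sum>l\<in>S. c l * \<eta> l w) w) \<in> dual_space V x"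
      by (intro add scale) auto
    also have "(\<lambda>w\<in>fibre V x. (\<lambda>w\<in>fibre V x. c l * \<eta> l w) w + (\<lambda>w\<in>fibre V x. \<Sum>l\<in>S. c l * \<eta> l w) w) =
        (\<lambda>w\<in>fibre V x. \<Sum>l\<in>insert l S. c l * \<eta> l w)"
      using insert.hyps by (auto simp: fun_eq_iff)
    finally show ?case .
  qed
qed

text \<open>\<open>tensor_form\<close> evaluates a representative made of two-letter words. For
  fixed \<open>v\<close> the result is a linear combination of the second letters, which are smooth
  covectors.\<close>

lemma pseudo_metric_form:
  assumes V: "pseudo_bundle V" and g: "pseudo_metric V g" and x: "x \<in> points (base V)" and v: "v \<in> fibre V x"
  shows "restrict (g x v) (fibre V x) \<in> dual_space V x"
proof -
  have dV: "diffeology (tot V)" "diffeology (base V)" using V by (auto simp: pseudo_bundle_def)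
  note closed = fibre_closed_pseudo_bundle[OF V]
  note closed_dual = fibre_closed_dual[OF dV(1) closed]
  obtain s where s: "dsmooth (base V) (tot (tensor_power 2 (dual V))) s"
    "proj (tensor_power 2 (dual V)) (s x) = x"
    "\<And>v w. v \<in> fibre V x \<Longrightarrow> w \<in> fibre V x \<Longrightarrow> g x v w = tensor_form (snd (s x)) v w"
    using g x unfolding pseudo_metric_def by blast
  obtain t where t: "s x = (x, t)" "t \<in> tensor_power_space 2 (dual V) x"
    using dsmooth_points[OF s(1) x] s(2) by (auto simp: tensor_power_def)
  define rep where "rep p \<longleftrightarrow> p \<in> t \<and> (\<forall>l\<in>Poly_Mapping.keys p. length l = 2)" for p
  obtain p0 where p0: "t = tens (dual V) x p0" "p0 \<in> homogeneous 2 (dual V) x"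
    using t(2) by (auto simp: tensor_power_space_eq)
  have "0 + p0 \<in> t" unfolding p0 tens_eq tensor_rels_span using pm.span_zero by blast
  then have "rep p0" using p0(2) by (auto simp: rep_def homogeneous_def)
  define p where "p = (SOME p. rep p)"
  have "rep p" unfolding p_def using \<open>rep p0\<close> by (rule someI)
  \<comment> \<open>The choice in \<open>tensor_form\<close> controls only the length of words. The
    chosen \<open>p\<close> differs from \<open>p0\<close> by a relation, so its letters still
    belong to the dual fibre.\<close>
  then obtain r where r: "r \<in> tensor_rels (dual V) x" "p = r + p0" by (auto simp: rep_def p0 tens_eq)
  have "p \<in> words (dual V) x"
    unfolding r(2) using r(1) tensor_rels_words[OF closed_dual[OF x x]] homogeneous_words[OF p0(2)]
    by (intro words_add) auto
  then have keys: "length l = 2" "l \<in> lists (fibre (dual V) x)" if "l \<in> Poly_Mapping.keys p" for l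
    using \<open>rep p\<close> that by (auto simp: rep_def words_def)
  have second: "snd (l ! 1) \<in> dual_space V x" if "l \<in> Poly_Mapping.keys p" for l
  proof -
    have "l ! 1 \<in> fibre (dual V) x" using keys[OF that] by (auto simp: in_lists_conv_set)
    then show ?thesis using x by (auto simp: fibre_dual)
  qed
  have "restrict (g x v) (fibre V x) =
      (\<lambda>w\<in>fibre V x. \<Sum>l\<in>Poly_Mapping.keys p. (Poly_Mapping.lookup p l * snd (l ! 0) v) * snd (l ! 1) w)"
    using s(3)[OF v] by (auto simp: t(1) tensor_form_def p_def rep_def fun_eq_iff Let_def)
  also have "\<dots> \<in> dual_space V x"
    by (rule dual_space_sum[OF dV(1) closed[OF x] x finite_keys, where \<eta> = "\<lambda>l. snd (l ! 1)"]) (rule second)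
  finally show ?thesis .
qed

text \<open>By the rank condition the pairing maps onto the dual fibre.\<close>

lemma pairing_surj:
  assumes V: "pseudo_bundle V" and g: "pseudo_metric V g" and x: "x \<in> points (base V)"
  shows "pairing V g ` fibre V x = Pair x ` dual_space V x"
proof -
  have dV: "diffeology (tot V)" using V by (auto simp: pseudo_bundle_def)
  note cl = fibre_closed_pseudo_bundle[OF V x, unfolded fibre_closed_def]
  note cld = fibre_closed_dual[OF dV fibre_closed_pseudo_bundle[OF V x] x, unfolded fibre_closed_def]
  let ?P = "pairing V g ` fibre V x" and ?D = "Pair x ` dual_space V x"
  have fib: "fibre (dual V) x = ?D" using x by (simp add: fibre_dual)
  have pair: "pairing V g v = (x, restrict (g x v) (fibre V x))" if "v \<in> fibre V x" for v
    using fibreD[OF that] by (simp add: pairing_def)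
  have sym: "g x v w = g x w v" if "v \<in> fibre V x" "w \<in> fibre V x" for v w
    using g x that unfolding pseudo_metric_def by blast
  \<comment> \<open>Linearity in the second argument is known from
    \<open>pseudo_metric_form\<close>; symmetry moves it to the first, which makes the image of the
    pairing a subspace.\<close>
  have lin: "g x (vadd V w w') v = g x w v + g x w' v" "g x (vscale V c w) v = c * g x w v"
    if v: "v \<in> fibre V x" and w: "w \<in> fibre V x" "w' \<in> fibre V x" for v w w' c
  proof -
    note form = pseudo_metric_form[OF V g x v, unfolded dual_space_iff]
    have in_fib: "vadd V w w' \<in> fibre V x" "vscale V c w \<in> fibre V x" using cl w by blast+
    have "restrict (g x v) (fibre V x) (vadd V w w') = restrict (g x v) (fibre V x) w + restrict (g x v) (fibre V x) w'"
      "restrict (g x v) (fibre V x) (vscale V c w) = c * restrict (g x v) (fibre V x) w"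
      using form w by blast+
    then show "g x (vadd V w w') v = g x w v + g x w' v" "g x (vscale V c w) v = c * g x w v"
      using in_fib v w by (simp_all add: sym[OF _ v])
  qed
  have D: "dual_subspace V x ?D"
    unfolding dual_subspace_def using cld[unfolded fib] by (auto simp: dual_space_iff)
  have PD: "?P \<subseteq> ?D" using pair pseudo_metric_form[OF V g x] by auto
  have P: "dual_subspace V x ?P"
    unfolding dual_subspace_def
  proof (intro conjI ballI allI)
    show "?P \<subseteq> Pair x ` extensional (fibre V x)" using pair by auto
    have add: "vadd (dual V) (pairing V g v) (pairing V g w) = pairing V g (vadd V v w)"
      if "v \<in> fibre V x" "w \<in> fibre V x" for v w
    proof -
      have "vadd V v w \<in> fibre V x" using cl that by blast
      then show ?thesis
        unfolding pair[OF that(1)] pair[OF that(2)] pair[OF \<open>vadd V v w \<in> fibre V x\<close>] dual_simps(4)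
        by (intro arg_cong[where f = "Pair x"] restrict_ext) (simp add: lin(1) that)
    qed
    have scale: "vscale (dual V) c (pairing V g v) = pairing V g (vscale V c v)" if "v \<in> fibre V x" for v c
    proof -
      have "vscale V c v \<in> fibre V x" using cl that by blast
      then show ?thesis
        unfolding pair[OF that] pair[OF \<open>vscale V c v \<in> fibre V x\<close>] dual_simps(5)
        by (intro arg_cong[where f = "Pair x"] restrict_ext) (simp add: lin(2) that)
    qed
    show "vadd (dual V) a b \<in> ?P" if "a \<in> ?P" "b \<in> ?P" for a b
      using that by (elim imageE) (use cl in \<open>simp only: add imageI\<close>)
    show sc: "vscale (dual V) c a \<in> ?P" if "a \<in> ?P" for a c
      using that by (elim imageE) (use cl in \<open>simp only: scale imageI\<close>)
    have z: "vzero V x \<in> fibre V x" using cl by blast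
    have "vzero (dual V) x = vscale (dual V) 0 (pairing V g (vzero V x))" by (simp add: pair[OF z])
    then show "vzero (dual V) x \<in> ?P" using sc[OF imageI[OF z]] by (simp only:)
  qed
  \<comment> \<open>Here the rank condition enters: the image of the pairing has the dimension of
    the whole dual fibre.\<close>
  obtain n where "vs_dim (fibre_mod (dual V) x) n" "vs_dim (dual_mod V x ?P) n"
    using g x unfolding pseudo_metric_def form_rank_def by blast
  moreover have "fibre_mod (dual V) x = dual_mod V x ?D" by (simp add: fibre_mod_def fib)
  ultimately show ?thesis using dual_subspace_eqI[OF D _ P _ PD, of n] by simp
qed

text \<open>The value is independent of the preimages picked by \<open>SOME\<close>: equal pairings
  mean equal forms in the first argument, and symmetry carries this over to the second.\<close>

lemma dual_metric_pairing:
  assumes sym: "\<And>v w. v \<in> fibre V x \<Longrightarrow> w \<in> fibre V x \<Longrightarrow> g x v w = g x w v"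
    and v: "v \<in> fibre V x" and w: "w \<in> fibre V x"
  shows "dual_metric V g x (pairing V g v) (pairing V g w) = g x v w"
proof -
  define c where "c \<xi> = (SOME v. v \<in> fibre V x \<and> pairing V g v = \<xi>)" for \<xi>
  have c: "c (pairing V g v) \<in> fibre V x \<and> pairing V g (c (pairing V g v)) = pairing V g v" if "v \<in> fibre V x" for v
  proof -
    have "\<exists>u. u \<in> fibre V x \<and> pairing V g u = pairing V g v" using that by blast
    from someI_ex[OF this] show ?thesis unfolding c_def .
  qed
  have eq: "g x a u = g x b u" if "pairing V g a = pairing V g b" "a \<in> fibre V x" "b \<in> fibre V x" "u \<in> fibre V x" for a b u
  proof -
    have "snd (pairing V g a) u = snd (pairing V g b) u" using that(1) by simp
    then show ?thesis using fibreD[OF that(2)] fibreD[OF that(3)] that(4) by (simp add: pairing_def)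
  qed
  have "g x (c (pairing V g v)) (c (pairing V g w)) = g x v (c (pairing V g w))"
    using c[OF v] c[OF w] v by (intro eq) simp_all
  also have "\<dots> = g x (c (pairing V g w)) v" by (rule sym[OF v conjunct1[OF c[OF w]]])
  also have "\<dots> = g x w v" using c[OF w] v w by (intro eq) simp_all
  also have "\<dots> = g x v w" using v w by (intro sym)
  finally show ?thesis by (simp add: dual_metric_def c_def)
qed

lemma fibre_points: "v \<in> fibre V x \<Longrightarrow> v \<in> points (tot V)" and fibre_proj: "v \<in> fibre V x \<Longrightarrow> proj V v = x"
  by (simp_all add: fibre_def preim_def)

section \<open>Restriction of covectors along a bundle map\<close>

lemma dual_points: "\<eta> \<in> points (tot (dual V)) \<longleftrightarrow> fst \<eta> \<in> points (base V) \<and> snd \<eta> \<in> dual_space V (fst \<eta>)"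
  by (cases \<eta>) simp

lemma dual_space_extensional: "\<xi> \<in> dual_space V x \<Longrightarrow> \<xi> \<in> extensional (fibre V x)"
  by (simp add: dual_space_iff)

lemma dual_space_add: "\<xi> \<in> dual_space V x \<Longrightarrow> v \<in> fibre V x \<Longrightarrow> w \<in> fibre V x \<Longrightarrow> \<xi> (vadd V v w) = \<xi> v + \<xi> w"
  and dual_space_scale: "\<xi> \<in> dual_space V x \<Longrightarrow> v \<in> fibre V x \<Longrightarrow> \<xi> (vscale V c v) = c * \<xi> v"
  and dual_space_plot: "\<xi> \<in> dual_space V x \<Longrightarrow> plots (tot V) k W p \<Longrightarrow> p ` W \<subseteq> fibre V x \<Longrightarrow> Cinf_on k W (\<lambda>w. \<xi> (p w))"
  by (simp_all add: dual_space_iff)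

lemma dual_plot_eval:
  assumes V: "diffeology (tot V)" and q: "plots (tot (dual V)) m U q" and h: "Cinf_map k W m h" "h ` W \<subseteq> U"
    and p: "plots (tot V) k W p" "\<And>w. w \<in> W \<Longrightarrow> fst (q (h w)) = proj V (p w)"
  shows "Cinf_on k W (\<lambda>w. snd (q (h w)) (p w))"
  using q[unfolded dual_plot_iff[OF V], THEN conjunct2, THEN conjunct2, rule_format, OF h p(1)] p(2) by blast

lemma dual_plot_base: "diffeology (tot V) \<Longrightarrow> plots (tot (dual V)) m U q \<Longrightarrow> plots (base V) m U (\<lambda>u. fst (q u))"
  by (simp only: dual_plot_iff)

lemma dual_plotI:
  assumes V: "diffeology (tot V)" and "\<And>u. u \<in> U \<Longrightarrow> q u \<in> points (tot (dual V))"
    and "plots (base V) m U (\<lambda>u. fst (q u))"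
    and "\<And>k W h p. Cinf_map k W m h \<Longrightarrow> h ` W \<subseteq> U \<Longrightarrow> plots (tot V) k W p \<Longrightarrow>
       (\<And>w. w \<in> W \<Longrightarrow> fst (q (h w)) = proj V (p w)) \<Longrightarrow> Cinf_on k W (\<lambda>w. snd (q (h w)) (p w))"
  shows "plots (tot (dual V)) m U q"
  unfolding dual_plot_iff[OF V]
proof (intro conjI allI impI)
  show "q ` U \<subseteq> Sigma (points (base V)) (dual_space V)"
    unfolding dual_simps(1)[symmetric] by (rule image_subsetI[OF assms(2)])
qed (use assms(3,4) in simp_all)

text \<open>Models the inclusion of either piece into a glued bundle. The pullback
  \<open>res\<close> of covectors is the precomposition from which the commutativity map is built;
  where \<open>j\<close> maps onto a fibre, covectors can also be carried forward.\<close>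

locale bundle_map =
  fixes W :: "('w, 'y) pbundle" and V :: "('v, 'x) pbundle" and j :: "'w \<Rightarrow> 'v" and i :: "'y \<Rightarrow> 'x"
  assumes tot_W: "diffeology (tot W)" and base_W: "diffeology (base W)"
    and tot_V: "diffeology (tot V)" and base_V: "diffeology (base V)"
    and closed_W: "x \<in> points (base W) \<Longrightarrow> fibre_closed W x"
    and map_plot: "plots (tot W) n U p \<Longrightarrow> plots (tot V) n U (\<lambda>u. j (p u))"
    and map_fibre: "w \<in> fibre W x \<Longrightarrow> j w \<in> fibre V (i x)"
    and map_add: "x \<in> points (base W) \<Longrightarrow> w \<in> fibre W x \<Longrightarrow> w' \<in> fibre W x \<Longrightarrow> vadd V (j w) (j w') = j (vadd W w w')"
    and map_scale: "x \<in> points (base W) \<Longrightarrow> w \<in> fibre W x \<Longrightarrow> vscale V c (j w) = j (vscale W c w)"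
begin

definition res :: "'y \<Rightarrow> ('v \<Rightarrow> real) \<Rightarrow> 'w \<Rightarrow> real" where
  "res x \<xi> = (\<lambda>w\<in>fibre W x. \<xi> (j w))"

lemma res_dual:
  assumes x: "x \<in> points (base W)" and \<xi>: "\<xi> \<in> dual_space V (i x)"
  shows "res x \<xi> \<in> dual_space W x"
  unfolding res_def
proof (rule dual_space_restrictI[OF closed_W[OF x]])
  show "\<xi> (j (vadd W v w)) = \<xi> (j v) + \<xi> (j w)" if "v \<in> fibre W x" "w \<in> fibre W x" for v w
    using that by (simp add: map_add[OF x, symmetric] dual_space_add[OF \<xi>] map_fibre)
  show "\<xi> (j (vscale W c v)) = c * \<xi> (j v)" if "v \<in> fibre W x" for c v
    using that by (simp add: map_scale[OF x, symmetric] dual_space_scale[OF \<xi>] map_fibre)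
  show "Cinf_on k U (\<lambda>w. \<xi> (j (p w)))" if "plots (tot W) k U p" "p ` U \<subseteq> fibre W x" for k U p
    using that by (intro dual_space_plot[OF \<xi> map_plot]) (auto intro: map_fibre)
qed

lemma res_ops:
  "res x (\<lambda>a\<in>fibre V (i x). \<xi> a + \<eta> a) = (\<lambda>w\<in>fibre W x. res x \<xi> w + res x \<eta> w)"
  "res x (\<lambda>a\<in>fibre V (i x). c * \<xi> a) = (\<lambda>w\<in>fibre W x. c * res x \<xi> w)"
  "res x (\<lambda>a\<in>fibre V (i x). 0) = (\<lambda>w\<in>fibre W x. 0)"
  unfolding res_def by (rule restrict_ext, simp add: map_fibre)+

text \<open>The base plot comes with a lift \<open>r\<close> to the base of \<open>W\<close>. Test
  plots of \<open>W\<close> are sent by \<open>j\<close> to test plots of \<open>V\<close>, where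
  the evaluation condition for \<open>q\<close> applies.\<close>

lemma res_plot:
  assumes q: "plots (tot (dual V)) m U q" and r: "plots (base W) m U r" "\<And>u. u \<in> U \<Longrightarrow> fst (q u) = i (r u)"
  shows "plots (tot (dual W)) m U (\<lambda>u. (r u, res (r u) (snd (q u))))"
proof (rule dual_plotI[OF tot_W])
  have qu: "snd (q u) \<in> dual_space V (i (r u))" if "u \<in> U" for u
    using plot_points[OF diffeology_dual[OF tot_V base_V] q that] r(2)[OF that] by (simp only: dual_points)
  have ru: "r u \<in> points (base W)" if "u \<in> U" for u by (rule plot_points[OF base_W r(1) that])
  show "(r u, res (r u) (snd (q u))) \<in> points (tot (dual W))" if "u \<in> U" for u
    using res_dual[OF ru[OF that] qu[OF that]] ru[OF that] by simp
  show "plots (base W) m U (\<lambda>u. fst (r u, res (r u) (snd (q u))))" using r(1) by simp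
  fix k U' h p
  assume h: "Cinf_map k U' m h" "h ` U' \<subseteq> U" and p: "plots (tot W) k U' p"
    and eq: "\<And>w. w \<in> U' \<Longrightarrow> fst (r (h w), res (r (h w)) (snd (q (h w)))) = proj W (p w)"
  have pw: "p w \<in> fibre W (r (h w))" if "w \<in> U'" for w
    using plot_points[OF tot_W p that] eq[OF that] by (simp add: fibreI)
  have hw: "h w \<in> U" if "w \<in> U'" for w using h(2) that by blast
  have "Cinf_on k U' (\<lambda>w. snd (q (h w)) (j (p w)))"
    by (rule dual_plot_eval[OF tot_V q h map_plot[OF p]]) (simp add: r(2) hw fibre_proj[OF map_fibre[OF pw]])
  then show "Cinf_on k U' (\<lambda>w. snd (r (h w), res (r (h w)) (snd (q (h w)))) (p w))"
    by (rule Cinf_on_cong[rotated]) (simp add: res_def pw)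
qed

text \<open>Where \<open>j\<close> covers the fibre, linearity can be checked on elements
  \<open>j w\<close>. Smoothness is left to the caller, because a plot in this fibre of a glued
  bundle may come from the other piece.\<close>

lemma extend_dual:
  assumes x: "x \<in> points (base W)" and \<zeta>: "\<zeta> \<in> dual_space W x" and closed: "fibre_closed V (i x)"
    and onto: "fibre V (i x) = j ` fibre W x"
    and val: "\<And>w. w \<in> fibre W x \<Longrightarrow> \<xi> (j w) = \<zeta> w"
    and smooth: "\<And>k U p. plots (tot V) k U p \<Longrightarrow> p ` U \<subseteq> fibre V (i x) \<Longrightarrow> Cinf_on k U (\<lambda>u. \<xi> (p u))"
  shows "restrict \<xi> (fibre V (i x)) \<in> dual_space V (i x)"
proof (rule dual_space_restrictI[OF closed])
  note cl = closed_W[OF x, unfolded fibre_closed_def]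
  show "\<xi> (vadd V a b) = \<xi> a + \<xi> b" if ab: "a \<in> fibre V (i x)" "b \<in> fibre V (i x)" for a b
  proof -
    obtain v w where e: "a = j v" "b = j w" "v \<in> fibre W x" "w \<in> fibre W x" using ab unfolding onto by blast
    have "vadd W v w \<in> fibre W x" using cl e by blast
    then show ?thesis using e(3,4) by (simp only: e(1,2) map_add[OF x e(3,4)] val dual_space_add[OF \<zeta>])
  qed
  show "\<xi> (vscale V c a) = c * \<xi> a" if a: "a \<in> fibre V (i x)" for c a
  proof -
    obtain v where e: "a = j v" "v \<in> fibre W x" using a unfolding onto by blast
    have "vscale W c v \<in> fibre W x" using cl e by blast
    then show ?thesis using e(2) by (simp only: e(1) map_scale[OF x e(2)] val dual_space_scale[OF \<zeta>])
  qed
qed (rule smooth)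

lemma res_eqI:
  assumes \<xi>: "\<xi> \<in> extensional (fibre V (i x))" and onto: "fibre V (i x) = j ` fibre W x"
    and val: "\<And>w. w \<in> fibre W x \<Longrightarrow> \<psi> (j w) = res x \<xi> w"
  shows "restrict \<psi> (fibre V (i x)) = \<xi>"
proof (rule extensionalityI[OF restrict_extensional \<xi>])
  fix a assume a: "a \<in> fibre V (i x)"
  then obtain w where "a = j w" "w \<in> fibre W x" unfolding onto by blast
  then show "restrict \<psi> (fibre V (i x)) a = \<xi> a" using a val by (simp add: res_def)
qed

text \<open>If \<open>u\<close> represents the restriction of a covector under the pairing of
  \<open>W\<close>, then \<open>j u\<close> represents the covector itself, since \<open>j\<close>
  is isometric and onto the fibre. Both dual metrics are thus computed from the same
  vectors.\<close>

lemma dual_metric_res: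
  assumes x: "x \<in> points (base W)" and onto: "fibre V (i x) = j ` fibre W x"
    and surj: "pairing W g ` fibre W x = Pair x ` dual_space W x"
    and sym: "\<And>v w. v \<in> fibre W x \<Longrightarrow> w \<in> fibre W x \<Longrightarrow> g x v w = g x w v"
    and iso: "\<And>v w. v \<in> fibre W x \<Longrightarrow> w \<in> fibre W x \<Longrightarrow> g' (i x) (j v) (j w) = g x v w"
    and \<xi>: "\<xi> \<in> dual_space V (i x)" and \<eta>: "\<eta> \<in> dual_space V (i x)"
  shows "dual_metric V g' (i x) (i x, \<xi>) (i x, \<eta>) = dual_metric W g x (x, res x \<xi>) (x, res x \<eta>)"
proof -
  have ex: "\<exists>v\<in>fibre W x. pairing W g v = (x, res x \<zeta>)" if "\<zeta> \<in> dual_space V (i x)" for \<zeta>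
    using res_dual[OF x that] surj by (metis imageE imageI)
  obtain v w where v: "v \<in> fibre W x" "pairing W g v = (x, res x \<xi>)"
    and w: "w \<in> fibre W x" "pairing W g w = (x, res x \<eta>)"
    using ex[OF \<xi>] ex[OF \<eta>] by blast
  have pair: "pairing V g' (j u) = (i x, \<zeta>)"
    if \<zeta>: "\<zeta> \<in> dual_space V (i x)" and u: "u \<in> fibre W x" "pairing W g u = (x, res x \<zeta>)" for u \<zeta>
  proof -
    have "restrict (g' (i x) (j u)) (fibre V (i x)) = \<zeta>"
    proof (rule res_eqI[OF dual_space_extensional[OF \<zeta>] onto])
      fix w assume w: "w \<in> fibre W x"
      have "snd (pairing W g u) w = res x \<zeta> w" by (simp add: u(2))
      then show "g' (i x) (j u) (j w) = res x \<zeta> w" using w u(1) by (simp add: pairing_def fibre_proj iso)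
    qed
    then show ?thesis using fibre_proj[OF map_fibre[OF u(1)]] by (simp add: pairing_def)
  qed
  have sym': "g' (i x) a b = g' (i x) b a" if ab: "a \<in> fibre V (i x)" "b \<in> fibre V (i x)" for a b
  proof -
    obtain v w where "a = j v" "b = j w" "v \<in> fibre W x" "w \<in> fibre W x" using ab unfolding onto by blast
    then show ?thesis using sym by (simp add: iso)
  qed
  have "dual_metric V g' (i x) (pairing V g' (j v)) (pairing V g' (j w)) = g' (i x) (j v) (j w)"
    by (rule dual_metric_pairing[where V = V and g = g' and x = "i x", OF sym' map_fibre[OF v(1)] map_fibre[OF w(1)]])
  also have "\<dots> = dual_metric W g x (pairing W g v) (pairing W g w)"
    unfolding iso[OF v(1) w(1)] by (rule dual_metric_pairing[where V = W and g = g and x = x, OF sym v(1) w(1), symmetric])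
  finally show ?thesis by (simp only: pair[OF \<xi> v] pair[OF \<eta> w] v(2) w(2))
qed

end


section \<open>Glued pseudo-bundles\<close>

text \<open>Closed fibres and fibrewise linear gluing data suffice to describe the glued bundle. In
  this form the description serves twice: for \<open>V1\<close> and \<open>V2\<close>, and in
  reversed order for their duals.\<close>

locale glue_setup =
  fixes V1 :: "('v1, 'x1) pbundle" and Y :: "'x1 set" and F :: "'v1 \<Rightarrow> 'v2" and f :: "'x1 \<Rightarrow> 'x2"
    and V2 :: "('v2, 'x2) pbundle"
  assumes tot1: "diffeology (tot V1)" and base1: "diffeology (base V1)"
    and tot2: "diffeology (tot V2)" and base2: "diffeology (base V2)"
    and proj1: "v \<in> points (tot V1) \<Longrightarrow> proj V1 v \<in> points (base V1)"
    and proj2: "w \<in> points (tot V2) \<Longrightarrow> proj V2 w \<in> points (base V2)"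
    and closed1: "x \<in> points (base V1) \<Longrightarrow> fibre_closed V1 x"
    and closed2: "x' \<in> points (base V2) \<Longrightarrow> fibre_closed V2 x'"
    and Y: "Y \<subseteq> points (base V1)"
    and f_in: "y \<in> Y \<Longrightarrow> f y \<in> points (base V2)"
    and F_in: "y \<in> Y \<Longrightarrow> v \<in> fibre V1 y \<Longrightarrow> F v \<in> fibre V2 (f y)"
    and F_add: "y \<in> Y \<Longrightarrow> v \<in> fibre V1 y \<Longrightarrow> v' \<in> fibre V1 y \<Longrightarrow> F (vadd V1 v v') = vadd V2 (F v) (F v')"
    and F_scale: "y \<in> Y \<Longrightarrow> v \<in> fibre V1 y \<Longrightarrow> F (vscale V1 c v) = vscale V2 c (F v)"
    and F_zero: "y \<in> Y \<Longrightarrow> F (vzero V1 y) = vzero V2 (f y)"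
begin

abbreviation "E \<equiv> preim V1 Y"
abbreviation "V \<equiv> glue_bundle V1 Y F f V2"
abbreviation "j1 \<equiv> inc1 E F"
abbreviation "j2 \<equiv> inc2 E F"
abbreviation "i1 \<equiv> inc1 Y f"
abbreviation "i2 \<equiv> inc2 Y f"

lemma in_E: "v \<in> points (tot V1) \<Longrightarrow> v \<in> E \<longleftrightarrow> proj V1 v \<in> Y"
  by (simp add: preim_def)

lemma fibre_E: "v \<in> fibre V1 x \<Longrightarrow> v \<in> E \<longleftrightarrow> x \<in> Y"
  by (auto simp: preim_def fibre_def)

lemma F_E: "v \<in> E \<Longrightarrow> F v \<in> fibre V2 (f (proj V1 v))"
  using F_in[of "proj V1 v" v] by (simp add: preim_def fibre_def)

lemma tot_V: "tot V = glue_ds (tot V1) E F (tot V2)" and base_V: "base V = glue_ds (base V1) Y f (base V2)"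
  by (simp_all add: glue_bundle_def Let_def)

lemma diff_tot: "diffeology (tot V)" and diff_base: "diffeology (base V)"
  unfolding tot_V base_V by (intro diffeology_glue tot1 tot2 base1 base2)+

lemma tot_cases:
  assumes "a \<in> points (tot V)"
  obtains v where "v \<in> points (tot V1)" "v \<notin> E" "a = j1 v" | w where "w \<in> points (tot V2)" "a = j2 w"
proof -
  have "F ` (E \<inter> points (tot V1)) \<subseteq> points (tot V2)"
    by (auto intro: fibre_points F_E)
  from assms[unfolded tot_V] this show thesis
    by (rule glue_cases) (rule that; assumption)+
qed

lemma base_cases:
  assumes "P \<in> points (base V)"
  obtains x where "x \<in> points (base V1)" "x \<notin> Y" "P = i1 x" | x where "x \<in> points (base V2)" "P = i2 x"
proof -
  have "f ` (Y \<inter> points (base V1)) \<subseteq> points (base V2)" using f_in by blast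
  from assms[unfolded base_V] this show thesis
    by (rule glue_cases) (rule that; assumption)+
qed

lemma j1_in: "v \<in> points (tot V1) \<Longrightarrow> j1 v \<in> points (tot V)" and j2_in: "w \<in> points (tot V2) \<Longrightarrow> j2 w \<in> points (tot V)"
  and i1_in: "x \<in> points (base V1) \<Longrightarrow> i1 x \<in> points (base V)" and i2_in: "x' \<in> points (base V2) \<Longrightarrow> i2 x' \<in> points (base V)"
  unfolding tot_V base_V by (simp_all add: inc1_points inc2_points)

lemma j1_E: "v \<in> E \<Longrightarrow> j1 v = j2 (F v)" and i1_Y: "x \<in> Y \<Longrightarrow> i1 x = i2 (f x)"
  by (simp_all add: inc1_glued)

lemma proj_j2: "w \<in> points (tot V2) \<Longrightarrow> proj V (j2 w) = i2 (proj V2 w)"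
  by (simp add: glue_bundle_def Let_def)

lemma proj_j1: "v \<in> points (tot V1) \<Longrightarrow> proj V (j1 v) = i1 (proj V1 v)"
proof (cases "v \<in> E")
  case True
  assume "v \<in> points (tot V1)"
  then have "proj V1 v \<in> Y" using True in_E by simp
  then show ?thesis
    using fibre_points[OF F_E[OF True]] fibre_proj[OF F_E[OF True]] by (simp add: j1_E[OF True] proj_j2 i1_Y)
qed (simp add: glue_bundle_def Let_def)

lemma vadd_j2: "v \<in> fibre V2 x \<Longrightarrow> w \<in> fibre V2 x \<Longrightarrow> vadd V (j2 v) (j2 w) = j2 (vadd V2 v w)"
  and vscale_j2: "v \<in> fibre V2 x \<Longrightarrow> vscale V c (j2 v) = j2 (vscale V2 c v)"
  by (simp_all add: glue_bundle_def Let_def fibre_points)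

lemma vzero_i2: "x \<in> points (base V2) \<Longrightarrow> vzero V (i2 x) = j2 (vzero V2 x)"
  by (simp add: glue_bundle_def Let_def)

text \<open>Over \<open>Y\<close> the sum is computed in \<open>V2\<close>; linearity of
  \<open>j1\<close> persists there because \<open>j1 v = j2 (F v)\<close> and \<open>F\<close> is
  additive.\<close>

lemma vadd_j1:
  assumes x: "x \<in> points (base V1)" and v: "v \<in> fibre V1 x" "w \<in> fibre V1 x"
  shows "vadd V (j1 v) (j1 w) = j1 (vadd V1 v w)"
proof (cases "x \<in> Y")
  case True
  have "vadd V1 v w \<in> fibre V1 x" using closed1[OF x] v by (simp add: fibre_closed_def)
  then have "vadd V1 v w \<in> E" "v \<in> E" "w \<in> E" using True v by (simp_all add: fibre_E)
  then show ?thesis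
    by (simp add: j1_E vadd_j2[OF F_in[OF True v(1)] F_in[OF True v(2)]] F_add[OF True v])
next
  case False
  then have "v \<notin> E" "w \<notin> E" "v \<in> points (tot V1)" "w \<in> points (tot V1)"
    using v by (simp_all add: fibre_E fibre_points)
  then show ?thesis by (simp add: glue_bundle_def Let_def)
qed

lemma vscale_j1:
  assumes x: "x \<in> points (base V1)" and v: "v \<in> fibre V1 x"
  shows "vscale V c (j1 v) = j1 (vscale V1 c v)"
proof (cases "x \<in> Y")
  case True
  have "vscale V1 c v \<in> fibre V1 x" using closed1[OF x] v by (simp add: fibre_closed_def)
  then have "vscale V1 c v \<in> E" "v \<in> E" using True v by (simp_all add: fibre_E)
  then show ?thesis
    by (simp add: j1_E vscale_j2[OF F_in[OF True v]] F_scale[OF True v])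
next
  case False
  then have "v \<notin> E" "v \<in> points (tot V1)"
    using v by (simp_all add: fibre_E fibre_points)
  then show ?thesis by (simp add: glue_bundle_def Let_def)
qed

lemma vzero_i1:
  assumes x: "x \<in> points (base V1)"
  shows "vzero V (i1 x) = j1 (vzero V1 x)"
proof (cases "x \<in> Y")
  case True
  have "vzero V1 x \<in> fibre V1 x" using closed1[OF x] by (simp add: fibre_closed_def)
  then show ?thesis using True by (simp add: i1_Y vzero_i2 f_in j1_E fibre_E F_zero)
next
  case False
  then show ?thesis using x by (simp add: glue_bundle_def Let_def)
qed

lemma j1_fibre: "v \<in> fibre V1 x \<Longrightarrow> j1 v \<in> fibre V (i1 x)"
  by (intro fibreI) (simp_all add: j1_in proj_j1 fibre_points fibre_proj)

lemma j2_fibre: "w \<in> fibre V2 x \<Longrightarrow> j2 w \<in> fibre V (i2 x)"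
  by (intro fibreI) (simp_all add: j2_in proj_j2 fibre_points fibre_proj)

text \<open>A point of the first piece outside \<open>E\<close> lies over a base point outside
  \<open>Y\<close>, hence never over \<open>i2 x\<close>.\<close>

lemma fibre_i2: "fibre V (i2 x) = j2 ` fibre V2 x"
proof (intro equalityI subsetI)
  fix a assume a: "a \<in> fibre V (i2 x)"
  from a have "a \<in> points (tot V)" by (rule fibre_points)
  then show "a \<in> j2 ` fibre V2 x"
  proof (cases rule: tot_cases)
    case (1 v)
    then have "i1 (proj V1 v) = i2 x" using fibre_proj[OF a] by (simp add: proj_j1)
    then have "proj V1 v \<in> Y" by (simp add: inc1_eq_inc2_iff)
    then show ?thesis using 1 by (simp add: in_E)
  next
    case (2 w)
    then have "i2 (proj V2 w) = i2 x" using fibre_proj[OF a] by (simp add: proj_j2)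
    then have "w \<in> fibre V2 x" using 2 by (intro fibreI) simp_all
    then show ?thesis unfolding 2 by (rule imageI)
  qed
qed (use j2_fibre in auto)

lemma fibre_i1: "x \<notin> Y \<Longrightarrow> fibre V (i1 x) = j1 ` fibre V1 x"
proof (intro equalityI subsetI)
  fix a assume x: "x \<notin> Y" and a: "a \<in> fibre V (i1 x)"
  from a have "a \<in> points (tot V)" by (rule fibre_points)
  then show "a \<in> j1 ` fibre V1 x"
  proof (cases rule: tot_cases)
    case (1 v)
    then have "i1 (proj V1 v) = i1 x" using fibre_proj[OF a] by (simp add: proj_j1)
    then have "proj V1 v = x" using x by (simp add: inc1_eq_iff)
    then have "v \<in> fibre V1 x" using 1 by (intro fibreI)
    then show ?thesis unfolding 1 by (rule imageI)
  next
    case (2 w)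
    then have "i1 x = i2 (proj V2 w)" using fibre_proj[OF a] by (simp add: proj_j2)
    then show ?thesis using x by (simp add: inc1_eq_inc2_iff)
  qed
qed (use j1_fibre in auto)

lemma closed_V:
  assumes "P \<in> points (base V)"
  shows "fibre_closed V P"
  using assms
proof (cases rule: base_cases)
  case (1 x)
  note cl = closed1[OF 1(1), unfolded fibre_closed_def]
  show ?thesis unfolding fibre_closed_def 1(3) fibre_i1[OF 1(2)]
    using cl by (auto simp: vzero_i1[OF 1(1)] vadd_j1[OF 1(1)] vscale_j1[OF 1(1)])
next
  case (2 x)
  note cl = closed2[OF 2(1), unfolded fibre_closed_def]
  show ?thesis unfolding fibre_closed_def 2(2) fibre_i2
    using cl by (auto simp: vzero_i2[OF 2(1)] vadd_j2[where x = x] vscale_j2[where x = x])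
qed

lemma glue_metric_j2:
  assumes "x \<in> points (base V2)" "v \<in> fibre V2 x" "w \<in> fibre V2 x"
  shows "glue_metric V1 Y F f V2 g1 g2 (i2 x) (j2 v) (j2 w) = g2 x v w"
  using assms by (simp add: fibre_points glue_metric_def Let_def)

lemma glue_metric_j1:
  assumes "x \<in> points (base V1)" "x \<notin> Y" "v \<in> fibre V1 x" "w \<in> fibre V1 x"
  shows "glue_metric V1 Y F f V2 g1 g2 (i1 x) (j1 v) (j1 w) = g1 x v w"
  using assms by (simp add: fibre_points glue_metric_def Let_def fibre_E)

lemma j1_plot: "plots (tot V1) n U p \<Longrightarrow> plots (tot V) n U (\<lambda>u. j1 (p u))"
  and j2_plot: "plots (tot V2) n U q \<Longrightarrow> plots (tot V) n U (\<lambda>u. j2 (q u))"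
  and i1_plot: "plots (base V1) n U r \<Longrightarrow> plots (base V) n U (\<lambda>u. i1 (r u))"
  and i2_plot: "plots (base V2) n U s \<Longrightarrow> plots (base V) n U (\<lambda>u. i2 (s u))"
  unfolding tot_V base_V by (rule inc1_plot inc2_plot tot1 tot2 base1 base2 | assumption)+

text \<open>Both cases have to be treated even in a fibre over the glued part: there a local lift
  may go through either piece.\<close>

lemma Cinf_on_glue_plot:
  assumes p: "plots (tot V) n U p"
    and 1: "\<And>W q. openin (Euclidean_space n) W \<Longrightarrow> W \<subseteq> U \<Longrightarrow> plots (tot V1) n W q \<Longrightarrow> (\<And>u. u \<in> W \<Longrightarrow> p u = j1 (q u)) \<Longrightarrow> Cinf_on n W \<psi>"
    and 2: "\<And>W q. openin (Euclidean_space n) W \<Longrightarrow> W \<subseteq> U \<Longrightarrow> plots (tot V2) n W q \<Longrightarrow> (\<And>u. u \<in> W \<Longrightarrow> p u = j2 (q u)) \<Longrightarrow> Cinf_on n W \<psi>"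
  shows "Cinf_on n U \<psi>"
proof -
  have U: "openin (Euclidean_space n) U" and loc: "locally_on n U (glue_lift (tot V1) E F (tot V2) n p)"
    using p unfolding tot_V glue_plots_iff[OF tot1 tot2] by blast+
  show ?thesis
  proof (rule Cinf_on_locally[OF U locally_on_mono[OF loc]])
    fix W assume W: "openin (Euclidean_space n) W" "W \<subseteq> U" and "glue_lift (tot V1) E F (tot V2) n p W"
    then consider q where "plots (tot V1) n W q" "\<forall>u\<in>W. p u = j1 (q u)" | q where "plots (tot V2) n W q" "\<forall>u\<in>W. p u = j2 (q u)"
      unfolding glue_lift_def by blast
    then show "Cinf_on n W \<psi>"
      by cases (use assms(2,3)[OF W] in blast)+
  qed
qed

sublocale fst: bundle_map V1 V j1 i1
  by unfold_locales (rule tot1 base1 diff_tot diff_base closed1 j1_plot j1_fibre vadd_j1 vscale_j1 | assumption)+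

sublocale snd: bundle_map V2 V j2 i2
  by unfold_locales (rule tot2 base2 diff_tot diff_base closed2 j2_plot j2_fibre vadd_j2 vscale_j2 | assumption)+

end

section \<open>The gluing-dual commutativity isomorphism\<close>

locale metric_gluing =
  fixes V1 :: "('v1, 'x1) pbundle" and V2 :: "('v2, 'x2) pbundle"
    and Y :: "'x1 set" and f :: "'x1 \<Rightarrow> 'x2" and F :: "'v1 \<Rightarrow> 'v2"
    and g1 :: "'x1 \<Rightarrow> 'v1 \<Rightarrow> 'v1 \<Rightarrow> real" and g2 :: "'x2 \<Rightarrow> 'v2 \<Rightarrow> 'v2 \<Rightarrow> real"
  assumes V1: "pseudo_bundle V1" and V2: "pseudo_bundle V2"
    and gluing: "gluing V1 Y F f V2"
    and f_diffeo: "diffeomorphism (subset_ds (base V1) Y) (subset_ds (base V2) (f ` Y)) f"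
    and lift_diffeo: "diffeomorphism (subset_ds (tot (dual V2)) (preim (dual V2) (f ` Y)))
           (subset_ds (tot (dual V1)) (dual_lift V1 Y F f ` preim (dual V2) (f ` Y)))
           (dual_lift V1 Y F f)"
    and g1: "pseudo_metric V1 g1" and g2: "pseudo_metric V2 g2"
    and compatible: "compatible V1 Y F f g1 g2"
begin

abbreviation "L \<equiv> dual_lift V1 Y F f"
abbreviation "f' \<equiv> inv_into Y f"

lemma diffeologies: "diffeology (tot V1)" "diffeology (base V1)" "diffeology (tot V2)" "diffeology (base V2)"
  using V1 V2 by (simp_all add: pseudo_bundle_def)

lemma Y: "Y \<subseteq> points (base V1)" and f_in: "y \<in> Y \<Longrightarrow> f y \<in> points (base V2)"
  using gluing by (auto simp: gluing_def dsmooth_def subset_ds_def)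

lemma f_inj: "inj_on f Y"
  using f_diffeo Y by (auto simp: diffeomorphism_def bij_betw_def subset_ds_def Int_absorb1)

lemma f'_f: "y \<in> Y \<Longrightarrow> f' (f y) = y"
  using f_inj by simp

lemma F_lin: "y \<in> Y \<Longrightarrow> lin_map (fibre_mod V1 y) (fibre_mod V2 (f y)) F"
  using gluing by (simp add: gluing_def)

lemma proj_points:
  assumes "pseudo_bundle V" "v \<in> points (tot V)"
  shows "proj V v \<in> points (base V)"
  by (rule dsmooth_points[OF _ assms(2)]) (use assms(1) in \<open>simp add: pseudo_bundle_def\<close>)

lemma F_in: "y \<in> Y \<Longrightarrow> v \<in> fibre V1 y \<Longrightarrow> F v \<in> fibre V2 (f y)"
  and F_add: "y \<in> Y \<Longrightarrow> v \<in> fibre V1 y \<Longrightarrow> v' \<in> fibre V1 y \<Longrightarrow> F (vadd V1 v v') = vadd V2 (F v) (F v')"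
  and F_scale: "y \<in> Y \<Longrightarrow> v \<in> fibre V1 y \<Longrightarrow> F (vscale V1 c v) = vscale V2 c (F v)"
  using F_lin[of y] by (auto simp: lin_map_def fibre_mod_def)

lemma scale_zero:
  assumes V: "pseudo_bundle V" and x: "x \<in> points (base V)" and v: "v \<in> fibre V x"
  shows "vscale V 0 v = vzero V x"
proof -
  interpret M: Module.module real_fld "fibre_mod V x" using V x by (simp add: pseudo_bundle_def)
  have "\<zero>\<^bsub>real_fld\<^esub> = (0::real)" by (simp add: ring_of_type_algebra_def)
  then show ?thesis using M.smult_l_null[of v] v by (simp add: fibre_mod_def)
qed

text \<open>\<open>lin_map\<close> has no clause for zero vectors; a zero vector is recovered as
  \<open>0\<close> times any element of its fibre.\<close>

lemma F_zero: "y \<in> Y \<Longrightarrow> F (vzero V1 y) = vzero V2 (f y)"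
proof -
  assume y: "y \<in> Y"
  have y1: "y \<in> points (base V1)" using y Y by blast
  have z: "vzero V1 y \<in> fibre V1 y" using fibre_closed_pseudo_bundle[OF V1 y1] by (simp add: fibre_closed_def)
  have "F (vscale V1 0 (vzero V1 y)) = vscale V2 0 (F (vzero V1 y))" by (rule F_scale[OF y z])
  then show ?thesis by (simp add: scale_zero[OF V1 y1 z] scale_zero[OF V2 f_in[OF y] F_in[OF y z]])
qed

lemma F_plot:
  assumes "plots (tot V1) k W p" "p ` W \<subseteq> preim V1 Y"
  shows "plots (tot V2) k W (\<lambda>w. F (p w))"
proof -
  have "dsmooth (subset_ds (tot V1) (preim V1 Y)) (tot V2) F" using gluing by (simp add: gluing_def)
  from dsmooth_plot[OF this, of k W p] show ?thesis using assms by (simp add: subset_ds_def)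
qed

sublocale G: glue_setup V1 Y F f V2
  by unfold_locales
    (rule diffeologies proj_points[OF V1] proj_points[OF V2] fibre_closed_pseudo_bundle[OF V1]
      fibre_closed_pseudo_bundle[OF V2] Y f_in F_in F_add F_scale F_zero | assumption)+

lemma L_eq: "y \<in> Y \<Longrightarrow> L (f y, \<xi>) = (y, \<lambda>v\<in>fibre V1 y. \<xi> (F v))"
  by (simp add: dual_lift_def Let_def f'_f)

lemma L_dual:
  assumes y: "y \<in> Y" and \<xi>: "\<xi> \<in> dual_space V2 (f y)"
  shows "(\<lambda>v\<in>fibre V1 y. \<xi> (F v)) \<in> dual_space V1 y"
proof (rule dual_space_restrictI)
  have y1: "y \<in> points (base V1)" using y Y by blast
  show "fibre_closed V1 y" by (rule fibre_closed_pseudo_bundle[OF V1 y1])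
  show "\<xi> (F (vadd V1 v w)) = \<xi> (F v) + \<xi> (F w)" if "v \<in> fibre V1 y" "w \<in> fibre V1 y" for v w
    using that by (simp add: F_add[OF y] dual_space_add[OF \<xi>] F_in[OF y])
  show "\<xi> (F (vscale V1 c v)) = c * \<xi> (F v)" if "v \<in> fibre V1 y" for c v
    using that by (simp add: F_scale[OF y] dual_space_scale[OF \<xi>] F_in[OF y])
  fix k W p assume p: "plots (tot V1) k W p" "p ` W \<subseteq> fibre V1 y"
  have "p ` W \<subseteq> preim V1 Y" using p(2) y by (auto simp: fibre_def preim_def)
  then show "Cinf_on k W (\<lambda>w. \<xi> (F (p w)))"
    using p(2) by (intro dual_space_plot[OF \<xi> F_plot[OF p(1)]]) (auto intro: F_in[OF y])
qed

section \<open>The dual lift as a bijection onto the covectors over Y, with smooth inverse\<close>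

abbreviation "E' \<equiv> preim (dual V2) (f ` Y)"

lemma E'_iff: "\<eta> \<in> E' \<longleftrightarrow> (\<exists>y\<in>Y. \<exists>\<xi>\<in>dual_space V2 (f y). \<eta> = (f y, \<xi>))"
  using f_in by (auto simp: preim_def)

lemma points_E': "points (subset_ds (tot (dual V2)) E') = E'"
  by (auto simp: subset_ds_def preim_def)

lemma L_inj: "inj_on L E'"
  using lift_diffeo unfolding diffeomorphism_def points_E' bij_betw_def by blast

text \<open>Compatible pseudo-metrics force the dual lift to be fibrewise onto.\<close>

lemma L_pairing: "y \<in> Y \<Longrightarrow> v \<in> fibre V1 y \<Longrightarrow> L (pairing V2 g2 (F v)) = pairing V1 g1 v"
proof -
  assume y: "y \<in> Y" and v: "v \<in> fibre V1 y"
  have "(\<lambda>w\<in>fibre V1 y. (\<lambda>w\<in>fibre V2 (f y). g2 (f y) (F v) w) (F w)) = (\<lambda>w\<in>fibre V1 y. g1 y v w)"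
    using compatible y v F_in[OF y] by (intro restrict_ext) (simp add: compatible_def)
  then show ?thesis
    by (simp add: pairing_def fibre_proj[OF v] fibre_proj[OF F_in[OF y v]] L_eq[OF y])
qed

lemma pairing2_in: "x \<in> points (base V2) \<Longrightarrow> v \<in> fibre V2 x \<Longrightarrow> \<exists>\<xi>\<in>dual_space V2 x. pairing V2 g2 v = (x, \<xi>)"
  using pairing_surj[OF V2 g2, of x] by blast

lemma L_image: "L ` E' = preim (dual V1) Y"
proof (intro equalityI subsetI)
  fix \<eta> assume "\<eta> \<in> L ` E'"
  then obtain \<eta>' where "\<eta>' \<in> E'" "\<eta> = L \<eta>'" by blast
  then obtain y \<xi> where "y \<in> Y" "\<xi> \<in> dual_space V2 (f y)" "\<eta> = L (f y, \<xi>)" unfolding E'_iff by blast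
  then show "\<eta> \<in> preim (dual V1) Y" using Y L_dual by (auto simp: preim_def L_eq)
next
  fix \<eta> assume \<eta>: "\<eta> \<in> preim (dual V1) Y"
  define y where "y = fst \<eta>"
  have y: "y \<in> Y" "y \<in> points (base V1)" "\<eta> \<in> Pair y ` dual_space V1 y"
    using \<eta> by (auto simp: preim_def y_def)
  then obtain v where v: "v \<in> fibre V1 y" "\<eta> = pairing V1 g1 v" using pairing_surj[OF V1 g1 y(2)] by blast
  obtain \<xi> where \<xi>: "\<xi> \<in> dual_space V2 (f y)" "pairing V2 g2 (F v) = (f y, \<xi>)"
    using pairing2_in[OF f_in[OF y(1)] F_in[OF y(1) v(1)]] by blast
  then have "pairing V2 g2 (F v) \<in> E'" unfolding E'_iff using y(1) by blast
  then show "\<eta> \<in> L ` E'" unfolding v(2) L_pairing[OF y(1) v(1), symmetric] by (rule imageI)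
qed

definition L' :: "'x1 \<times> ('v1 \<Rightarrow> real) \<Rightarrow> 'x2 \<times> ('v2 \<Rightarrow> real)" where
  "L' = inv_into E' L"

lemma L'_L: "\<eta> \<in> E' \<Longrightarrow> L' (L \<eta>) = \<eta>"
  unfolding L'_def by (rule inv_into_f_f[OF L_inj])

lemma L'_in: "\<eta> \<in> preim (dual V1) Y \<Longrightarrow> L' \<eta> \<in> E' \<and> L (L' \<eta>) = \<eta>"
  unfolding L'_def L_image[symmetric] by (simp add: inv_into_into f_inv_into_f)

lemma L'_spec:
  assumes "x \<in> Y" "\<zeta> \<in> dual_space V1 x"
  obtains \<xi> where "\<xi> \<in> dual_space V2 (f x)" "L' (x, \<zeta>) = (f x, \<xi>)" "\<zeta> = (\<lambda>v\<in>fibre V1 x. \<xi> (F v))"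
proof -
  have "(x, \<zeta>) \<in> preim (dual V1) Y" using assms Y by (auto simp: preim_def)
  note L' = L'_in[OF this]
  then obtain y \<xi> where e: "y \<in> Y" "\<xi> \<in> dual_space V2 (f y)" "L' (x, \<zeta>) = (f y, \<xi>)" unfolding E'_iff by blast
  have "(y, \<lambda>v\<in>fibre V1 y. \<xi> (F v)) = L (L' (x, \<zeta>))" unfolding e(3) L_eq[OF e(1)] ..
  also have "\<dots> = (x, \<zeta>)" using L' by blast
  finally have eq: "y = x \<and> (\<lambda>v\<in>fibre V1 y. \<xi> (F v)) = \<zeta>" by (rule iffD1[OF prod.inject])
  note yx = conjunct1[OF eq]
  show thesis by (rule that[OF e(2,3)[unfolded yx] conjunct2[OF eq, unfolded yx, symmetric]])
qed

text \<open>The hypothesis makes the inverse smooth on the image of \<open>L\<close>. By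
  \<open>L_image\<close> this image contains every covector over \<open>Y\<close>, so any plot lying
  over \<open>Y\<close> may be lifted.\<close>

lemma L'_plot:
  assumes q: "plots (tot (dual V1)) k W q" "\<And>w. w \<in> W \<Longrightarrow> fst (q w) \<in> Y"
  shows "plots (tot (dual V2)) k W (\<lambda>w. L' (q w))"
proof -
  have "q ` W \<subseteq> L ` E'"
    unfolding L_image
  proof (rule image_subsetI)
    fix w assume "w \<in> W"
    then show "q w \<in> preim (dual V1) Y"
      using plot_points[OF diffeology_dual[OF diffeologies(1,2)] q(1)] q(2) by (simp add: preim_def del: dual_simps(1))
  qed
  then have "plots (subset_ds (tot (dual V1)) (L ` E')) k W q" using q(1) by (simp add: subset_ds_def)
  moreover have "dsmooth (subset_ds (tot (dual V1)) (L ` E')) (subset_ds (tot (dual V2)) E') L'"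
    using lift_diffeo unfolding diffeomorphism_def points_E' L'_def by blast
  ultimately have "plots (subset_ds (tot (dual V2)) E') k W (\<lambda>w. L' (q w))" by (rule dsmooth_plot[rotated])
  then show ?thesis by (simp add: subset_ds_def)
qed

lemma dual1: "diffeology (tot (dual V1))" and dual2: "diffeology (tot (dual V2))"
  using diffeologies by (simp_all add: diffeology_dual)

lemma closed_dual1: "x \<in> points (base V1) \<Longrightarrow> fibre_closed (dual V1) x"
  and closed_dual2: "x' \<in> points (base V2) \<Longrightarrow> fibre_closed (dual V2) x'"
  using fibre_closed_dual[OF diffeologies(1) G.closed1] fibre_closed_dual[OF diffeologies(3) G.closed2] by blast+

text \<open>The roles are reversed: \<open>H.j1\<close> includes \<open>dual V2\<close> and
  \<open>H.j2\<close> includes \<open>dual V1\<close>, likewise \<open>H.i1\<close> and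
  \<open>H.i2\<close> for the bases. Glued covectors are represented in
  \<open>dual V1\<close>.\<close>

sublocale H: glue_setup "dual V2" "f ` Y" L f' "dual V1"
proof unfold_locales
  show "f ` Y \<subseteq> points (base (dual V2))" using f_in by auto
  fix y' assume "y' \<in> f ` Y"
  then obtain y where y: "y \<in> Y" "y' = f y" by blast
  then have y1: "y \<in> points (base V1)" using Y by blast
  note fib = fibre_dual[of V1 y] fibre_dual[of V2 "f y"]
  show "f' y' \<in> points (base (dual V1))" using y y1 by (simp add: f'_f)
  show "L (vzero (dual V2) y') = vzero (dual V1) (f' y')"
    using F_in[OF y(1)] by (auto simp: y f'_f L_eq intro!: restrict_ext)
  fix \<eta> assume "\<eta> \<in> fibre (dual V2) y'"
  then obtain \<xi> where \<xi>: "\<eta> = (f y, \<xi>)" "\<xi> \<in> dual_space V2 (f y)" using f_in[OF y(1)] by (auto simp: fib y)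
  show "L \<eta> \<in> fibre (dual V1) (f' y')" using y1 L_dual[OF y(1) \<xi>(2)] by (simp add: \<xi> y f'_f L_eq fib)
  show "L (vscale (dual V2) c \<eta>) = vscale (dual V1) c (L \<eta>)" for c
    using F_in[OF y(1)] by (auto simp: y \<xi> L_eq intro!: restrict_ext)
  fix \<eta>' assume "\<eta>' \<in> fibre (dual V2) y'"
  then obtain \<xi>' where \<xi>': "\<eta>' = (f y, \<xi>')" using f_in[OF y(1)] by (auto simp: fib y)
  show "L (vadd (dual V2) \<eta> \<eta>') = vadd (dual V1) (L \<eta>) (L \<eta>')"
    using F_in[OF y(1)] by (auto simp: y \<xi> \<xi>' L_eq intro!: restrict_ext)
qed (simp_all add: diffeologies dual1 dual2 closed_dual1 closed_dual2 mem_Times_iff split_beta del: dual_simps(1) add: dual_points)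

section \<open>The commutativity map in uniform formulas, and its inverse\<close>

abbreviation "A \<equiv> dual G.V"
abbreviation "B \<equiv> H.V"
abbreviation "\<Phi> \<equiv> gluing_dual_comm V1 Y F f V2"

lemma B_eq: "glue_dual V1 Y F f V2 = B"
  by (simp add: glue_dual_def)

abbreviation "r1 \<equiv> G.fst.res"
abbreviation "r2 \<equiv> G.snd.res"
lemmas r1_def = G.fst.res_def and r2_def = G.snd.res_def
lemmas r1_in = G.fst.res_dual and r2_in = G.snd.res_dual

text \<open>Over the image of \<open>Y\<close> the definition uses \<open>L\<close> followed by
  \<open>H.j2\<close>. The target gluing identifies this with \<open>H.j1\<close> of the covector,
  so one formula holds on the whole second piece.\<close>

lemma comm_i2:
  assumes x: "x \<in> points (base V2)" and \<xi>: "\<xi> \<in> dual_space G.V (G.i2 x)"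
  shows "\<Phi> (G.i2 x, \<xi>) = H.j1 (x, r2 x \<xi>)"
proof (cases "x \<in> f ` Y")
  case True
  have "(x, r2 x \<xi>) \<in> E'" using True x r2_in[OF x \<xi>] by (auto simp: preim_def)
  then show ?thesis using True x by (simp add: gluing_dual_comm_def Let_def r2_def H.j1_E)
qed (use x in \<open>simp add: gluing_dual_comm_def Let_def r2_def\<close>)

text \<open>Holds on the whole first piece, including \<open>Y\<close>, where the definition works
  through \<open>V2\<close> and \<open>L\<close>.\<close>

lemma comm_i1:
  assumes x: "x \<in> points (base V1)" and \<xi>: "\<xi> \<in> dual_space G.V (G.i1 x)"
  shows "\<Phi> (G.i1 x, \<xi>) = H.j2 (x, r1 x \<xi>)"
proof (cases "x \<in> Y")
  case True
  have i1: "G.i1 x = G.i2 (f x)" by (rule G.i1_Y[OF True])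
  have \<xi>': "\<xi> \<in> dual_space G.V (G.i2 (f x))" using \<xi> by (simp add: i1)
  have "(f x, r2 (f x) \<xi>) \<in> E'" unfolding E'_iff using True r2_in[OF f_in[OF True] \<xi>'] by blast
  then have "\<Phi> (G.i1 x, \<xi>) = H.j2 (L (f x, r2 (f x) \<xi>))" by (simp add: i1 comm_i2[OF f_in[OF True] \<xi>'] H.j1_E)
  \<comment> \<open>Restricting to \<open>V2\<close> and then pulling back along \<open>F\<close> is
    the restriction to \<open>V1\<close>, since \<open>G.j1 v = G.j2 (F v)\<close> over
    \<open>Y\<close>.\<close>
  also have "L (f x, r2 (f x) \<xi>) = (x, r1 x \<xi>)"
    using F_in[OF True] True by (auto simp: L_eq r1_def r2_def G.j1_E G.fibre_E intro!: restrict_ext)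
  finally show ?thesis .
qed (use x in \<open>simp add: gluing_dual_comm_def Let_def r1_def\<close>)

text \<open>The swap of the two bases. At glued points either description of the point may be used,
  as both gluings identify \<open>y\<close> with \<open>f y\<close>; this is what
  \<open>\<phi>_i1\<close> and \<open>\<phi>_i2\<close> say together.\<close>

definition \<phi> :: "('x1 + 'x2) set \<Rightarrow> ('x2 + 'x1) set" where
  "\<phi> P = (if in2 Y f (base V2) P then H.i1 (out2 Y f (base V2) P) else H.i2 (out1 (base V1) Y f P))"

definition \<phi>' :: "('x2 + 'x1) set \<Rightarrow> ('x1 + 'x2) set" where
  "\<phi>' Q = (if in2 (f ` Y) f' (base V1) Q then G.i1 (out2 (f ` Y) f' (base V1) Q) else G.i2 (out1 (base V2) (f ` Y) f' Q))"

lemma \<phi>_i2: "x \<in> points (base V2) \<Longrightarrow> \<phi> (G.i2 x) = H.i1 x"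
  by (simp add: \<phi>_def)

lemma \<phi>_i1: "x \<in> points (base V1) \<Longrightarrow> \<phi> (G.i1 x) = H.i2 x"
  by (cases "x \<in> Y") (simp_all add: G.i1_Y \<phi>_i2 f_in H.i1_Y f'_f, simp add: \<phi>_def)

lemma \<phi>'_i2: "x \<in> points (base V1) \<Longrightarrow> \<phi>' (H.i2 x) = G.i1 x"
  by (simp add: \<phi>'_def)

lemma \<phi>'_i1: "x \<in> points (base V2) \<Longrightarrow> \<phi>' (H.i1 x) = G.i2 x"
proof (cases "x \<in> f ` Y")
  case True
  then obtain y where "y \<in> Y" "x = f y" by blast
  then show ?thesis using Y by (auto simp: H.i1_Y f'_f \<phi>'_i2 G.i1_Y)
qed (simp add: \<phi>'_def)

text \<open>Inverse of the restriction to \<open>V2\<close>: a fibre over \<open>G.i2\<close> is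
  entirely a copy of a fibre of \<open>V2\<close>, so \<open>out2\<close> reads off its
  elements.\<close>

definition e2 :: "'x2 \<times> ('v2 \<Rightarrow> real) \<Rightarrow> ('x1 + 'x2) set \<times> (('v1 + 'v2) set \<Rightarrow> real)" where
  "e2 \<eta> = (G.i2 (fst \<eta>), \<lambda>a\<in>fibre G.V (G.i2 (fst \<eta>)). snd \<eta> (out2 G.E F (tot V2) a))"

text \<open>Over \<open>Y\<close> the glued fibre is the one of \<open>V2\<close>, so the covector
  is first moved there by \<open>L'\<close>; elsewhere the fibre is a copy of that of
  \<open>V1\<close>.\<close>

definition e1 :: "'x1 \<times> ('v1 \<Rightarrow> real) \<Rightarrow> ('x1 + 'x2) set \<times> (('v1 + 'v2) set \<Rightarrow> real)" where
  "e1 \<eta> = (if fst \<eta> \<in> Y then e2 (L' \<eta>)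
     else (G.i1 (fst \<eta>), \<lambda>a\<in>fibre G.V (G.i1 (fst \<eta>)). snd \<eta> (out1 (tot V1) G.E F a)))"

lemma e2_j2: "w \<in> fibre V2 x \<Longrightarrow> snd (e2 (x, \<zeta>)) (G.j2 w) = \<zeta> w"
  by (simp add: e2_def G.j2_fibre fibre_points)

lemma e2_j1: "y \<in> Y \<Longrightarrow> v \<in> fibre V1 y \<Longrightarrow> snd (e2 (f y, \<zeta>)) (G.j1 v) = \<zeta> (F v)"
  by (simp add: G.j1_E G.fibre_E e2_j2 F_in)

lemma e2_in:
  assumes x: "x \<in> points (base V2)" and \<zeta>: "\<zeta> \<in> dual_space V2 x"
  shows "e2 (x, \<zeta>) \<in> points (tot A)"
proof -
  let ?\<xi> = "\<lambda>a. \<zeta> (out2 G.E F (tot V2) a)"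
  have val: "?\<xi> (G.j2 w) = \<zeta> w" if "w \<in> fibre V2 x" for w using that by (simp add: fibre_points)
  have "restrict ?\<xi> (fibre G.V (G.i2 x)) \<in> dual_space G.V (G.i2 x)"
  proof (rule G.snd.extend_dual[OF x \<zeta> G.closed_V[OF G.i2_in[OF x]] G.fibre_i2 val])
    fix k W p assume p: "plots (tot G.V) k W p" and fib: "p ` W \<subseteq> fibre G.V (G.i2 x)"
    show "Cinf_on k W (\<lambda>w. ?\<xi> (p w))"
    proof (rule G.Cinf_on_glue_plot[OF p])
      \<comment> \<open>A lift to \<open>V1\<close> of a plot in this fibre runs over
        \<open>Y\<close>. There it is \<open>G.j2\<close> of \<open>F (q u)\<close>, and
        \<open>F\<close> turns \<open>q\<close> into a plot of \<open>V2\<close>, on which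
        \<open>\<zeta>\<close> is smooth.\<close>
      fix W' q assume W': "W' \<subseteq> W" and q: "plots (tot V1) k W' q" and e: "\<And>u. u \<in> W' \<Longrightarrow> p u = G.j1 (q u)"
      have y: "proj V1 (q u) \<in> Y" "f (proj V1 (q u)) = x" "q u \<in> fibre V1 (proj V1 (q u))" if u: "u \<in> W'" for u
      proof -
        have qu: "q u \<in> points (tot V1)" by (rule plot_points[OF diffeologies(1) q u])
        have "G.j1 (q u) \<in> fibre G.V (G.i2 x)" using fib W' e[OF u] u by auto
        then have "G.i1 (proj V1 (q u)) = G.i2 x" using fibre_proj[of "G.j1 (q u)"] G.proj_j1[OF qu] by metis
        then show "proj V1 (q u) \<in> Y" "f (proj V1 (q u)) = x" by (simp_all add: inc1_eq_inc2_iff)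
        show "q u \<in> fibre V1 (proj V1 (q u))" using qu by (rule fibreI) simp
      qed
      have qE: "q ` W' \<subseteq> G.E" using y G.fibre_E by blast
      have Fq: "F (q u) \<in> fibre V2 x" if "u \<in> W'" for u using F_in[OF y(1,3)[OF that]] y(2)[OF that] by simp
      have "Cinf_on k W' (\<lambda>u. \<zeta> (F (q u)))"
        using Fq by (intro dual_space_plot[OF \<zeta> F_plot[OF q qE]]) auto
      then show "Cinf_on k W' (\<lambda>w. ?\<xi> (p w))"
      proof (rule Cinf_on_cong[rotated])
        fix u assume u: "u \<in> W'"
        have "q u \<in> G.E" using qE u by blast
        then have "p u = G.j2 (F (q u))" by (simp add: e[OF u] G.j1_E)
        then show "\<zeta> (F (q u)) = ?\<xi> (p u)" by (simp only: val[OF Fq[OF u]])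
      qed
    next
      fix W' q assume W': "W' \<subseteq> W" and q: "plots (tot V2) k W' q" and e: "\<And>u. u \<in> W' \<Longrightarrow> p u = G.j2 (q u)"
      have qf: "q u \<in> fibre V2 x" if u: "u \<in> W'" for u
      proof -
        have qu: "q u \<in> points (tot V2)" by (rule plot_points[OF diffeologies(3) q u])
        have "G.j2 (q u) \<in> fibre G.V (G.i2 x)" using fib W' e[OF u] u by auto
        then have "G.i2 (proj V2 (q u)) = G.i2 x" using fibre_proj[of "G.j2 (q u)"] G.proj_j2[OF qu] by metis
        then show ?thesis using qu by (intro fibreI) simp_all
      qed
      have "Cinf_on k W' (\<lambda>u. \<zeta> (q u))" using qf by (intro dual_space_plot[OF \<zeta> q]) auto
      then show "Cinf_on k W' (\<lambda>w. ?\<xi> (p w))"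
        by (rule Cinf_on_cong[rotated]) (simp only: e val[OF qf])
    qed
  qed
  then show ?thesis using G.i2_in[OF x] by (simp add: e2_def)
qed

lemma e1_spec:
  assumes x: "x \<in> points (base V1)" and \<zeta>: "\<zeta> \<in> dual_space V1 x"
  shows "e1 (x, \<zeta>) \<in> points (tot A)" "fst (e1 (x, \<zeta>)) = G.i1 x" "v \<in> fibre V1 x \<Longrightarrow> snd (e1 (x, \<zeta>)) (G.j1 v) = \<zeta> v"
proof -
  have "e1 (x, \<zeta>) \<in> points (tot A) \<and> fst (e1 (x, \<zeta>)) = G.i1 x \<and> (\<forall>v\<in>fibre V1 x. snd (e1 (x, \<zeta>)) (G.j1 v) = \<zeta> v)"
  proof (cases "x \<in> Y")
    case True
    obtain \<xi> where \<xi>: "\<xi> \<in> dual_space V2 (f x)" "L' (x, \<zeta>) = (f x, \<xi>)" "\<zeta> = (\<lambda>v\<in>fibre V1 x. \<xi> (F v))"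
      by (rule L'_spec[OF True \<zeta>])
    have e: "e1 (x, \<zeta>) = e2 (f x, \<xi>)" using True by (simp add: e1_def \<xi>(2))
    have "fst (e2 (f x, \<xi>)) = G.i1 x" using True by (simp add: e2_def G.i1_Y)
    moreover have "snd (e2 (f x, \<xi>)) (G.j1 v) = \<zeta> v" if "v \<in> fibre V1 x" for v
      using that True by (simp add: e2_j1 \<xi>(3))
    ultimately show ?thesis using e2_in[OF f_in[OF True] \<xi>(1)] unfolding e by blast
  next
    case False
    let ?\<xi> = "\<lambda>a. \<zeta> (out1 (tot V1) G.E F a)"
    have val: "?\<xi> (G.j1 v) = \<zeta> v" if "v \<in> fibre V1 x" for v
      using that False by (simp add: fibre_points G.fibre_E)
    have "restrict ?\<xi> (fibre G.V (G.i1 x)) \<in> dual_space G.V (G.i1 x)"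
    proof (rule G.fst.extend_dual[OF x \<zeta> G.closed_V[OF G.i1_in[OF x]] G.fibre_i1[OF False] val])
      fix k W p assume p: "plots (tot G.V) k W p" and fib: "p ` W \<subseteq> fibre G.V (G.i1 x)"
      show "Cinf_on k W (\<lambda>w. ?\<xi> (p w))"
      proof (rule G.Cinf_on_glue_plot[OF p])
        fix W' q assume W': "W' \<subseteq> W" and q: "plots (tot V1) k W' q" and e: "\<And>u. u \<in> W' \<Longrightarrow> p u = G.j1 (q u)"
        have qf: "q u \<in> fibre V1 x" if u: "u \<in> W'" for u
        proof -
          have qu: "q u \<in> points (tot V1)" by (rule plot_points[OF diffeologies(1) q u])
          have "G.j1 (q u) \<in> fibre G.V (G.i1 x)" using fib W' e[OF u] u by auto
          then have "G.i1 (proj V1 (q u)) = G.i1 x" using fibre_proj[of "G.j1 (q u)"] G.proj_j1[OF qu] by metis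
          then show ?thesis using qu by (intro fibreI) (simp_all add: inc1_inject[OF f_inj])
        qed
        have "Cinf_on k W' (\<lambda>u. \<zeta> (q u))" using qf by (intro dual_space_plot[OF \<zeta> q]) auto
        then show "Cinf_on k W' (\<lambda>w. ?\<xi> (p w))"
          by (rule Cinf_on_cong[rotated]) (simp only: e val[OF qf])
      next
        fix W' q assume W: "openin (Euclidean_space k) W'" "W' \<subseteq> W" and q: "plots (tot V2) k W' q"
          and e: "\<And>u. u \<in> W' \<Longrightarrow> p u = G.j2 (q u)"
        \<comment> \<open>No point of the second piece lies over \<open>G.i1 x\<close> with
          \<open>x\<close> outside \<open>Y\<close>, so this neighbourhood is empty and smoothness
          is trivial.\<close>
        have "False" if u: "u \<in> W'" for u
        proof -
          have qu: "q u \<in> points (tot V2)" by (rule plot_points[OF diffeologies(3) q u])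
          have "G.j2 (q u) \<in> fibre G.V (G.i1 x)" using fib W(2) e[OF u] u by auto
          then have "G.i1 x = G.i2 (proj V2 (q u))" using fibre_proj[of "G.j2 (q u)"] G.proj_j2[OF qu] by metis
          then show False using False by (simp add: inc1_eq_inc2_iff)
        qed
        then show "Cinf_on k W' (\<lambda>w. ?\<xi> (p w))"
          using Cinf_on_cong[OF _ Cinf_on_const[OF W(1), of 0]] by blast
      qed
    qed
    moreover have "snd (e1 (x, \<zeta>)) (G.j1 v) = \<zeta> v" if "v \<in> fibre V1 x" for v
      using False val[OF that] G.j1_fibre[OF that] by (simp add: e1_def)
    ultimately show ?thesis using G.i1_in[OF x] False by (simp add: e1_def)
  qed
  then show "e1 (x, \<zeta>) \<in> points (tot A)" "fst (e1 (x, \<zeta>)) = G.i1 x"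
    "v \<in> fibre V1 x \<Longrightarrow> snd (e1 (x, \<zeta>)) (G.j1 v) = \<zeta> v" by blast+
qed

definition \<Phi>' :: "(('x2 \<times> ('v2 \<Rightarrow> real)) + ('x1 \<times> ('v1 \<Rightarrow> real))) set \<Rightarrow> ('x1 + 'x2) set \<times> (('v1 + 'v2) set \<Rightarrow> real)" where
  "\<Phi>' a = (if in2 E' L (tot (dual V1)) a then e1 (out2 E' L (tot (dual V1)) a) else e2 (out1 (tot (dual V2)) E' L a))"

lemma \<Phi>'_j2: "\<eta> \<in> points (tot (dual V1)) \<Longrightarrow> \<Phi>' (H.j2 \<eta>) = e1 \<eta>"
  by (simp add: \<Phi>'_def del: dual_simps)

text \<open>On \<open>E'\<close> the definition takes the detour through \<open>L\<close> and
  \<open>e1\<close>; the latter applies \<open>L'\<close>, which undoes \<open>L\<close>.\<close>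

lemma \<Phi>'_j1:
  assumes \<eta>: "\<eta> \<in> points (tot (dual V2))"
  shows "\<Phi>' (H.j1 \<eta>) = e2 \<eta>"
proof (cases "\<eta> \<in> E'")
  case True
  then have "L \<eta> \<in> preim (dual V1) Y" using L_image by blast
  then have "L \<eta> \<in> points (tot (dual V1))" "fst (L \<eta>) \<in> Y" by (auto simp: preim_def)
  then show ?thesis using True by (simp add: H.j1_E \<Phi>'_j2 e1_def L'_L del: dual_simps)
qed (use \<eta> in \<open>simp add: \<Phi>'_def del: dual_simps\<close>)

lemma A_cases:
  assumes "a \<in> points (tot A)"
  obtains x \<xi> where "x \<in> points (base V1)" "x \<notin> Y" "\<xi> \<in> dual_space G.V (G.i1 x)" "a = (G.i1 x, \<xi>)"
  | x \<xi> where "x \<in> points (base V2)" "\<xi> \<in> dual_space G.V (G.i2 x)" "a = (G.i2 x, \<xi>)"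
proof -
  obtain P \<xi> where a: "a = (P, \<xi>)" "P \<in> points (base G.V)" "\<xi> \<in> dual_space G.V P" using assms by auto
  show thesis using a(2)
  proof (cases rule: G.base_cases)
    case (1 x)
    then show thesis using that(1)[of x \<xi>] a by simp
  next
    case (2 x)
    then show thesis using that(2)[of x \<xi>] a by simp
  qed
qed

lemma comm_in: "a \<in> points (tot A) \<Longrightarrow> \<Phi> a \<in> points (tot B)"
  by (elim A_cases) (simp_all add: comm_i1 comm_i2 r1_in r2_in H.j1_in H.j2_in)

lemma inv_comm: "a \<in> points (tot A) \<Longrightarrow> \<Phi>' (\<Phi> a) = a"
proof (elim A_cases)
  fix x \<xi> assume x: "x \<in> points (base V1)" "x \<notin> Y" and \<xi>: "\<xi> \<in> dual_space G.V (G.i1 x)" and a: "a = (G.i1 x, \<xi>)"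
  have "(\<lambda>b\<in>fibre G.V (G.i1 x). r1 x \<xi> (out1 (tot V1) G.E F b)) = \<xi>"
    using x(2) by (intro G.fst.res_eqI[OF dual_space_extensional[OF \<xi>] G.fibre_i1]) (simp_all add: fibre_points G.fibre_E)
  then show ?thesis using x r1_in[OF x(1) \<xi>] by (simp add: a comm_i1[OF x(1) \<xi>] \<Phi>'_j2 e1_def)
next
  fix x \<xi> assume x: "x \<in> points (base V2)" and \<xi>: "\<xi> \<in> dual_space G.V (G.i2 x)" and a: "a = (G.i2 x, \<xi>)"
  have "(\<lambda>b\<in>fibre G.V (G.i2 x). r2 x \<xi> (out2 G.E F (tot V2) b)) = \<xi>"
    by (intro G.snd.res_eqI[OF dual_space_extensional[OF \<xi>] G.fibre_i2]) (simp add: fibre_points)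
  then show ?thesis using x r2_in[OF x \<xi>] by (simp add: a comm_i2[OF x \<xi>] \<Phi>'_j1 e2_def)
qed

lemma comm_e2:
  assumes "\<eta> \<in> points (tot (dual V2))"
  shows "\<Phi> (e2 \<eta>) = H.j1 \<eta>"
proof -
  obtain x \<zeta> where \<eta>: "\<eta> = (x, \<zeta>)" "x \<in> points (base V2)" "\<zeta> \<in> dual_space V2 x" using assms by auto
  obtain \<xi> where e: "e2 (x, \<zeta>) = (G.i2 x, \<xi>)" by (simp add: e2_def)
  then have \<xi>: "\<xi> \<in> dual_space G.V (G.i2 x)" using e2_in[OF \<eta>(2,3)] by simp
  have "r2 x \<xi> = \<zeta>"
  proof (rule extensionalityI[OF _ dual_space_extensional[OF \<eta>(3)]])
    show "r2 x \<xi> \<in> extensional (fibre V2 x)" by (simp add: r2_def)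
    show "r2 x \<xi> v = \<zeta> v" if "v \<in> fibre V2 x" for v using that e2_j2[OF that, of \<zeta>] by (simp add: e r2_def)
  qed
  then show ?thesis by (simp add: \<eta>(1) e comm_i2[OF \<eta>(2) \<xi>])
qed

lemma comm_e1:
  assumes "\<eta> \<in> points (tot (dual V1))"
  shows "\<Phi> (e1 \<eta>) = H.j2 \<eta>"
proof -
  obtain x \<zeta> where \<eta>: "\<eta> = (x, \<zeta>)" "x \<in> points (base V1)" "\<zeta> \<in> dual_space V1 x" using assms by auto
  note e1 = e1_spec[OF \<eta>(2,3)]
  obtain \<xi> where e: "e1 (x, \<zeta>) = (G.i1 x, \<xi>)" using e1(2) by (metis prod.collapse)
  then have \<xi>: "\<xi> \<in> dual_space G.V (G.i1 x)" using e1(1) by simp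
  have "r1 x \<xi> = \<zeta>"
  proof (rule extensionalityI[OF _ dual_space_extensional[OF \<eta>(3)]])
    show "r1 x \<xi> \<in> extensional (fibre V1 x)" by (simp add: r1_def)
    show "r1 x \<xi> v = \<zeta> v" if "v \<in> fibre V1 x" for v using that e1(3)[OF that] by (simp add: e r1_def)
  qed
  then show ?thesis by (simp add: \<eta>(1) e comm_i1[OF \<eta>(2) \<xi>])
qed

lemma comm_inv: "b \<in> points (tot B) \<Longrightarrow> \<Phi> (\<Phi>' b) = b"
  by (elim H.tot_cases) (simp_all only: \<Phi>'_j1 \<Phi>'_j2 comm_e1 comm_e2)

section \<open>Smoothness of the commutativity map and of its inverse; the bundle
  isomorphism\<close>

lemma tot_A: "diffeology (tot A)" and tot_B: "diffeology (tot B)"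
  by (rule diffeology_dual G.diff_tot G.diff_base H.diff_tot)+

lemma \<phi>_smooth: "dsmooth (base A) (base B) \<phi>"
  unfolding dual_simps(2) G.base_V
proof (rule dsmooth_from_glue[OF diffeologies(2,4) H.diff_base])
  show "plots (base B) n U (\<lambda>u. \<phi> (G.i1 (q u)))" if q: "plots (base V1) n U q" for n U q
    using H.i2_plot[unfolded dual_simps(2), OF q]
    by (rule plot_cong[OF H.diff_base]) (simp add: \<phi>_i1 plot_points[OF diffeologies(2) q])
  show "plots (base B) n U (\<lambda>u. \<phi> (G.i2 (q u)))" if q: "plots (base V2) n U q" for n U q
    using H.i1_plot[unfolded dual_simps(2), OF q]
    by (rule plot_cong[OF H.diff_base]) (simp add: \<phi>_i2 plot_points[OF diffeologies(4) q])
qed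

lemma \<phi>'_smooth: "dsmooth (base B) (base A) \<phi>'"
  unfolding dual_simps(2) H.base_V
proof (rule dsmooth_from_glue[OF diffeologies(4,2) G.diff_base])
  show "plots (base G.V) n U (\<lambda>u. \<phi>' (H.i1 (q u)))" if q: "plots (base V2) n U q" for n U q
    using G.i2_plot[OF q]
    by (rule plot_cong[OF G.diff_base]) (simp add: \<phi>'_i1 plot_points[OF diffeologies(4) q])
  show "plots (base G.V) n U (\<lambda>u. \<phi>' (H.i2 (q u)))" if q: "plots (base V1) n U q" for n U q
    using G.i1_plot[OF q]
    by (rule plot_cong[OF G.diff_base]) (simp add: \<phi>'_i2 plot_points[OF diffeologies(2) q])
qed

text \<open>The base component lifts locally to one of the two bases. A lift to \<open>X1\<close>
  may run in and out of \<open>Y\<close>; the formulas \<open>comm_i1\<close> and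
  \<open>comm_i2\<close> hold throughout, so the map is a restriction of covectors followed by an
  inclusion.\<close>

lemma comm_smooth: "dsmooth (tot A) (tot B) \<Phi>"
proof (rule dsmoothI)
  fix m U q assume q: "plots (tot A) m U q"
  have U: "openin (Euclidean_space m) U" by (rule plot_open[OF tot_A q])
  have "locally_on m U (glue_lift (base V1) Y f (base V2) m (\<lambda>u. fst (q u)))"
    using dual_plot_base[OF G.diff_tot q] unfolding G.base_V glue_plots_iff[OF diffeologies(2,4)] by blast
  then show "plots (tot B) m U (\<lambda>u. \<Phi> (q u))"
  proof (intro plot_locally[OF tot_B U], elim locally_on_mono)
    fix W assume W: "openin (Euclidean_space m) W" "W \<subseteq> U" and "glue_lift (base V1) Y f (base V2) m (\<lambda>u. fst (q u)) W"
    then consider r where "plots (base V1) m W r" "\<forall>u\<in>W. fst (q u) = G.i1 (r u)"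
      | r where "plots (base V2) m W r" "\<forall>u\<in>W. fst (q u) = G.i2 (r u)"
      unfolding glue_lift_def by blast
    then show "plots (tot B) m W (\<lambda>u. \<Phi> (q u))"
    proof cases
      case (1 r)
      note qW = plot_subset[OF tot_A q W]
      have "plots (tot B) m W (\<lambda>u. H.j2 (r u, r1 (r u) (snd (q u))))"
        by (rule H.j2_plot[OF G.fst.res_plot[OF qW 1(1)]]) (use 1(2) in blast)
      then show ?thesis
      proof (rule plot_cong[OF tot_B])
        fix u assume u: "u \<in> W"
        have "q u = (G.i1 (r u), snd (q u))" using 1(2) u by (metis prod.collapse)
        moreover have "snd (q u) \<in> dual_space G.V (G.i1 (r u))"
          using plot_points[OF tot_A qW u] 1(2) u by (simp only: dual_points)
        ultimately show "H.j2 (r u, r1 (r u) (snd (q u))) = \<Phi> (q u)"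
          using comm_i1[OF plot_points[OF diffeologies(2) 1(1) u]] by metis
      qed
    next
      case (2 r)
      note qW = plot_subset[OF tot_A q W]
      have "plots (tot B) m W (\<lambda>u. H.j1 (r u, r2 (r u) (snd (q u))))"
        by (rule H.j1_plot[OF G.snd.res_plot[OF qW 2(1)]]) (use 2(2) in blast)
      then show ?thesis
      proof (rule plot_cong[OF tot_B])
        fix u assume u: "u \<in> W"
        have "q u = (G.i2 (r u), snd (q u))" using 2(2) u by (metis prod.collapse)
        moreover have "snd (q u) \<in> dual_space G.V (G.i2 (r u))"
          using plot_points[OF tot_A qW u] 2(2) u by (simp only: dual_points)
        ultimately show "H.j1 (r u, r2 (r u) (snd (q u))) = \<Phi> (q u)"
          using comm_i2[OF plot_points[OF diffeologies(4) 2(1) u]] by metis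
      qed
    qed
  qed
qed (rule comm_in)

lemma e2_plot:
  assumes q: "plots (tot (dual V2)) m U q"
  shows "plots (tot A) m U (\<lambda>u. e2 (q u))"
proof (rule dual_plotI[OF G.diff_tot])
  have qu: "fst (q u) \<in> points (base V2)" "snd (q u) \<in> dual_space V2 (fst (q u))" if "u \<in> U" for u
    using plot_points[OF dual2 q that] by (simp_all only: dual_points)
  have fst_e2: "fst (e2 \<eta>) = G.i2 (fst \<eta>)" for \<eta> by (simp add: e2_def)
  show "e2 (q u) \<in> points (tot A)" if "u \<in> U" for u
    using e2_in[OF qu[OF that]] by simp
  show "plots (base G.V) m U (\<lambda>u. fst (e2 (q u)))"
    unfolding fst_e2 by (rule G.i2_plot[OF dual_plot_base[OF diffeologies(3) q]])
  fix k W h p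
  assume h: "Cinf_map k W m h" "h ` W \<subseteq> U" and p: "plots (tot G.V) k W p"
    and eq: "\<And>w. w \<in> W \<Longrightarrow> fst (e2 (q (h w))) = proj G.V (p w)"
  show "Cinf_on k W (\<lambda>w. snd (e2 (q (h w))) (p w))"
  proof (rule G.Cinf_on_glue_plot[OF p])
    \<comment> \<open>A test plot through \<open>V1\<close> over points of the second base runs over
      \<open>Y\<close>; evaluating on it amounts to evaluating on the plot \<open>F (p1 u)\<close>
      of \<open>V2\<close>.\<close>
    fix W' p1 assume W': "openin (Euclidean_space k) W'" "W' \<subseteq> W" and p1: "plots (tot V1) k W' p1"
      and e: "\<And>u. u \<in> W' \<Longrightarrow> p u = G.j1 (p1 u)"
    note h' = Cinf_map_subset[OF h(1) W'(1,2)] order_trans[OF image_mono[OF W'(2)] h(2)]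
    have y: "proj V1 (p1 u) \<in> Y" "f (proj V1 (p1 u)) = fst (q (h u))" "p1 u \<in> fibre V1 (proj V1 (p1 u))" if u: "u \<in> W'" for u
    proof -
      have pu: "p1 u \<in> points (tot V1)" by (rule plot_points[OF diffeologies(1) p1 u])
      have "G.i1 (proj V1 (p1 u)) = G.i2 (fst (q (h u)))"
        using eq[OF subsetD[OF W'(2) u]] by (simp add: fst_e2 e[OF u] G.proj_j1[OF pu])
      then show "proj V1 (p1 u) \<in> Y" "f (proj V1 (p1 u)) = fst (q (h u))" by (simp_all add: inc1_eq_inc2_iff)
      show "p1 u \<in> fibre V1 (proj V1 (p1 u))" using pu by (rule fibreI) simp
    qed
    have pE: "p1 ` W' \<subseteq> G.E" using y G.fibre_E by blast
    have "Cinf_on k W' (\<lambda>u. snd (q (h u)) (F (p1 u)))"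
      by (rule dual_plot_eval[OF diffeologies(3) q h' F_plot[OF p1 pE]])
        (simp add: fibre_proj[OF F_in[OF y(1,3)]] y(2))
    then show "Cinf_on k W' (\<lambda>w. snd (e2 (q (h w))) (p w))"
    proof (rule Cinf_on_cong[rotated])
      fix u assume u: "u \<in> W'"
      have "q (h u) = (f (proj V1 (p1 u)), snd (q (h u)))" using y(2)[OF u] by (metis prod.collapse)
      then have "snd (e2 (q (h u))) (G.j1 (p1 u)) = snd (q (h u)) (F (p1 u))" using e2_j1[OF y(1,3)[OF u]] by metis
      then show "snd (q (h u)) (F (p1 u)) = snd (e2 (q (h u))) (p u)" by (simp only: e[OF u])
    qed
  next
    fix W' p2 assume W': "openin (Euclidean_space k) W'" "W' \<subseteq> W" and p2: "plots (tot V2) k W' p2"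
      and e: "\<And>u. u \<in> W' \<Longrightarrow> p u = G.j2 (p2 u)"
    note h' = Cinf_map_subset[OF h(1) W'(1,2)] order_trans[OF image_mono[OF W'(2)] h(2)]
    have y: "proj V2 (p2 u) = fst (q (h u))" "p2 u \<in> fibre V2 (fst (q (h u)))" if u: "u \<in> W'" for u
    proof -
      have pu: "p2 u \<in> points (tot V2)" by (rule plot_points[OF diffeologies(3) p2 u])
      have "G.i2 (proj V2 (p2 u)) = G.i2 (fst (q (h u)))"
        using eq[OF subsetD[OF W'(2) u]] by (simp add: fst_e2 e[OF u] G.proj_j2[OF pu])
      then show "proj V2 (p2 u) = fst (q (h u))" by simp
      then show "p2 u \<in> fibre V2 (fst (q (h u)))" using pu by (intro fibreI)
    qed
    have "Cinf_on k W' (\<lambda>u. snd (q (h u)) (p2 u))"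
      by (rule dual_plot_eval[OF diffeologies(3) q h' p2]) (simp add: y(1))
    then show "Cinf_on k W' (\<lambda>w. snd (e2 (q (h w))) (p w))"
    proof (rule Cinf_on_cong[rotated])
      fix u assume u: "u \<in> W'"
      show "snd (q (h u)) (p2 u) = snd (e2 (q (h u))) (p u)"
        using e2_j2[OF y(2)[OF u], of "snd (q (h u))"] by (simp add: e[OF u])
    qed
  qed
qed

text \<open>Although \<open>e1\<close> is defined by cases on \<open>Y\<close>, its values on
  \<open>G.j1\<close> are given by \<open>e1_spec\<close> throughout, which handles test plots
  through \<open>V1\<close>. Test plots through \<open>V2\<close> confine \<open>q\<close> to
  \<open>Y\<close>, where the smooth inverse of the dual lift is used.\<close>

lemma e1_plot:
  assumes q: "plots (tot (dual V1)) m U q"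
  shows "plots (tot A) m U (\<lambda>u. e1 (q u))"
proof (rule dual_plotI[OF G.diff_tot])
  have qu: "fst (q u) \<in> points (base V1)" "snd (q u) \<in> dual_space V1 (fst (q u))" if "u \<in> U" for u
    using plot_points[OF dual1 q that] by (simp_all only: dual_points)
  note spec = e1_spec[OF qu, unfolded prod.collapse]
  show "e1 (q u) \<in> points (tot A)" if "u \<in> U" for u by (rule spec(1)[OF that that])
  have "plots (base G.V) m U (\<lambda>u. G.i1 (fst (q u)))"
    by (rule G.i1_plot[OF dual_plot_base[OF diffeologies(1) q]])
  then show "plots (base G.V) m U (\<lambda>u. fst (e1 (q u)))"
    by (rule plot_cong[OF G.diff_base]) (simp only: spec(2))
  fix k W h p
  assume h: "Cinf_map k W m h" "h ` W \<subseteq> U" and p: "plots (tot G.V) k W p"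
    and eq: "\<And>w. w \<in> W \<Longrightarrow> fst (e1 (q (h w))) = proj G.V (p w)"
  have hw: "h w \<in> U" if "w \<in> W" for w using h(2) that by blast
  show "Cinf_on k W (\<lambda>w. snd (e1 (q (h w))) (p w))"
  proof (rule G.Cinf_on_glue_plot[OF p])
    fix W' p1 assume W': "openin (Euclidean_space k) W'" "W' \<subseteq> W" and p1: "plots (tot V1) k W' p1"
      and e: "\<And>u. u \<in> W' \<Longrightarrow> p u = G.j1 (p1 u)"
    note h' = Cinf_map_subset[OF h(1) W'(1,2)] order_trans[OF image_mono[OF W'(2)] h(2)]
    have hu: "h u \<in> U" if "u \<in> W'" for u using hw W'(2) that by blast
    have y: "proj V1 (p1 u) = fst (q (h u))" "p1 u \<in> fibre V1 (fst (q (h u)))" if u: "u \<in> W'" for u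
    proof -
      have pu: "p1 u \<in> points (tot V1)" by (rule plot_points[OF diffeologies(1) p1 u])
      have "G.i1 (proj V1 (p1 u)) = G.i1 (fst (q (h u)))"
        using eq[OF subsetD[OF W'(2) u]] by (simp only: spec(2)[OF hu[OF u] hu[OF u]] e[OF u] G.proj_j1[OF pu])
      \<comment> \<open>Injectivity of \<open>f\<close> makes \<open>G.i1\<close> injective also on
        \<open>Y\<close>, so equality in the glued base gives equality in the base of
        \<open>V1\<close>.\<close>
      then show "proj V1 (p1 u) = fst (q (h u))" by (simp add: inc1_inject[OF f_inj])
      then show "p1 u \<in> fibre V1 (fst (q (h u)))" using pu by (intro fibreI)
    qed
    have "Cinf_on k W' (\<lambda>u. snd (q (h u)) (p1 u))"
      by (rule dual_plot_eval[OF diffeologies(1) q h' p1]) (simp add: y(1))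
    then show "Cinf_on k W' (\<lambda>w. snd (e1 (q (h w))) (p w))"
    proof (rule Cinf_on_cong[rotated])
      fix u assume u: "u \<in> W'"
      show "snd (q (h u)) (p1 u) = snd (e1 (q (h u))) (p u)"
        unfolding e[OF u] by (rule spec(3)[OF hu[OF u] hu[OF u] y(2)[OF u], symmetric])
    qed
  next
    fix W' p2 assume W': "openin (Euclidean_space k) W'" "W' \<subseteq> W" and p2: "plots (tot V2) k W' p2"
      and e: "\<And>u. u \<in> W' \<Longrightarrow> p u = G.j2 (p2 u)"
    note h' = Cinf_map_subset[OF h(1) W'(1,2)] order_trans[OF image_mono[OF W'(2)] h(2)]
    have hu: "h u \<in> U" if "u \<in> W'" for u using hw W'(2) that by blast
    have y: "fst (q (h u)) \<in> Y" "f (fst (q (h u))) = proj V2 (p2 u)" "p2 u \<in> points (tot V2)" if u: "u \<in> W'" for u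
    proof -
      show pu: "p2 u \<in> points (tot V2)" by (rule plot_points[OF diffeologies(3) p2 u])
      have "G.i1 (fst (q (h u))) = G.i2 (proj V2 (p2 u))"
        using eq[OF subsetD[OF W'(2) u]] by (simp only: spec(2)[OF hu[OF u] hu[OF u]] e[OF u] G.proj_j2[OF pu])
      then show "fst (q (h u)) \<in> Y" "f (fst (q (h u))) = proj V2 (p2 u)" by (simp_all add: inc1_eq_inc2_iff)
    qed
    \<comment> \<open>On this neighbourhood \<open>q\<close> stays over \<open>Y\<close>, so it
      becomes a plot of \<open>dual V2\<close> that can be evaluated on the test plot
      \<open>p2\<close>.\<close>
    have q': "plots (tot (dual V2)) k W' (\<lambda>u. L' (q (h u)))"
      by (rule L'_plot[OF plot_compose[OF dual1 q h'] y(1)])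
    have L'u: "fst (L' (q (h u))) = proj V2 (p2 u)" if u: "u \<in> W'" for u
    proof -
      obtain \<xi> where "L' (fst (q (h u)), snd (q (h u))) = (f (fst (q (h u))), \<xi>)"
        by (rule L'_spec[OF y(1)[OF u] qu(2)[OF hu[OF u]]])
      then show ?thesis using y(2)[OF u] by simp
    qed
    have "Cinf_on k W' (\<lambda>u. snd (L' (q (h u))) (p2 u))"
      by (rule dual_plot_eval[OF diffeologies(3) q' Cinf_map_id[OF W'(1)] _ p2]) (simp_all add: L'u)
    then show "Cinf_on k W' (\<lambda>w. snd (e1 (q (h w))) (p w))"
    proof (rule Cinf_on_cong[rotated])
      fix u assume u: "u \<in> W'"
      have "p2 u \<in> fibre V2 (fst (L' (q (h u))))" using L'u[OF u] y(3)[OF u] by (intro fibreI) simp_all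
      from e2_j2[OF this, of "snd (L' (q (h u)))"]
      show "snd (L' (q (h u))) (p2 u) = snd (e1 (q (h u))) (p u)"
        by (simp add: e[OF u] e1_def y(1)[OF u])
    qed
  qed
qed

lemma inv_smooth: "dsmooth (tot B) (tot A) \<Phi>'"
  unfolding H.tot_V
proof (rule dsmooth_from_glue[OF dual2 dual1 tot_A])
  show "plots (tot A) n U (\<lambda>u. \<Phi>' (H.j1 (q u)))" if q: "plots (tot (dual V2)) n U q" for n U q
    using e2_plot[OF q] by (rule plot_cong[OF tot_A]) (simp only: \<Phi>'_j1 plot_points[OF dual2 q])
  show "plots (tot A) n U (\<lambda>u. \<Phi>' (H.j2 (q u)))" if q: "plots (tot (dual V1)) n U q" for n U q
    using e1_plot[OF q] by (rule plot_cong[OF tot_A]) (simp only: \<Phi>'_j2 plot_points[OF dual1 q])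
qed

sublocale iso: bundle_iso A B \<Phi> \<Phi>' \<phi> \<phi>'
proof unfold_locales
  show "diffeology (base A)" "diffeology (base B)" by (simp_all add: G.diff_base H.diff_base)
  show "dsmooth (base A) (base B) \<phi>" "dsmooth (base B) (base A) \<phi>'" by (rule \<phi>_smooth \<phi>'_smooth)+
  show "\<phi>' (\<phi> P) = P" if "P \<in> points (base A)" for P
    using that unfolding dual_simps(2)
    by (cases rule: G.base_cases) (simp_all add: \<phi>_i1 \<phi>_i2 \<phi>'_i1 \<phi>'_i2)
  show "\<phi> (\<phi>' Q) = Q" if "Q \<in> points (base B)" for Q
    using that by (cases rule: H.base_cases) (simp_all add: \<phi>_i1 \<phi>_i2 \<phi>'_i1 \<phi>'_i2)
  show "plots_extensional (tot A)" "plots_extensional (tot B)"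
    by (rule diffeology_extensional tot_A tot_B)+
  show "dsmooth (tot A) (tot B) \<Phi>" "dsmooth (tot B) (tot A) \<Phi>'" by (rule comm_smooth inv_smooth)+
  show "\<Phi>' (\<Phi> v) = v" if "v \<in> points (tot A)" for v by (rule inv_comm[OF that])
  show "\<Phi> (\<Phi>' w) = w" if "w \<in> points (tot B)" for w by (rule comm_inv[OF that])
  show "proj A v \<in> points (base A)" if "v \<in> points (tot A)" for v using that by (simp only: dual_points dual_simps(2,3))
  show "proj B (\<Phi> v) = \<phi> (proj A v)" if "v \<in> points (tot A)" for v
    using that
  proof (cases rule: A_cases)
    case (1 x \<xi>)
    then show ?thesis using r1_in[OF 1(1,3)] by (simp add: comm_i1 \<phi>_i1 H.proj_j2)
  next
    case (2 x \<xi>)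
    then show ?thesis using r2_in[OF 2(1,2)] by (simp add: comm_i2 \<phi>_i2 H.proj_j1)
  qed
  fix P assume "P \<in> points (base A)"
  then have P: "P \<in> points (base G.V)" by simp
  note cl = fibre_closed_dual[OF G.diff_tot G.closed_V[OF P] P]
  show "fibre_closed A P" by (rule cl)
  have fib: "fibre A P = Pair P ` dual_space G.V P" using P by (simp add: fibre_dual)
  from P show "\<Phi> (vzero A P) = vzero B (\<phi> P)"
  proof (cases rule: G.base_cases)
    case (1 x)
    have z: "(\<lambda>v\<in>fibre G.V (G.i1 x). 0) \<in> dual_space G.V (G.i1 x)"
      using cl unfolding fibre_closed_def fib by (auto simp: 1(3))
    then show ?thesis using comm_i1[OF 1(1) z] 1 by (simp add: \<phi>_i1 H.vzero_i2 G.fst.res_ops)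
  next
    case (2 x)
    have z: "(\<lambda>v\<in>fibre G.V (G.i2 x). 0) \<in> dual_space G.V (G.i2 x)"
      using cl unfolding fibre_closed_def fib by (auto simp: 2(2))
    then show ?thesis using comm_i2[OF 2(1) z] 2 by (simp add: \<phi>_i2 H.vzero_i1 G.snd.res_ops)
  qed
  fix v assume v: "v \<in> fibre A P"
  then obtain \<xi> where \<xi>: "v = (P, \<xi>)" "\<xi> \<in> dual_space G.V P" unfolding fib by blast
  show "\<Phi> (vscale A c v) = vscale B c (\<Phi> v)" for c
  proof -
    have "vscale A c v \<in> fibre A P" using cl v unfolding fibre_closed_def by blast
    then have s: "(\<lambda>a\<in>fibre G.V P. c * \<xi> a) \<in> dual_space G.V P" by (auto simp: \<xi> fib)
    from P show ?thesis
    proof (cases rule: G.base_cases)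
      case (1 x)
      have "(x, r1 x \<xi>) \<in> fibre (dual V1) x" using r1_in[OF 1(1)] \<xi>(2) 1 by (simp add: fibre_dual)
      then show ?thesis
        using comm_i1[OF 1(1)] s \<xi>(2) by (simp add: \<xi>(1) 1(3) H.vscale_j2 G.fst.res_ops)
    next
      case (2 x)
      have "(x, r2 x \<xi>) \<in> fibre (dual V2) x" using r2_in[OF 2(1)] \<xi>(2) 2 by (simp add: fibre_dual)
      then show ?thesis
        using comm_i2[OF 2(1)] s \<xi>(2) 2(1) by (simp add: \<xi>(1) 2(2) H.vscale_j1 G.snd.res_ops)
    qed
  qed
  fix w assume w: "w \<in> fibre A P"
  then obtain \<eta> where \<eta>: "w = (P, \<eta>)" "\<eta> \<in> dual_space G.V P" unfolding fib by blast
  have "vadd A v w \<in> fibre A P" using cl v w unfolding fibre_closed_def by blast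
  then have s: "(\<lambda>a\<in>fibre G.V P. \<xi> a + \<eta> a) \<in> dual_space G.V P" by (auto simp: \<xi> \<eta> fib)
  from P show "\<Phi> (vadd A v w) = vadd B (\<Phi> v) (\<Phi> w)"
  proof (cases rule: G.base_cases)
    case (1 x)
    have "(x, r1 x \<xi>) \<in> fibre (dual V1) x" "(x, r1 x \<eta>) \<in> fibre (dual V1) x"
      using r1_in[OF 1(1)] \<xi>(2) \<eta>(2) 1 by (simp_all add: fibre_dual)
    then show ?thesis
      using comm_i1[OF 1(1)] s \<xi>(2) \<eta>(2) H.vadd_j2[of "(x, r1 x \<xi>)" x "(x, r1 x \<eta>)"] by (simp add: \<xi>(1) \<eta>(1) 1(3) G.fst.res_ops)
  next
    case (2 x)
    have "(x, r2 x \<xi>) \<in> fibre (dual V2) x" "(x, r2 x \<eta>) \<in> fibre (dual V2) x"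
      using r2_in[OF 2(1)] \<xi>(2) \<eta>(2) 2 by (simp_all add: fibre_dual)
    then show ?thesis
      using comm_i2[OF 2(1)] s \<xi>(2) \<eta>(2) H.vadd_j1[of x "(x, r2 x \<xi>)" "(x, r2 x \<eta>)"] 2(1)
      by (simp add: \<xi>(1) \<eta>(1) 2(2) G.snd.res_ops)
  qed
qed

section \<open>Isometry with respect to the two dual pseudo-metrics\<close>

abbreviation "gV \<equiv> glue_metric V1 Y F f V2 g1 g2"
abbreviation "gA \<equiv> dual_metric G.V gV"
abbreviation "gB \<equiv> glue_dual_metric V1 Y F f V2 g1 g2"

lemma sym1: "x \<in> points (base V1) \<Longrightarrow> v \<in> fibre V1 x \<Longrightarrow> w \<in> fibre V1 x \<Longrightarrow> g1 x v w = g1 x w v"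
  and sym2: "x' \<in> points (base V2) \<Longrightarrow> v' \<in> fibre V2 x' \<Longrightarrow> w' \<in> fibre V2 x' \<Longrightarrow> g2 x' v' w' = g2 x' w' v'"
  using g1 g2 unfolding pseudo_metric_def by blast+

lemma gB_j2:
  "x \<in> points (base V1) \<Longrightarrow> \<xi> \<in> dual_space V1 x \<Longrightarrow> \<eta> \<in> dual_space V1 x \<Longrightarrow>
    gB (H.i2 x) (H.j2 (x, \<xi>)) (H.j2 (x, \<eta>)) = dual_metric V1 g1 x (x, \<xi>) (x, \<eta>)"
  unfolding glue_dual_metric_def by (rule H.glue_metric_j2) (simp_all add: fibre_dual)

lemma gB_j1:
  "x \<in> points (base V2) \<Longrightarrow> x \<notin> f ` Y \<Longrightarrow> \<xi> \<in> dual_space V2 x \<Longrightarrow> \<eta> \<in> dual_space V2 x \<Longrightarrow>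
    gB (H.i1 x) (H.j1 (x, \<xi>)) (H.j1 (x, \<eta>)) = dual_metric V2 g2 x (x, \<xi>) (x, \<eta>)"
  unfolding glue_dual_metric_def by (rule H.glue_metric_j1) (simp_all add: fibre_dual)

text \<open>The metric on the source is always computed from \<open>g2\<close> here. The target uses
  the dual of \<open>g2\<close> off the image of \<open>Y\<close> and the dual of \<open>g1\<close>
  over it, so only the second case involves compatibility.\<close>

lemma metric_i2:
  assumes x: "x \<in> points (base V2)" and \<xi>: "\<xi> \<in> dual_space G.V (G.i2 x)" and \<eta>: "\<eta> \<in> dual_space G.V (G.i2 x)"
  shows "gB (\<phi> (G.i2 x)) (\<Phi> (G.i2 x, \<xi>)) (\<Phi> (G.i2 x, \<eta>)) = gA (G.i2 x) (G.i2 x, \<xi>) (G.i2 x, \<eta>)"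
proof -
  note r\<xi> = r2_in[OF x \<xi>] and r\<eta> = r2_in[OF x \<eta>]
  have "(x, r2 x \<xi>) \<in> pairing V2 g2 ` fibre V2 x" "(x, r2 x \<eta>) \<in> pairing V2 g2 ` fibre V2 x"
    using r\<xi> r\<eta> by (simp_all add: pairing_surj[OF V2 g2 x])
  then obtain v w where v: "v \<in> fibre V2 x" "pairing V2 g2 v = (x, r2 x \<xi>)"
    and w: "w \<in> fibre V2 x" "pairing V2 g2 w = (x, r2 x \<eta>)" by (elim imageE) metis
  have val2: "dual_metric V2 g2 x (x, r2 x \<xi>) (x, r2 x \<eta>) = g2 x v w"
    using dual_metric_pairing[where V = V2 and g = g2 and x = x, OF sym2[OF x] v(1) w(1)] by (simp only: v(2) w(2))
  have gA: "gA (G.i2 x) (G.i2 x, \<xi>) (G.i2 x, \<eta>) = g2 x v w"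
    using G.snd.dual_metric_res[where g = g2 and g' = gV, OF x G.fibre_i2 pairing_surj[OF V2 g2 x] sym2[OF x] G.glue_metric_j2[OF x] \<xi> \<eta>]
    by (simp only: val2)
  show ?thesis
  proof (cases "x \<in> f ` Y")
    case False
    then show ?thesis
      by (simp only: gA \<phi>_i2[OF x] comm_i2[OF x \<xi>] comm_i2[OF x \<eta>] gB_j1[OF x False r\<xi> r\<eta>] val2)
  next
    case True
    then obtain y where y: "y \<in> Y" "x = f y" by blast
    have y1: "y \<in> points (base V1)" using y Y by blast
    have i2: "G.i2 x = G.i1 y" by (simp add: G.i1_Y[OF y(1)] y(2))
    have \<xi>1: "\<xi> \<in> dual_space G.V (G.i1 y)" and \<eta>1: "\<eta> \<in> dual_space G.V (G.i1 y)" using \<xi> \<eta> by (simp_all only: i2)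
    have L_r: "L (x, r2 x \<zeta>) = (y, r1 y \<zeta>)" for \<zeta>
      unfolding y(2) L_eq[OF y(1)] r1_def r2_def
      by (intro arg_cong[where f = "Pair y"] restrict_ext)
        (simp add: F_in[OF y(1)] G.j1_E G.fibre_E y(1))
    have "(y, r1 y \<xi>) \<in> pairing V1 g1 ` fibre V1 y" "(y, r1 y \<eta>) \<in> pairing V1 g1 ` fibre V1 y"
      using r1_in[OF y1 \<xi>1] r1_in[OF y1 \<eta>1] by (simp_all add: pairing_surj[OF V1 g1 y1])
    then obtain v1 w1 where v1: "v1 \<in> fibre V1 y" "pairing V1 g1 v1 = (y, r1 y \<xi>)"
      and w1: "w1 \<in> fibre V1 y" "pairing V1 g1 w1 = (y, r1 y \<eta>)" by (elim imageE) metis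
    \<comment> \<open>If \<open>u\<close> represents a covector on \<open>V1\<close>, then
      \<open>F u\<close> represents the corresponding covector on \<open>V2\<close>: both have the
      same image under \<open>L\<close> by compatibility, and \<open>L\<close> is injective on
      \<open>E'\<close>.\<close>
    have lift: "pairing V2 g2 (F u) = (x, r2 x \<zeta>)"
      if u: "u \<in> fibre V1 y" "pairing V1 g1 u = (y, r1 y \<zeta>)" and \<zeta>: "r2 x \<zeta> \<in> dual_space V2 x" for u \<zeta>
    proof (rule inj_onD[OF L_inj])
      show "L (pairing V2 g2 (F u)) = L (x, r2 x \<zeta>)"
        by (simp only: L_pairing[OF y(1) u(1)] u(2) L_r)
      show "pairing V2 g2 (F u) \<in> E'"
        unfolding E'_iff using pairing2_in[OF f_in[OF y(1)] F_in[OF y(1) u(1)]] y(1) by blast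
      show "(x, r2 x \<zeta>) \<in> E'" unfolding E'_iff using y \<zeta> by blast
    qed
    have Fv: "F v1 \<in> fibre V2 x" "F w1 \<in> fibre V2 x" using F_in[OF y(1)] v1(1) w1(1) y(2) by simp_all
    \<comment> \<open>Compatibility moves the value from \<open>g1\<close> to \<open>g2\<close>;
      independence of the preimages then replaces \<open>F v1\<close> and \<open>F w1\<close> by
      \<open>v\<close> and \<open>w\<close>.\<close>
    have "g1 y v1 w1 = g2 x (F v1) (F w1)"
      using compatible y v1(1) w1(1) by (simp add: compatible_def)
    also have "\<dots> = dual_metric V2 g2 x (pairing V2 g2 (F v1)) (pairing V2 g2 (F w1))"
      by (rule dual_metric_pairing[where V = V2 and g = g2 and x = x, OF sym2[OF x] Fv, symmetric])
    also have "\<dots> = g2 x v w" by (simp only: lift[OF v1 r\<xi>] lift[OF w1 r\<eta>] val2)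
    finally have "dual_metric V1 g1 y (pairing V1 g1 v1) (pairing V1 g1 w1) = g2 x v w"
      using dual_metric_pairing[where V = V1 and g = g1 and x = y, OF sym1[OF y1] v1(1) w1(1)] by (simp only:)
    then show ?thesis
      unfolding gA
      by (simp only: i2 \<phi>_i1[OF y1] comm_i1[OF y1 \<xi>1] comm_i1[OF y1 \<eta>1] gB_j2[OF y1 r1_in[OF y1 \<xi>1] r1_in[OF y1 \<eta>1]]
          v1(2) w1(2))
  qed
qed

lemma metric_i1:
  assumes x: "x \<in> points (base V1)" "x \<notin> Y" and \<xi>: "\<xi> \<in> dual_space G.V (G.i1 x)" and \<eta>: "\<eta> \<in> dual_space G.V (G.i1 x)"
  shows "gB (\<phi> (G.i1 x)) (\<Phi> (G.i1 x, \<xi>)) (\<Phi> (G.i1 x, \<eta>)) = gA (G.i1 x) (G.i1 x, \<xi>) (G.i1 x, \<eta>)"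
proof -
  note r\<xi> = r1_in[OF x(1) \<xi>] and r\<eta> = r1_in[OF x(1) \<eta>]
  show ?thesis
    using G.fst.dual_metric_res[where g = g1 and g' = gV, OF x(1) G.fibre_i1[OF x(2)] pairing_surj[OF V1 g1 x(1)] sym1[OF x(1)]
        G.glue_metric_j1[OF x] \<xi> \<eta>]
    by (simp only: \<phi>_i1[OF x(1)] comm_i1[OF x(1) \<xi>] comm_i1[OF x(1) \<eta>] gB_j2[OF x(1) r\<xi> r\<eta>])
qed

sublocale isometry: isometric_bundle_iso A B \<Phi> \<Phi>' \<phi> \<phi>' gA gB
proof unfold_locales
  fix P v w assume "P \<in> points (base A)" and "v \<in> fibre A P" "w \<in> fibre A P"
  then have P: "P \<in> points (base G.V)" and "v \<in> Pair P ` dual_space G.V P" "w \<in> Pair P ` dual_space G.V P"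
    by (simp_all add: fibre_dual)
  then obtain \<xi> \<eta> where e: "v = (P, \<xi>)" "w = (P, \<eta>)" and d: "\<xi> \<in> dual_space G.V P" "\<eta> \<in> dual_space G.V P" by blast
  from P show "gB (\<phi> P) (\<Phi> v) (\<Phi> w) = gA P v w"
  proof (cases rule: G.base_cases)
    case (1 x)
    show ?thesis using d unfolding e 1(3) by (rule metric_i1[OF 1(1,2)])
  next
    case (2 x)
    show ?thesis using d unfolding e 2(2) by (rule metric_i2[OF 2(1)])
  qed
qed

end

theorem theorem6p1:
  fixes V1 :: "('v1, 'x1) pbundle" and V2 :: "('v2, 'x2) pbundle"
    and Y :: "'x1 set" and f :: "'x1 \<Rightarrow> 'x2" and F :: "'v1 \<Rightarrow> 'v2"
    and g1 :: "'x1 \<Rightarrow> 'v1 \<Rightarrow> 'v1 \<Rightarrow> real" and g2 :: "'x2 \<Rightarrow> 'v2 \<Rightarrow> 'v2 \<Rightarrow> real"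
  assumes "pseudo_bundle V1" and "bounded_dim V1" and "locally_trivial V1"
    and "pseudo_bundle V2" and "bounded_dim V2" and "locally_trivial V2"
    and "gluing V1 Y F f V2"
    and "diffeomorphism (subset_ds (base V1) Y) (subset_ds (base V2) (f ` Y)) f"
    and "diffeomorphism (subset_ds (tot (dual V2)) (preim (dual V2) (f ` Y)))
           (subset_ds (tot (dual V1)) (dual_lift V1 Y F f ` preim (dual V2) (f ` Y)))
           (dual_lift V1 Y F f)"
    and "pseudo_metric V1 g1" and "pseudo_metric V2 g2"
    and "compatible V1 Y F f g1 g2"
  shows "let V = glue_bundle V1 Y F f V2;
             A = dual V;
             gA = dual_metric V (glue_metric V1 Y F f V2 g1 g2);
             B = glue_dual V1 Y F f V2;
             gB = glue_dual_metric V1 Y F f V2 g1 g2;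
             \<Phi> = gluing_dual_comm V1 Y F f V2
         in \<exists>\<Theta>. \<Theta> \<in> points (cl_ds A gA) \<rightarrow>\<^sub>E points (cl_ds B gB) \<and>
              (\<forall>t\<in>points (tensor_ds A). \<Theta> (cl_proj A gA t) = cl_proj B gB (tensor_map A B \<Phi> t)) \<and>
              (\<forall>\<Theta>'. \<Theta>' \<in> points (cl_ds A gA) \<rightarrow>\<^sub>E points (cl_ds B gB) \<and>
                 (\<forall>t\<in>points (tensor_ds A). \<Theta>' (cl_proj A gA t) = cl_proj B gB (tensor_map A B \<Phi> t))
                 \<longrightarrow> \<Theta>' = \<Theta>) \<and>
              diffeomorphism (cl_ds A gA) (cl_ds B gB) \<Theta>"
proof -
  interpret metric_gluing V1 V2 Y f F g1 g2
    by unfold_locales fact+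
  show ?thesis
    unfolding Let_def B_eq by (rule isometry.clifford_diffeomorphism)
qed

end
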